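(* Let $1\le k\le d$ be integers and let $M\subset\mathbb R^d$ be a smooth submanifold of dimension $k$, with smooth volume measure $\lambda_M$. If $\lambda_M$-almost every point of $M$ is nondegenerate, then $\mathrm{VWA}_M(\psi_{c(k,d)})$ is a $\lambda_M$-nullset. More generally, let $\Psi:U\to M$ be a local parameterization of $M$ (with $U\subset\mathbb R^k$ open), let $\mu$ be an absolutely friendly measure on $U$, and let $\nu=\Psi[\mu]$ be the pushforward of $\mu$ under $\Psi$. If $\nu$-almost every point of $M$ is nondegenerate, then $\mathrm{VWA}_M(\psi_{c(k,d)})$ is a $\nu$-nullset.
   Context: $\mathbb N=\{1,2,\dots\}$, $\mathbb N_0=\mathbb N\cup\{0\}$. $\mathbb R^d$ and $\mathbb R^k$ carry the distance $\mathrm{dist}$ given by the max norm; $B(\mathbf x,\rho)$ is the closed ball, and $S^{(\epsilon)}$ is the closed $\epsilon$-thickening of a set $S$. A local parameterization of $M$ is a diffeomorphism from an open subset of $\mathbb R^k$ onto an open subset of $M$. Height: for $\mathbf r\in\mathbb Q^d$ write $\mathbf r=\mathbf p/q$ in reduced form ($\mathbf p\in\mathbb Z^d$, $q\in\mathbb N$, no common factor of $q$ and all the coordinates of $\mathbf p$); $H(\mathbf r):=q$. For $c>0$, $\psi_c(t):=t^{-c}$. For $c>0$, $\mathrm{VWA}_M(\psi_c)$ is the set of $\mathbf x\in M$ for which there exist $\epsilon>0$ and a sequence $(\mathbf r_n)$ in $\mathbb Q^d\cap M$ such that $\mathbf r_n\to\mathbf x$ and $\mathrm{dist}(\mathbf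 x,\mathbf r_n)\le\psi_{c+\epsilon}(H(\mathbf r_n))$ for all $n$. The constant $c(k,d)$: let $[n,m]:=\binom{n+m}{m}$. Let $n_{k,d}\in\mathbb N$ be maximal such that $d=[k-1,1]+[k-1,2]+\dots+[k-1,n_{k,d}]+m_{k,d}$ for some $m_{k,d}\ge 0$, and let $m_{k,d}$ be the unique integer satisfying this. Put $N_{k,d}:=1[k-1,1]+2[k-1,2]+\dots+n_{k,d}[k-1,n_{k,d}]+(n_{k,d}+1)m_{k,d}$ and $c(k,d):=(d+1)/N_{k,d}$. Nondegeneracy: for $\mathbf x\in M$, $j\in\mathbb N$ and a local parameterization $\Phi:U'\to M$ with $\Phi(\mathbf v)=\mathbf x$, let $T^{(j)}_{\mathbf x}(M)=\mathrm{Span}\{\partial^\alpha\Phi(\mathbf v):\alpha\in\mathbb N_0^k,\ 0<|\alpha|\le j\}\subset\mathbb R^d$. A point $\mathbf x\in M$ is nondegenerate if $T^{(D)}_{\mathbf x}(M)=\mathbb R^d$ for some $D\in\mathbb N$. Absolutely friendly measures: measures are locally finite Borel measures, and for a measure $\mu$ on $U$ and a ball $B$, $\mu(B)$ means $\mu(B\cap U)$. A measure $\mu$ on an open set $U\subset\mathbb R^k$ is absolutely decaying if there exist $C,\alpha>0$ such that for all $\mathbf x\in\mathrm{Supp}(\mu)$, all $0<\rho\le1$ with $B(\mathbf x,\rho)\subset U$, all $\epsilon>0$ and every affine hyperplane $\mathcal L\subset\mathbb R^k$, $\mu(\mathcal L^{(\epsilon\rho)}\cap B(\mathbf x,\rho))\le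 C\epsilon^\alpha\mu(B(\mathbf x,\rho))$. $\mu$ is doubling if there is a constant $C'$ with $\mu(B(\mathbf x,2\rho))\le C'\mu(B(\mathbf x,\rho))$ for all $\mathbf x\in\mathrm{Supp}(\mu)$ and $0<\rho\le1$. $\mu$ is absolutely friendly if it is both absolutely decaying and doubling. *)

theory Defs
  imports "HOL-Analysis.Analysis"
begin

section \<open>The max-norm metric\<close>

abbreviation maxdist :: "real^'n \<Rightarrow> real^'n \<Rightarrow> real" where
  "maxdist x y \<equiv> infnorm (x - y)"

definition max_cball :: "real^'n \<Rightarrow> real \<Rightarrow> (real^'n) set" where
  "max_cball x \<rho> = {y. maxdist y x \<le> \<rho>}"

definition thickening :: "(real^'n) set \<Rightarrow> real \<Rightarrow> (real^'n) set" where
  "thickening S \<epsilon> = {y. S \<noteq> {} \<and> (INF s\<in>S. maxdist y s) \<le> \<epsilon>}"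


section \<open>Partial derivatives and smooth maps\<close>

definition partial_deriv ::
    "'n::finite \<Rightarrow> (real^'n \<Rightarrow> 'b::real_normed_vector) \<Rightarrow> real^'n \<Rightarrow> 'b" where
  "partial_deriv i f = (\<lambda>x. frechet_derivative f (at x) (axis i 1))"

definition iter_partial ::
    "'n::finite list \<Rightarrow> (real^'n \<Rightarrow> 'b::real_normed_vector) \<Rightarrow> real^'n \<Rightarrow> 'b" where
  "iter_partial is f = foldr partial_deriv is f"

text \<open>
  The derivative for a multi-index \<open>\<alpha>\<close>, in which every coordinate direction \<open>i\<close> occurs \<open>\<alpha> i\<close> times.
  It is only applied to smooth maps, for which the order of the directions is immaterial; since a
  finite index type carries no order, an arbitrary order is selected.
\<close>

definition multi_partial ::
    "('n::finite \<Rightarrow> nat) \<Rightarrow> (real^'n \<Rightarrow> 'b::real_normed_vector) \<Rightarrow> real^'n \<Rightarrow> 'b" where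
  "multi_partial \<alpha> f = iter_partial (SOME is. \<forall>i. count_list is i = \<alpha> i) f"

text \<open>
  \<open>C\<^sup>\<infinity>\<close> on an open set: all iterated partial derivatives exist and are differentiable, hence
  continuous. On an arbitrary set, a map is smooth if it extends locally to a smooth map on an
  open set.
\<close>

definition smooth_on_open ::
    "(real^'n) set \<Rightarrow> (real^'n \<Rightarrow> 'b::real_normed_vector) \<Rightarrow> bool" where
  "smooth_on_open W f \<longleftrightarrow> open W \<and> (\<forall>is. iter_partial is f differentiable_on W)"

definition smooth_map_on ::
    "(real^'n) set \<Rightarrow> (real^'n \<Rightarrow> 'b::real_normed_vector) \<Rightarrow> bool" where
  "smooth_map_on S f \<longleftrightarrow>
     (\<forall>x\<in>S. \<exists>W g. x \<in> W \<and> smooth_on_open W g \<and> (\<forall>y\<in>S \<inter> W. g y = f y))"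

definition diffeomorphism ::
    "(real^'m) set \<Rightarrow> (real^'n) set \<Rightarrow> (real^'m \<Rightarrow> real^'n) \<Rightarrow> bool" where
  "diffeomorphism S T f \<longleftrightarrow>
     bij_betw f S T \<and> smooth_map_on S f \<and> smooth_map_on T (inv_into S f)"


section \<open>Submanifolds, volume and nondegeneracy\<close>

definition local_parameterization ::
    "(real^'d) set \<Rightarrow> (real^'k) set \<Rightarrow> (real^'k \<Rightarrow> real^'d) \<Rightarrow> bool" where
  "local_parameterization M U \<Phi> \<longleftrightarrow>
     open U \<and> openin (top_of_set M) (\<Phi> ` U) \<and> diffeomorphism U (\<Phi> ` U) \<Phi>"

text \<open>The dimension of the submanifold is the cardinality of the index type \<open>'k\<close>.\<close>

definition smooth_submanifold :: "'k::finite itself \<Rightarrow> (real^'d) set \<Rightarrow> bool" where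
  "smooth_submanifold _ M \<longleftrightarrow>
     (\<forall>x\<in>M. \<exists>(U :: (real^'k) set) \<Phi>. local_parameterization M U \<Phi> \<and> x \<in> \<Phi> ` U)"

definition jacobian_volume :: "(real^'k \<Rightarrow> real^'d) \<Rightarrow> real^'k \<Rightarrow> real" where
  "jacobian_volume \<Phi> v =
     (let J = matrix (frechet_derivative \<Phi> (at v)) in sqrt (det (transpose J ** J)))"

text \<open>
  The Riemannian volume measure of a \<open>k\<close>-dimensional submanifold is the unique Borel measure on it
  that is given by the area formula in every local parameterization.
\<close>

definition volume_measure_on ::
    "'k::finite itself \<Rightarrow> (real^'d) set \<Rightarrow> (real^'d) measure \<Rightarrow> bool" where
  "volume_measure_on _ M vol \<longleftrightarrow>
     sets vol = sets (restrict_space borel M) \<and>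
     (\<forall>(U :: (real^'k) set) \<Phi>. local_parameterization M U \<Phi> \<longrightarrow>
        (\<forall>A. A \<in> sets borel \<and> A \<subseteq> U \<longrightarrow>
           emeasure vol (\<Phi> ` A) = (\<integral>\<^sup>+v\<in>A. ennreal (jacobian_volume \<Phi> v) \<partial>lborel)))"

definition osculating_space :: "nat \<Rightarrow> (real^'k \<Rightarrow> real^'d) \<Rightarrow> real^'k \<Rightarrow> (real^'d) set" where
  "osculating_space j \<Phi> v =
     span {multi_partial \<alpha> \<Phi> v | \<alpha>. 0 < (\<Sum>i\<in>UNIV. \<alpha> i) \<and> (\<Sum>i\<in>UNIV. \<alpha> i) \<le> j}"

text \<open>The osculating spaces at a point do not depend on the choice of the parameterization.\<close>

definition nondegenerate_point :: "'k::finite itself \<Rightarrow> (real^'d) set \<Rightarrow> real^'d \<Rightarrow> bool" where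
  "nondegenerate_point _ M x \<longleftrightarrow>
     (\<exists>(U :: (real^'k) set) \<Phi> v D. local_parameterization M U \<Phi> \<and> v \<in> U \<and> \<Phi> v = x \<and>
        D \<ge> 1 \<and> osculating_space D \<Phi> v = UNIV)"


section \<open>Intrinsic approximation\<close>

definition rational_points :: "(real^'d) set" where
  "rational_points = {r. \<forall>i. r $ i \<in> \<rat>}"

definition height :: "real^'d \<Rightarrow> nat" where
  "height r = (THE q. q \<ge> 1 \<and>
     (\<exists>p :: int^'d. r = (\<chi> i. real_of_int (p $ i) / real q) \<and>
        Gcd (insert (int q) (range (\<lambda>i. p $ i))) = 1))"

definition psi :: "real \<Rightarrow> real \<Rightarrow> real" where
  "psi c t = t powr (- c)"

definition VWA :: "(real^'d) set \<Rightarrow> real \<Rightarrow> (real^'d) set" where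
  "VWA M c = {x \<in> M. \<exists>\<epsilon>>0. \<exists>r :: nat \<Rightarrow> real^'d.
     (\<forall>n. r n \<in> rational_points \<inter> M) \<and> r \<longlonglongrightarrow> x \<and>
     (\<forall>n. maxdist x (r n) \<le> psi (c + \<epsilon>) (real (height (r n))))}"


section \<open>The exponent\<close>

definition bracket :: "nat \<Rightarrow> nat \<Rightarrow> nat" where
  "bracket n m = (n + m) choose m"

definition n_kd :: "nat \<Rightarrow> nat \<Rightarrow> nat" where
  "n_kd k d = (GREATEST n. n \<ge> 1 \<and> (\<exists>m. d = (\<Sum>j=1..n. bracket (k - 1) j) + m))"

definition m_kd :: "nat \<Rightarrow> nat \<Rightarrow> nat" where
  "m_kd k d = (THE m. d = (\<Sum>j=1..n_kd k d. bracket (k - 1) j) + m)"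

definition N_kd :: "nat \<Rightarrow> nat \<Rightarrow> nat" where
  "N_kd k d = (\<Sum>j=1..n_kd k d. j * bracket (k - 1) j) + (n_kd k d + 1) * m_kd k d"

definition c_kd :: "nat \<Rightarrow> nat \<Rightarrow> real" where
  "c_kd k d = (real d + 1) / real (N_kd k d)"


section \<open>Absolutely friendly measures\<close>

definition locally_finite_borel_measure :: "(real^'k) set \<Rightarrow> (real^'k) measure \<Rightarrow> bool" where
  "locally_finite_borel_measure U \<mu> \<longleftrightarrow>
     sets \<mu> = sets (restrict_space borel U) \<and>
     (\<forall>x\<in>U. \<exists>W. open W \<and> x \<in> W \<and> emeasure \<mu> (W \<inter> U) < \<infinity>)"

definition measure_support :: "(real^'k) set \<Rightarrow> (real^'k) measure \<Rightarrow> (real^'k) set" where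
  "measure_support U \<mu> = {x \<in> U. \<forall>W. open W \<and> x \<in> W \<longrightarrow> emeasure \<mu> (W \<inter> U) > 0}"

definition absolutely_decaying :: "(real^'k) set \<Rightarrow> (real^'k) measure \<Rightarrow> bool" where
  "absolutely_decaying U \<mu> \<longleftrightarrow>
     (\<exists>C>0. \<exists>\<alpha>>0. \<forall>x\<in>measure_support U \<mu>. \<forall>\<rho>. 0 < \<rho> \<and> \<rho> \<le> 1 \<and> max_cball x \<rho> \<subseteq> U \<longrightarrow>
        (\<forall>\<epsilon>>0. \<forall>a b. a \<noteq> 0 \<longrightarrow>
           emeasure \<mu> (thickening {y. a \<bullet> y = b} (\<epsilon> * \<rho>) \<inter> max_cball x \<rho> \<inter> U)
             \<le> ennreal (C * \<epsilon> powr \<alpha>) * emeasure \<mu> (max_cball x \<rho> \<inter> U)))"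

definition doubling :: "(real^'k) set \<Rightarrow> (real^'k) measure \<Rightarrow> bool" where
  "doubling U \<mu> \<longleftrightarrow>
     (\<exists>C>0. \<forall>x\<in>measure_support U \<mu>. \<forall>\<rho>. 0 < \<rho> \<and> \<rho> \<le> 1 \<longrightarrow>
        emeasure \<mu> (max_cball x (2 * \<rho>) \<inter> U) \<le> ennreal C * emeasure \<mu> (max_cball x \<rho> \<inter> U))"

definition absolutely_friendly :: "(real^'k) set \<Rightarrow> (real^'k) measure \<Rightarrow> bool" where
  "absolutely_friendly U \<mu> \<longleftrightarrow>
     locally_finite_borel_measure U \<mu> \<and> absolutely_decaying U \<mu> \<and> doubling U \<mu>"

definition pushforward_on ::
    "(real^'d) set \<Rightarrow> (real^'k \<Rightarrow> real^'d) \<Rightarrow> (real^'k) measure \<Rightarrow> (real^'d) measure" where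
  "pushforward_on M \<Psi> \<mu> = distr \<mu> (restrict_space borel M) \<Psi>"

end

theory Submission
  imports Defs
begin

text \<open>
  The problem is local: let \<open>\<Psi>\<close> be a parameterization, \<open>u\<close> a parameter whose image is a nondegenerate
  point, \<open>k\<close> and \<open>d\<close> the dimensions of the manifold and of the ambient space, \<open>N\<close> the number
  \<open>N_kd k d\<close>, and \<open>c = (d + 1) / N\<close> the critical exponent. Fix \<open>\<epsilon> > 0\<close> and consider the rational points
  on the manifold whose height is between \<open>T = 2^n\<close> and \<open>2 T\<close>. By the lemma of Borel and Cantelli it
  suffices that the parameters \<open>v\<close> near \<open>u\<close> for which \<open>\<Psi> v\<close> has distance at most \<open>T powr -(c + \<epsilon>)\<close> from
  one of these points form a set whose measure decays exponentially in \<open>n\<close>. Two scales matter: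
  \<open>\<sigma> = T powr -(c + \<epsilon>/2)\<close> and \<open>\<delta> = T powr -(c + \<epsilon>)\<close>, with \<open>\<delta> / \<sigma> = T powr -(\<epsilon>/2)\<close>.

  Arithmetic. All the rational points under consideration whose parameters lie in one cube of radius \<open>\<sigma>\<close>
  lie on a single affine hyperplane (\<open>rational_points_on_hyperplane\<close>). For \<open>d + 1\<close> of them, the
  determinant of their homogeneous coordinates is a rational number with denominator at most
  \<open>(2 T)^(d + 1)\<close>. On the other hand, if every row is replaced by its Taylor expansion at the centre and
  the determinant is expanded, a monomial used in two rows contributes nothing. A surviving term therefore
  uses at best the constant, the \<open>k\<close> linear monomials, all the quadratic monomials and so on, and its total
  degree is at least \<open>N\<close>: this is where the exponent comes from. So the determinant is of order
  \<open>\<sigma>^N\<close>, which for large \<open>n\<close> is much smaller than \<open>T powr -(d + 1)\<close>, and it has to vanish.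

  Measure. A parameter \<open>v\<close> in such a cube that is close to one of these rational points is therefore
  within a constant multiple of \<open>\<delta>\<close> of a zero of \<open>f = a \<bullet> \<Psi> - b\<close>, for some fixed \<open>a \<noteq> 0\<close> and \<open>b\<close>.
  Nondegeneracy says that some derivative of \<open>f\<close> of bounded order does not vanish, and this makes it
  possible to rescale \<open>f\<close> to a function on the unit cube with bounded derivatives, one of which is bounded below; there
  \<open>\<bar>f\<bar>\<close> is at most a multiple of \<open>\<delta> / \<sigma>\<close> at \<open>v\<close>. Where a function is small but its gradient is not,
  it is nearly affine at a suitable smaller scale, and absolute decay bounds the measure; where the gradient
  is small as well, pass to a partial derivative and induct on the order of the derivative that is bounded
  below (\<open>sublevel_measure\<close>). The result is a bound \<open>(\<delta> / \<sigma>) powr \<gamma>\<close> for the proportion of bad parameters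
  in each cube. Summing over a cover of bounded multiplicity (\<open>emeasure_le_by_grid\<close>) gives the decay in \<open>n\<close>.

  Two points remain. Nondegeneracy is defined by means of an arbitrary parameterization, so the order of
  vanishing of a function has to be invariant under smooth changes of variables
  (\<open>nondegenerate_point_parameterization\<close>). And the volume measure has, in each parameterization, a positive
  density with respect to Lebesgue measure. The latter decays near hyperplanes, so the same argument
  covers the volume measure (\<open>AE_not_VWA\<close>).
\<close>

section \<open>Cubes and iterated partial derivatives\<close>

lemma mem_max_cball: "y \<in> max_cball x \<rho> \<longleftrightarrow> (\<forall>i. \<bar>y $ i - x $ i\<bar> \<le> \<rho>)"
  unfolding max_cball_def infnorm_Max
  by (auto simp: Basis_vec_def cart_eq_inner_axis[symmetric] inner_axis)

lemma max_cball_eq_cbox: "max_cball x \<rho> = cbox (\<chi> i. x $ i - \<rho>) (\<chi> i. x $ i + \<rho>)"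
  by (auto simp: mem_max_cball mem_box_cart abs_le_iff algebra_simps)

lemma convex_max_cball [simp]: "convex (max_cball x \<rho>)"
  by (simp add: max_cball_eq_cbox)

lemma compact_max_cball [simp]: "compact (max_cball x \<rho>)"
  by (simp add: max_cball_eq_cbox compact_cbox)

lemma closed_max_cball [simp]: "closed (max_cball x \<rho>)"
  by (simp add: max_cball_eq_cbox closed_cbox)

lemma max_cball_borel [simp, measurable]: "max_cball x \<rho> \<in> sets borel"
  by (simp add: borel_closed)

lemma max_cball_mono: "\<rho> \<le> \<rho>' \<Longrightarrow> max_cball x \<rho> \<subseteq> max_cball x \<rho>'"
  by (auto simp: mem_max_cball) (meson order_trans)

lemma max_cball_trans:
  assumes "y \<in> max_cball x a" "z \<in> max_cball y b" "a + b \<le> c"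
  shows "z \<in> max_cball x c"
  unfolding mem_max_cball
proof
  fix i
  have "\<bar>y $ i - x $ i\<bar> \<le> a" "\<bar>z $ i - y $ i\<bar> \<le> b"
    using assms by (auto simp: mem_max_cball)
  then show "\<bar>z $ i - x $ i\<bar> \<le> c" using assms(3) by linarith
qed

lemma cball_subset_max_cball: "cball x \<rho> \<subseteq> max_cball x \<rho>"
proof
  fix y assume "y \<in> cball x \<rho>"
  then have "norm (y - x) \<le> \<rho>" by (simp add: dist_norm norm_minus_commute)
  then show "y \<in> max_cball x \<rho>"
    using component_le_norm_cart[of "y - x"] by (auto simp: mem_max_cball intro: order_trans)
qed

lemma max_cball_subset_open:
  fixes x :: "real^'n"
  assumes "open U" "x \<in> U"
  obtains R where "0 < R" "R \<le> 1" "max_cball x R \<subseteq> U"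
proof -
  obtain e where e: "e > 0" "cball x e \<subseteq> U" using assms open_contains_cball by blast
  define R where "R = min 1 (e / real CARD('n))"
  have "max_cball x R \<subseteq> cball x e"
  proof
    fix y assume y: "y \<in> max_cball x R"
    have "norm (y - x) \<le> (\<Sum>i\<in>UNIV. \<bar>(y - x) $ i\<bar>)" by (rule norm_le_l1_cart)
    also have "\<dots> \<le> (\<Sum>i\<in>(UNIV::'n set). R)" using y by (intro sum_mono) (auto simp: mem_max_cball)
    also have "\<dots> \<le> e" by (simp add: R_def min_def field_simps)
    finally show "y \<in> cball x e" by (simp add: dist_norm norm_minus_commute)
  qed
  with e show ?thesis by (intro that[of R]) (auto simp: R_def)
qed

lemma partial_deriv_cong_open:
  assumes "open W" "x \<in> W" "\<And>y. y \<in> W \<Longrightarrow> f y = g y"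
  shows "partial_deriv i f x = partial_deriv i g x"
proof -
  have "(f has_derivative D) (at x) \<longleftrightarrow> (g has_derivative D) (at x)" for D
    using has_derivative_transform_within_open[of f D x UNIV W g, OF _ assms(1,2)]
      has_derivative_transform_within_open[of g D x UNIV W f, OF _ assms(1,2)] assms(3) by auto
  then have "(\<lambda>D. (f has_derivative D) (at x)) = (\<lambda>D. (g has_derivative D) (at x))" by (rule ext)
  then show ?thesis unfolding partial_deriv_def frechet_derivative_def by (rule arg_cong)
qed

lemma iter_partial_Nil [simp]: "iter_partial [] f = f"
  by (simp add: iter_partial_def)

lemma iter_partial_Cons: "iter_partial (i # is) f = partial_deriv i (iter_partial is f)"
  by (simp add: iter_partial_def)

lemma iter_partial_append: "iter_partial (is @ js) f = iter_partial is (iter_partial js f)"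
  by (simp add: iter_partial_def)

lemma iter_partial_cong_open:
  assumes "open W" "\<And>y. y \<in> W \<Longrightarrow> f y = g y" "x \<in> W"
  shows "iter_partial is f x = iter_partial is g x"
  using assms(3)
  by (induction "is" arbitrary: x)
     (auto simp: iter_partial_Cons assms(2) intro: partial_deriv_cong_open[OF assms(1)])

lemma smooth_on_open_openD: "smooth_on_open W f \<Longrightarrow> open W"
  by (simp add: smooth_on_open_def)

lemma smooth_on_open_iter_partial_differentiable:
  "smooth_on_open W f \<Longrightarrow> iter_partial is f differentiable_on W"
  by (simp add: smooth_on_open_def)

lemma smooth_on_open_iter_partial: "smooth_on_open W f \<Longrightarrow> smooth_on_open W (iter_partial is f)"
  by (simp add: smooth_on_open_def flip: iter_partial_append)

lemma smooth_on_open_partial_deriv: "smooth_on_open W f \<Longrightarrow> smooth_on_open W (partial_deriv i f)"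
  using smooth_on_open_iter_partial[of W f "[i]"] by (simp add: iter_partial_Cons)

lemma smooth_on_open_differentiable:
  assumes "smooth_on_open W f" "x \<in> W" shows "f differentiable (at x)"
proof -
  have "\<forall>is. iter_partial is f differentiable_on W" using assms(1) by (simp add: smooth_on_open_def)
  from this[rule_format, of "[]"] have "f differentiable_on W" unfolding iter_partial_Nil .
  then show ?thesis
    using smooth_on_open_openD[OF assms(1)] assms(2) by (simp add: differentiable_on_eq_differentiable_at)
qed

lemma smooth_on_open_continuous:
  "smooth_on_open W f \<Longrightarrow> continuous_on W f"
  by (intro differentiable_imp_continuous_on differentiable_at_imp_differentiable_on)
     (rule smooth_on_open_differentiable)

lemma continuous_on_iter_partial:
  "smooth_on_open W f \<Longrightarrow> S \<subseteq> W \<Longrightarrow> continuous_on S (iter_partial is f)"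
  by (rule continuous_on_subset[OF smooth_on_open_continuous[OF smooth_on_open_iter_partial]])

lemma differentiable_on_cong:
  assumes "f differentiable_on W" "\<And>y. y \<in> W \<Longrightarrow> g y = f y"
  shows "g differentiable_on W"
  unfolding differentiable_on_def differentiable_def
proof
  fix x assume x: "x \<in> W"
  then obtain D where "(f has_derivative D) (at x within W)"
    using assms(1) by (auto simp: differentiable_on_def differentiable_def)
  then show "\<exists>D. (g has_derivative D) (at x within W)"
    using has_derivative_transform[OF x assms(2)] by (intro exI)
qed

lemma smooth_on_open_cong:
  assumes "smooth_on_open W f" "\<And>y. y \<in> W \<Longrightarrow> f y = g y"
  shows "smooth_on_open W g"
proof -
  have W: "open W" using assms(1) by (simp add: smooth_on_open_def)
  show ?thesis
    unfolding smooth_on_open_def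
  proof (intro conjI W allI)
    fix "is"
    have "iter_partial is f differentiable_on W" using assms(1) by (simp add: smooth_on_open_def)
    then show "iter_partial is g differentiable_on W"
      by (rule differentiable_on_cong) (simp add: iter_partial_cong_open[OF W assms(2)])
  qed
qed

lemma smooth_on_open_subset: "smooth_on_open W f \<Longrightarrow> open V \<Longrightarrow> V \<subseteq> W \<Longrightarrow> smooth_on_open V f"
  by (auto simp: smooth_on_open_def intro: differentiable_on_subset)

lemma smooth_on_openI_local:
  assumes "open W" "\<And>x. x \<in> W \<Longrightarrow> \<exists>V. x \<in> V \<and> smooth_on_open V f"
  shows "smooth_on_open W f"
  unfolding smooth_on_open_def
proof (intro conjI assms(1) allI differentiable_at_imp_differentiable_on)
  fix "is" x assume "x \<in> W"
  then obtain V where "x \<in> V" "smooth_on_open V f" using assms by blast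
  then show "iter_partial is f differentiable (at x)"
    by (intro smooth_on_open_differentiable[of V] smooth_on_open_iter_partial)
qed

lemma has_derivative_partials:
  fixes f :: "real^'n \<Rightarrow> 'b::real_normed_vector"
  assumes "f differentiable (at x)"
  shows "(f has_derivative (\<lambda>h. \<Sum>i\<in>UNIV. h $ i *\<^sub>R partial_deriv i f x)) (at x)"
proof -
  have D: "(f has_derivative frechet_derivative f (at x)) (at x)"
    using assms frechet_derivative_works by blast
  interpret bounded_linear "frechet_derivative f (at x)" using D by (rule has_derivative_bounded_linear)
  have "frechet_derivative f (at x) h = (\<Sum>i\<in>UNIV. h $ i *\<^sub>R partial_deriv i f x)" for h
  proof -
    have "h = (\<Sum>i\<in>UNIV. h $ i *\<^sub>R axis i 1)"
      using basis_expansion[of h] by (simp add: scalar_mult_eq_scaleR)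
    then have "frechet_derivative f (at x) h = frechet_derivative f (at x) (\<Sum>i\<in>UNIV. h $ i *\<^sub>R axis i 1)"
      by simp
    then show ?thesis by (simp add: sum scale partial_deriv_def)
  qed
  then have "frechet_derivative f (at x) = (\<lambda>h. \<Sum>i\<in>UNIV. h $ i *\<^sub>R partial_deriv i f x)" by blast
  then show ?thesis using D by simp
qed

lemma partial_deriv_eqI:
  "(f has_derivative D) (at x) \<Longrightarrow> partial_deriv i f x = D (axis i 1)"
  unfolding partial_deriv_def using frechet_derivative_at by metis

lemma iter_partial_bounded_linear:
  assumes "bounded_linear L" "smooth_on_open W f" "x \<in> W"
  shows "iter_partial is (\<lambda>y. L (f y)) x = L (iter_partial is f x)"
  using assms(3)
proof (induction "is" arbitrary: x)
  case (Cons i "is")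
  interpret bounded_linear L by fact
  have "iter_partial is f differentiable (at x)"
    using Cons.prems by (rule smooth_on_open_differentiable[OF smooth_on_open_iter_partial[OF assms(2)]])
  then have D: "((\<lambda>y. L (iter_partial is f y)) has_derivative
      (\<lambda>h. L (frechet_derivative (iter_partial is f) (at x) h))) (at x)"
    unfolding frechet_derivative_works by (rule has_derivative)
  have "iter_partial (i # is) (\<lambda>y. L (f y)) x = partial_deriv i (\<lambda>y. L (iter_partial is f y)) x"
    unfolding iter_partial_Cons using assms(2) Cons
    by (intro partial_deriv_cong_open[of W]) (auto simp: smooth_on_open_def)
  also have "\<dots> = L (iter_partial (i # is) f x)"
    using partial_deriv_eqI[OF D] by (simp add: iter_partial_Cons partial_deriv_def)
  finally show ?case .
qed simp

lemma smooth_on_open_bounded_linear: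
  assumes "bounded_linear L" "smooth_on_open W f"
  shows "smooth_on_open W (\<lambda>y. L (f y))"
  unfolding smooth_on_open_def
proof (intro conjI allI)
  show W: "open W" using assms(2) by (simp add: smooth_on_open_def)
  fix "is"
  have "(\<lambda>y. L (iter_partial is f y)) differentiable_on W"
    unfolding differentiable_on_def differentiable_def
  proof
    fix x assume "x \<in> W"
    then obtain D where "(iter_partial is f has_derivative D) (at x within W)"
      using smooth_on_open_iter_partial_differentiable[OF assms(2), of "is"]
      by (auto simp: differentiable_on_def differentiable_def)
    then show "\<exists>D. ((\<lambda>y. L (iter_partial is f y)) has_derivative D) (at x within W)"
      using bounded_linear.has_derivative[OF assms(1)] by fast
  qed
  then show "iter_partial is (\<lambda>y. L (f y)) differentiable_on W"
    by (rule differentiable_on_cong) (simp add: iter_partial_bounded_linear[OF assms])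
qed

lemma iter_partial_minus_const:
  assumes "smooth_on_open W f" "x \<in> W"
  shows "iter_partial is (\<lambda>y. f y - b) x = (if is = [] then f x - b else iter_partial is f x)"
  using assms(2)
proof (induction "is" arbitrary: x)
  case (Cons i "is")
  have W: "open W" using assms(1) by (simp add: smooth_on_open_def)
  show ?case
  proof (cases "is = []")
    case True
    have D: "((\<lambda>y. f y - b) has_derivative frechet_derivative f (at x)) (at x)"
      using smooth_on_open_differentiable[OF assms(1) Cons.prems] frechet_derivative_works
      by (auto intro!: derivative_eq_intros)
    show ?thesis using True partial_deriv_eqI[OF D] by (simp add: iter_partial_Cons partial_deriv_def)
  next
    case False
    then show ?thesis using Cons
      by (simp add: iter_partial_Cons, intro partial_deriv_cong_open[OF W]) auto
  qed
qed simp

lemma smooth_on_open_minus_const: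
  assumes "smooth_on_open W f" shows "smooth_on_open W (\<lambda>y. f y - b)"
  unfolding smooth_on_open_def
proof (intro conjI allI)
  show "open W" using assms by (simp add: smooth_on_open_def)
  fix "is"
  have "iter_partial is f differentiable_on W" using assms by (rule smooth_on_open_iter_partial_differentiable)
  then have "(\<lambda>y. if is = [] then f y - b else iter_partial is f y) differentiable_on W"
    by (cases "is = []") (auto intro!: differentiable_on_diff)
  then show "iter_partial is (\<lambda>y. f y - b) differentiable_on W"
    by (rule differentiable_on_cong) (simp add: iter_partial_minus_const[OF assms])
qed

section \<open>Taylor's formula with iterated partial derivatives\<close>

abbreviation list_monomial :: "real^'n \<Rightarrow> 'n list \<Rightarrow> real" where
  "list_monomial w is \<equiv> \<Prod>i\<leftarrow>is. w $ i"

abbreviation index_lists :: "nat \<Rightarrow> 'n list set" where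
  "index_lists m \<equiv> {is. length is = m}"

lemma finite_index_lists [simp]: "finite (index_lists m :: 'n::finite list set)"
  using finite_lists_length_eq[of "UNIV :: 'n set"] by simp

lemma card_index_lists: "card (index_lists m :: 'n::finite list set) = CARD('n) ^ m"
  using card_lists_length_eq[of "UNIV :: 'n set" m] by simp

lemma sum_index_lists_Suc:
  fixes F :: "'n::finite list \<Rightarrow> 'b::comm_monoid_add"
  shows "(\<Sum>is\<in>index_lists (Suc m). F is) = (\<Sum>is\<in>index_lists m. \<Sum>i\<in>UNIV. F (i # is))"
proof -
  have "(\<Sum>is\<in>index_lists (Suc m). F is) =
    (\<Sum>(is,i)\<in>index_lists m \<times> UNIV. F (i # is))"
    by (rule sum.reindex_bij_witness[where i="\<lambda>(is,i). i # is" and j="\<lambda>is. (tl is, hd is)"])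
       (auto simp: length_Suc_conv)
  then show ?thesis by (simp add: sum.cartesian_product)
qed

text \<open>
  This is Maclaurin's formula on the segment from \<open>x\<close> to \<open>x + w\<close>: the derivative of order \<open>m\<close> of
  \<open>f (x + t w)\<close> in \<open>t\<close> is the sum of the terms \<open>iter_partial is f\<close> times \<open>list_monomial w is\<close> over all lists
  \<open>is\<close> of \<open>m\<close> directions. Lists with the same entries in another order are collected later.
\<close>

lemma taylor_index_lists:
  fixes f :: "real^'n \<Rightarrow> real"
  assumes sm: "smooth_on_open W f" and S: "convex S" "S \<subseteq> W" "x \<in> S" "x + w \<in> S" and n: "0 < n"
  shows "\<exists>\<xi>\<in>S. f (x + w) =
      (\<Sum>m<n. (\<Sum>is\<in>index_lists m. iter_partial is f x * list_monomial w is) / fact m)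
      + (\<Sum>is\<in>index_lists n. iter_partial is f \<xi> * list_monomial w is) / fact n"
proof -
  define diff where "diff m t = (\<Sum>is\<in>index_lists m. iter_partial is f (x + t *\<^sub>R w) * list_monomial w is)"
    for m t
  have seg: "x + t *\<^sub>R w \<in> S" if "0 \<le> t" "t \<le> 1" for t
  proof -
    have "(1 - t) *\<^sub>R x + t *\<^sub>R (x + w) \<in> S" using S that by (intro convexD_alt) auto
    then show ?thesis by (simp add: algebra_simps)
  qed
  have D: "(diff m has_real_derivative diff (Suc m) t) (at t)" if t: "0 \<le> t" "t \<le> 1" for m t
  proof -
    have one: "((\<lambda>t. iter_partial is f (x + t *\<^sub>R w)) has_real_derivative
        (\<Sum>i\<in>UNIV. w $ i * iter_partial (i # is) f (x + t *\<^sub>R w))) (at t)" for "is"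
    proof -
      have "iter_partial is f differentiable (at (x + t *\<^sub>R w))"
        using subsetD[OF S(2) seg[OF t]]
        by (rule smooth_on_open_differentiable[OF smooth_on_open_iter_partial[OF sm]])
      note D = has_derivative_partials[OF this]
      have line: "((\<lambda>t. x + t *\<^sub>R w) has_derivative (\<lambda>h. h *\<^sub>R w)) (at t)"
        by (auto intro!: derivative_eq_intros)
      have "((\<lambda>t. iter_partial is f (x + t *\<^sub>R w)) has_derivative
          (\<lambda>h. \<Sum>i\<in>UNIV. (h *\<^sub>R w) $ i *\<^sub>R partial_deriv i (iter_partial is f) (x + t *\<^sub>R w))) (at t)"
        by (rule has_derivative_compose[OF line D])
      moreover have "(\<lambda>h. \<Sum>i\<in>UNIV. (h *\<^sub>R w) $ i *\<^sub>R partial_deriv i (iter_partial is f) (x + t *\<^sub>R w))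
        = (*) (\<Sum>i\<in>UNIV. w $ i * iter_partial (i # is) f (x + t *\<^sub>R w))"
        by (auto simp: fun_eq_iff sum_distrib_right iter_partial_Cons intro!: sum.cong)
      ultimately show ?thesis by (simp add: has_field_derivative_def)
    qed
    have "(diff m has_real_derivative
      (\<Sum>is\<in>index_lists m. (\<Sum>i\<in>UNIV. w $ i * iter_partial (i # is) f (x + t *\<^sub>R w)) * list_monomial w is)) (at t)"
      unfolding diff_def by (intro DERIV_sum DERIV_cmult_right one)
    also have "(\<Sum>is\<in>index_lists m. (\<Sum>i\<in>UNIV. w $ i * iter_partial (i # is) f (x + t *\<^sub>R w)) * list_monomial w is)
       = diff (Suc m) t"
      by (simp add: diff_def sum_index_lists_Suc sum_distrib_right sum_distrib_left mult_ac)
    finally show ?thesis .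
  qed
  obtain t where t: "0 < t" "t < 1"
    "diff 0 1 = (\<Sum>m<n. diff m 0 / fact m * 1 ^ m) + diff n t / fact n * 1 ^ n"
    using Maclaurin[of 1 n diff "diff 0"] D n by auto
  have "diff 0 1 = f (x + w)" by (simp add: diff_def)
  moreover have "x + t *\<^sub>R w \<in> S" using seg t by simp
  ultimately show ?thesis using t(3) by (auto simp: diff_def)
qed

lemma abs_list_monomial_le:
  assumes "\<And>i. \<bar>w $ i\<bar> \<le> \<tau>"
  shows "\<bar>list_monomial w is\<bar> \<le> \<tau> ^ length is"
proof (induction "is")
  case (Cons i "is")
  have "0 \<le> \<tau>" using assms[of i] by linarith
  then show ?case using Cons assms[of i] by (auto simp: abs_mult intro: mult_mono)
qed simp

lemma taylor_remainder_bound: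
  fixes G :: "'n::finite list \<Rightarrow> real" and w :: "real^'n"
  assumes "\<And>i. \<bar>w $ i\<bar> \<le> \<tau>" "\<And>is. length is = n \<Longrightarrow> \<bar>G is\<bar> \<le> K"
  shows "\<bar>(\<Sum>is\<in>index_lists n. G is * list_monomial w is) / fact n\<bar> \<le> real CARD('n) ^ n * K * \<tau> ^ n"
proof -
  have "\<bar>\<Sum>is\<in>index_lists n. G is * list_monomial w is\<bar> \<le> (\<Sum>is\<in>index_lists n. \<bar>G is * list_monomial w is\<bar>)"
    by (rule sum_abs)
  also have "\<dots> \<le> (\<Sum>is\<in>(index_lists n::'n list set). K * \<tau> ^ n)"
  proof (intro sum_mono)
    fix "is" :: "'n list" assume "is \<in> index_lists n"
    then have l: "length is = n" by simp
    have "\<bar>list_monomial w is\<bar> \<le> \<tau> ^ n" using abs_list_monomial_le[of w \<tau> "is"] assms(1) l by simp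
    moreover have "\<bar>G is\<bar> \<le> K" using assms(2) l by simp
    ultimately show "\<bar>G is * list_monomial w is\<bar> \<le> K * \<tau> ^ n"
      unfolding abs_mult by (intro mult_mono) auto
  qed
  also have "\<dots> = real CARD('n) ^ n * K * \<tau> ^ n" by (simp add: card_index_lists)
  finally have 1: "\<bar>\<Sum>is\<in>index_lists n. G is * list_monomial w is\<bar> \<le> real CARD('n) ^ n * K * \<tau> ^ n" .
  have "\<bar>(\<Sum>is\<in>index_lists n. G is * list_monomial w is) / fact n\<bar>
      \<le> \<bar>\<Sum>is\<in>index_lists n. G is * list_monomial w is\<bar> / 1"
    unfolding abs_divide by (intro divide_left_mono frac_le) (auto simp: fact_ge_1)
  with 1 show ?thesis by simp
qed

lemma mean_value_bound:
  fixes f :: "real^'n \<Rightarrow> real"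
  assumes sm: "smooth_on_open W f" and S: "convex S" "S \<subseteq> W" "x \<in> S" "y \<in> S"
    and K: "\<And>z i. z \<in> S \<Longrightarrow> \<bar>partial_deriv i f z\<bar> \<le> K" and \<tau>: "\<And>i. \<bar>y $ i - x $ i\<bar> \<le> \<tau>"
  shows "\<bar>f y - f x\<bar> \<le> real CARD('n) * K * \<tau>"
proof -
  obtain \<xi> where "\<xi> \<in> S" and e: "f (x + (y - x)) =
      (\<Sum>m<1. (\<Sum>is\<in>index_lists m. iter_partial is f x * list_monomial (y - x) is) / fact m)
      + (\<Sum>is\<in>index_lists 1. iter_partial is f \<xi> * list_monomial (y - x) is) / fact 1"
    using taylor_index_lists[OF sm S(1,2,3), of "y - x" 1] S by auto
  have "\<bar>(\<Sum>is\<in>index_lists 1. iter_partial is f \<xi> * list_monomial (y - x) is) / fact 1\<bar>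
      \<le> real CARD('n) ^ 1 * K * \<tau> ^ 1"
    using K[OF \<open>\<xi> \<in> S\<close>] \<tau> by (intro taylor_remainder_bound) (auto simp: length_Suc_conv iter_partial_Cons)
  then show ?thesis using e by simp
qed

lemma second_order_bound:
  fixes f :: "real^'n \<Rightarrow> real"
  assumes sm: "smooth_on_open W f" and S: "convex S" "S \<subseteq> W" "x \<in> S" "y \<in> S"
    and K: "\<And>z i j. z \<in> S \<Longrightarrow> \<bar>iter_partial [i, j] f z\<bar> \<le> K" and \<tau>: "\<And>i. \<bar>y $ i - x $ i\<bar> \<le> \<tau>"
  shows "\<bar>f y - f x - (\<Sum>i\<in>UNIV. (y $ i - x $ i) * partial_deriv i f x)\<bar> \<le> (real CARD('n))\<^sup>2 * K * \<tau>\<^sup>2"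
proof -
  obtain \<xi> where "\<xi> \<in> S" and e: "f (x + (y - x)) =
      (\<Sum>m<2. (\<Sum>is\<in>index_lists m. iter_partial is f x * list_monomial (y - x) is) / fact m)
      + (\<Sum>is\<in>index_lists 2. iter_partial is f \<xi> * list_monomial (y - x) is) / fact 2"
    using taylor_index_lists[OF sm S(1,2,3), of "y - x" 2] S by auto
  have "\<bar>(\<Sum>is\<in>index_lists 2. iter_partial is f \<xi> * list_monomial (y - x) is) / fact 2\<bar>
      \<le> real CARD('n) ^ 2 * K * \<tau> ^ 2"
    using K[OF \<open>\<xi> \<in> S\<close>] \<tau> by (intro taylor_remainder_bound) (auto simp: length_Suc_conv numeral_2_eq_2)
  moreover have "(\<Sum>m<2. (\<Sum>is\<in>index_lists m. iter_partial is f x * list_monomial (y - x) is) / fact m)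
    = f x + (\<Sum>i\<in>UNIV. (y $ i - x $ i) * partial_deriv i f x)"
    by (simp add: numeral_2_eq_2 sum_index_lists_Suc iter_partial_Cons mult.commute)
  ultimately show ?thesis using e by simp
qed

section \<open>Smooth functions are closed under products and composition\<close>

lemma iter_partial_add:
  assumes "smooth_on_open W f" "smooth_on_open W g" "x \<in> W"
  shows "iter_partial is (\<lambda>y. f y + g y) x = iter_partial is f x + iter_partial is g x"
  using assms(3)
proof (induction "is" arbitrary: x)
  case (Cons i "is")
  have D: "((\<lambda>y. iter_partial is f y + iter_partial is g y) has_derivative
      (\<lambda>h. frechet_derivative (iter_partial is f) (at x) h + frechet_derivative (iter_partial is g) (at x) h)) (at x)"
    using smooth_on_open_differentiable[OF smooth_on_open_iter_partial[OF assms(1), of "is"] Cons.prems]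
      smooth_on_open_differentiable[OF smooth_on_open_iter_partial[OF assms(2), of "is"] Cons.prems]
    unfolding frechet_derivative_works by (rule has_derivative_add)
  have "iter_partial (i # is) (\<lambda>y. f y + g y) x
      = partial_deriv i (\<lambda>y. iter_partial is f y + iter_partial is g y) x"
    unfolding iter_partial_Cons
    using Cons by (intro partial_deriv_cong_open[OF smooth_on_open_openD[OF assms(1)]]) auto
  then show ?case
    using partial_deriv_eqI[OF D, of i] by (simp add: iter_partial_Cons partial_deriv_def)
qed simp

text \<open>
  A finite stage of \<open>smooth_on_open\<close>, which admits induction on the order: derivatives of products and
  composites involve the factors themselves at the next lower stage.
\<close>

definition partials_differentiable ::
    "nat \<Rightarrow> (real^'n) set \<Rightarrow> (real^'n \<Rightarrow> 'b::real_normed_vector) \<Rightarrow> bool" where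
  "partials_differentiable n W f \<longleftrightarrow>
     open W \<and> (\<forall>is. length is \<le> n \<longrightarrow> (\<forall>x\<in>W. iter_partial is f differentiable (at x)))"

lemma smooth_on_open_iff_partials_differentiable:
  "smooth_on_open W f \<longleftrightarrow> (\<forall>n. partials_differentiable n W f)"
proof (cases "open W")
  case True
  then show ?thesis
    unfolding smooth_on_open_def partials_differentiable_def differentiable_on_eq_differentiable_at[OF True]
    by (meson order_refl)
qed (auto simp: smooth_on_open_def partials_differentiable_def)

lemma all_lists_snoc:
  "(\<forall>is. length is \<le> Suc n \<longrightarrow> P is) \<longleftrightarrow> P [] \<and> (\<forall>i is. length is \<le> n \<longrightarrow> P (is @ [i]))"
proof safe
  fix "is" :: "'a list" assume *: "P []" "\<forall>i is. length is \<le> n \<longrightarrow> P (is @ [i])" "length is \<le> Suc n"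
  then show "P is" by (cases "is" rule: rev_cases) auto
qed auto

lemma partials_differentiable_Suc:
  "partials_differentiable (Suc n) W f \<longleftrightarrow>
     open W \<and> (\<forall>x\<in>W. f differentiable (at x)) \<and> (\<forall>i. partials_differentiable n W (partial_deriv i f))"
  unfolding partials_differentiable_def
  by (subst all_lists_snoc) (auto simp: iter_partial_append iter_partial_Cons)

lemma partials_differentiable_0:
  "partials_differentiable 0 W f \<longleftrightarrow> open W \<and> (\<forall>x\<in>W. f differentiable (at x))"
  by (simp add: partials_differentiable_def)

lemma partials_differentiable_cong:
  assumes "partials_differentiable n W f" "\<And>y. y \<in> W \<Longrightarrow> g y = f y"
  shows "partials_differentiable n W g"
  unfolding partials_differentiable_def
proof (intro conjI allI impI ballI)
  show W: "open W" using assms(1) by (simp add: partials_differentiable_def)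
  fix "is" :: "'a list" and x assume *: "length is \<le> n" "x \<in> W"
  then have "iter_partial is f differentiable (at x)"
    using assms(1) by (simp add: partials_differentiable_def)
  then obtain D where "(iter_partial is f has_derivative D) (at x)" by (auto simp: differentiable_def)
  then have "(iter_partial is g has_derivative D) (at x)"
    using iter_partial_cong_open[OF W assms(2)] * W
    by (intro has_derivative_transform_within_open[of "iter_partial is f" D x UNIV W "iter_partial is g"]) auto
  then show "iter_partial is g differentiable (at x)" by (auto simp: differentiable_def)
qed

lemma partials_differentiable_antimono:
  "partials_differentiable (Suc n) W f \<Longrightarrow> partials_differentiable n W f"
  by (simp add: partials_differentiable_def)

lemma partials_differentiable_add:
  "partials_differentiable n W f \<Longrightarrow> partials_differentiable n W g
    \<Longrightarrow> partials_differentiable n W (\<lambda>x. f x + g x)"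
proof (induction n arbitrary: f g)
  case (Suc n)
  have "partials_differentiable n W (partial_deriv i (\<lambda>x. f x + g x))" for i
  proof (rule partials_differentiable_cong)
    show "partials_differentiable n W (\<lambda>x. partial_deriv i f x + partial_deriv i g x)"
      using Suc by (simp add: partials_differentiable_Suc)
    fix x assume "x \<in> W"
    then have "f differentiable (at x)" "g differentiable (at x)"
      using Suc.prems by (auto simp: partials_differentiable_Suc)
    then have "((\<lambda>x. f x + g x) has_derivative
      (\<lambda>h. frechet_derivative f (at x) h + frechet_derivative g (at x) h)) (at x)"
      unfolding frechet_derivative_works by (rule has_derivative_add)
    from partial_deriv_eqI[OF this]
    show "partial_deriv i (\<lambda>x. f x + g x) x = partial_deriv i f x + partial_deriv i g x"
      by (simp add: partial_deriv_def)
  qed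
  then show ?case using Suc.prems by (auto simp: partials_differentiable_Suc)
qed (auto simp: partials_differentiable_0)

lemma partial_deriv_zero: "partial_deriv i (\<lambda>_. 0) = (\<lambda>_. 0)"
  by (rule ext, subst partial_deriv_eqI[of _ "\<lambda>_. 0"]) auto

lemma partials_differentiable_zero: "open W \<Longrightarrow> partials_differentiable n W (\<lambda>x. 0)"
proof (induction n)
  case (Suc n)
  then show ?case by (simp add: partial_deriv_zero partials_differentiable_Suc)
qed (simp add: partials_differentiable_0)

lemma partials_differentiable_sum:
  assumes "finite A" "open W" "\<And>a. a \<in> A \<Longrightarrow> partials_differentiable n W (f a)"
  shows "partials_differentiable n W (\<lambda>x. \<Sum>a\<in>A. f a x)"
  using assms by (induction rule: finite_induct)
    (auto simp: partials_differentiable_zero intro!: partials_differentiable_add)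

lemma partial_deriv_scaleR:
  assumes "s differentiable (at x)" "f differentiable (at x)"
  shows "partial_deriv i (\<lambda>x. s x *\<^sub>R f x) x = s x *\<^sub>R partial_deriv i f x + partial_deriv i s x *\<^sub>R f x"
proof -
  have "((\<lambda>x. s x *\<^sub>R f x) has_derivative
      (\<lambda>h. s x *\<^sub>R frechet_derivative f (at x) h + frechet_derivative s (at x) h *\<^sub>R f x)) (at x)"
    using assms unfolding frechet_derivative_works by (rule has_derivative_scaleR)
  from partial_deriv_eqI[OF this] show ?thesis by (simp add: partial_deriv_def)
qed

lemma partials_differentiable_scaleR:
  fixes s :: "real^'n \<Rightarrow> real" and f :: "real^'n \<Rightarrow> 'b::real_normed_vector"
  shows "partials_differentiable n W s \<Longrightarrow> partials_differentiable n W f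
    \<Longrightarrow> partials_differentiable n W (\<lambda>x. s x *\<^sub>R f x)"
proof (induction n arbitrary: s f)
  case (Suc n)
  have "partials_differentiable n W (partial_deriv i (\<lambda>x. s x *\<^sub>R f x))" for i
  proof (rule partials_differentiable_cong)
    show "partials_differentiable n W (\<lambda>x. s x *\<^sub>R partial_deriv i f x + partial_deriv i s x *\<^sub>R f x)"
      using Suc.prems Suc.prems[THEN partials_differentiable_antimono]
      by (intro partials_differentiable_add Suc.IH) (auto simp: partials_differentiable_Suc)
    fix x assume "x \<in> W"
    then show "partial_deriv i (\<lambda>x. s x *\<^sub>R f x) x = s x *\<^sub>R partial_deriv i f x + partial_deriv i s x *\<^sub>R f x"
      using Suc.prems by (intro partial_deriv_scaleR) (auto simp: partials_differentiable_Suc)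
  qed
  then show ?case using Suc.prems by (auto simp: partials_differentiable_Suc)
qed (auto simp: partials_differentiable_0)

lemma partial_deriv_compose:
  fixes \<theta> :: "real^'n \<Rightarrow> real^'m" and f :: "real^'m \<Rightarrow> 'b::real_normed_vector"
  assumes "\<theta> differentiable (at x)" "f differentiable (at (\<theta> x))"
  shows "partial_deriv i (\<lambda>x. f (\<theta> x)) x =
    (\<Sum>j\<in>UNIV. partial_deriv i (\<lambda>x. \<theta> x $ j) x *\<^sub>R partial_deriv j f (\<theta> x))"
proof -
  have D: "(\<theta> has_derivative frechet_derivative \<theta> (at x)) (at x)"
    using assms(1) frechet_derivative_works by blast
  have c: "((\<lambda>x. \<theta> x $ j) has_derivative (\<lambda>h. frechet_derivative \<theta> (at x) h $ j)) (at x)" for j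
    by (rule bounded_linear.has_derivative[OF bounded_linear_vec_nth D])
  show ?thesis
    by (subst partial_deriv_eqI[OF has_derivative_compose[OF D has_derivative_partials[OF assms(2)]]])
       (simp add: partial_deriv_eqI[OF c])
qed

lemma partials_differentiable_compose:
  fixes \<theta> :: "real^'n \<Rightarrow> real^'m" and f :: "real^'m \<Rightarrow> 'b::real_normed_vector"
  assumes \<theta>: "smooth_on_open V \<theta>" "\<theta> ` V \<subseteq> W"
  shows "partials_differentiable n W f \<Longrightarrow> partials_differentiable n V (\<lambda>x. f (\<theta> x))"
proof (induction n arbitrary: f)
  case 0
  have "(\<lambda>x. f (\<theta> x)) differentiable (at x)" if x: "x \<in> V" for x
  proof -
    have "f differentiable (at (\<theta> x))" using 0 x \<theta> by (auto simp: partials_differentiable_0)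
    then show ?thesis
      using differentiable_chain_at[OF smooth_on_open_differentiable[OF \<theta>(1) x], of f] by (simp add: o_def)
  qed
  then show ?case using smooth_on_open_openD[OF \<theta>(1)] by (simp add: partials_differentiable_0)
next
  case (Suc n)
  note V = smooth_on_open_openD[OF \<theta>(1)]
  have d: "f differentiable (at (\<theta> x))" if x: "x \<in> V" for x
    using Suc.prems x \<theta> by (auto simp: partials_differentiable_Suc)
  have "partials_differentiable n V (partial_deriv i (\<lambda>x. f (\<theta> x)))" for i
  proof (rule partials_differentiable_cong)
    have "smooth_on_open V (partial_deriv i (\<lambda>x. \<theta> x $ j))" for j
      by (rule smooth_on_open_partial_deriv[OF smooth_on_open_bounded_linear[OF bounded_linear_vec_nth \<theta>(1)]])
    then show "partials_differentiable n V
        (\<lambda>x. \<Sum>j\<in>UNIV. partial_deriv i (\<lambda>x. \<theta> x $ j) x *\<^sub>R partial_deriv j f (\<theta> x))"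
      using Suc V
      by (intro partials_differentiable_sum partials_differentiable_scaleR Suc.IH)
         (auto simp: partials_differentiable_Suc smooth_on_open_iff_partials_differentiable)
    fix x assume "x \<in> V"
    then show "partial_deriv i (\<lambda>x. f (\<theta> x)) x =
        (\<Sum>j\<in>UNIV. partial_deriv i (\<lambda>x. \<theta> x $ j) x *\<^sub>R partial_deriv j f (\<theta> x))"
      by (intro partial_deriv_compose smooth_on_open_differentiable[OF \<theta>(1)] d)
  qed
  moreover have "(\<lambda>x. f (\<theta> x)) differentiable (at x)" if x: "x \<in> V" for x
    using differentiable_chain_at[OF smooth_on_open_differentiable[OF \<theta>(1) x] d[OF x]] by (simp add: o_def)
  ultimately show ?case using V by (simp add: partials_differentiable_Suc)
qed

lemma smooth_on_open_compose:
  fixes \<theta> :: "real^'n \<Rightarrow> real^'m"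
  assumes "smooth_on_open V \<theta>" "\<theta> ` V \<subseteq> W" "smooth_on_open W f"
  shows "smooth_on_open V (\<lambda>x. f (\<theta> x))"
  using assms(3) unfolding smooth_on_open_iff_partials_differentiable
  by (intro allI partials_differentiable_compose[OF assms(1,2)]) simp

lemma smooth_on_open_scaleR:
  fixes s :: "real^'n \<Rightarrow> real"
  assumes "smooth_on_open V s" "smooth_on_open V f"
  shows "smooth_on_open V (\<lambda>x. s x *\<^sub>R f x)"
  using assms unfolding smooth_on_open_iff_partials_differentiable
  by (intro allI partials_differentiable_scaleR) simp_all

lemma smooth_on_open_sum:
  assumes "finite A" "open W" "\<And>a. a \<in> A \<Longrightarrow> smooth_on_open W (f a)"
  shows "smooth_on_open W (\<lambda>x. \<Sum>a\<in>A. f a x)"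
  using assms unfolding smooth_on_open_iff_partials_differentiable
  by (intro allI partials_differentiable_sum) simp_all

section \<open>Order of vanishing and nondegeneracy in a given parameterization\<close>

definition vanishes_to_order :: "nat \<Rightarrow> (real^'n \<Rightarrow> 'b::real_normed_vector) \<Rightarrow> real^'n \<Rightarrow> bool" where
  "vanishes_to_order m f x \<longleftrightarrow> (\<forall>is. length is \<le> m \<longrightarrow> iter_partial is f x = 0)"

lemma vanishes_to_order_Suc:
  "vanishes_to_order (Suc m) f x \<longleftrightarrow> f x = 0 \<and> (\<forall>i. vanishes_to_order m (partial_deriv i f) x)"
  unfolding vanishes_to_order_def
  by (subst all_lists_snoc) (auto simp: iter_partial_append iter_partial_Cons)

lemma vanishes_to_order_antimono: "vanishes_to_order (Suc m) f x \<Longrightarrow> vanishes_to_order m f x"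
  by (simp add: vanishes_to_order_def)

lemma vanishes_to_order_cong:
  assumes "open W" "x \<in> W" "\<And>y. y \<in> W \<Longrightarrow> g y = f y" "vanishes_to_order m f x"
  shows "vanishes_to_order m g x"
  using assms(4) iter_partial_cong_open[OF assms(1,3,2)] by (simp add: vanishes_to_order_def)

lemma vanishes_to_order_add:
  assumes "smooth_on_open W f" "smooth_on_open W g" "x \<in> W"
    "vanishes_to_order m f x" "vanishes_to_order m g x"
  shows "vanishes_to_order m (\<lambda>y. f y + g y) x"
  using assms(4,5) iter_partial_add[OF assms(1-3)] by (simp add: vanishes_to_order_def)

lemma vanishes_to_order_zero: "vanishes_to_order m (\<lambda>_. 0) x"
proof (induction m)
  case (Suc m)
  then show ?case by (simp add: partial_deriv_zero vanishes_to_order_Suc)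
qed (simp add: vanishes_to_order_def)

lemma vanishes_to_order_sum:
  assumes "finite A" "open W" "x \<in> W" "\<And>a. a \<in> A \<Longrightarrow> smooth_on_open W (f a)"
    "\<And>a. a \<in> A \<Longrightarrow> vanishes_to_order m (f a) x"
  shows "vanishes_to_order m (\<lambda>y. \<Sum>a\<in>A. f a y) x"
  using assms
  by (induction rule: finite_induct)
     (auto simp: vanishes_to_order_zero intro!: vanishes_to_order_add[of W] smooth_on_open_sum)

text \<open>
  By the product rule, every first partial derivative of the product is a sum of two products of the same
  kind, in each of which one factor vanishes to the next lower order.
\<close>

lemma vanishes_to_order_scaleR:
  fixes s :: "real^'n \<Rightarrow> real" and f :: "real^'n \<Rightarrow> 'b::real_normed_vector"
  assumes "x \<in> W"
  shows "smooth_on_open W s \<Longrightarrow> smooth_on_open W f \<Longrightarrow> vanishes_to_order m f x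
    \<Longrightarrow> vanishes_to_order m (\<lambda>y. s y *\<^sub>R f y) x"
proof (induction m arbitrary: s f)
  case (Suc m)
  have "vanishes_to_order m (partial_deriv i (\<lambda>y. s y *\<^sub>R f y)) x" for i
  proof (rule vanishes_to_order_cong)
    show "open W" "x \<in> W" using Suc.prems assms smooth_on_open_openD by auto
    show "partial_deriv i (\<lambda>x. s x *\<^sub>R f x) y = s y *\<^sub>R partial_deriv i f y + partial_deriv i s y *\<^sub>R f y"
      if "y \<in> W" for y
      using Suc.prems that by (intro partial_deriv_scaleR smooth_on_open_differentiable)
    show "vanishes_to_order m (\<lambda>y. s y *\<^sub>R partial_deriv i f y + partial_deriv i s y *\<^sub>R f y) x"
      using Suc.prems vanishes_to_order_antimono[OF Suc.prems(3)] assms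
      by (intro vanishes_to_order_add[of W] Suc.IH smooth_on_open_scaleR smooth_on_open_partial_deriv)
         (auto simp: vanishes_to_order_Suc)
  qed
  then show ?case using Suc.prems by (simp add: vanishes_to_order_Suc)
qed (simp add: vanishes_to_order_def)

text \<open>
  By the chain rule, the first partial derivatives of \<open>f \<circ> \<theta>\<close> are combinations of the functions
  \<open>partial_deriv j f \<circ> \<theta>\<close> with smooth coefficients, so induction on the order applies.
\<close>

lemma vanishes_to_order_compose:
  fixes \<theta> :: "real^'n \<Rightarrow> real^'m" and f :: "real^'m \<Rightarrow> 'b::real_normed_vector"
  assumes \<theta>: "smooth_on_open V \<theta>" "\<theta> ` V \<subseteq> W" and x: "x \<in> V"
  shows "smooth_on_open W f \<Longrightarrow> vanishes_to_order m f (\<theta> x) \<Longrightarrow> vanishes_to_order m (\<lambda>y. f (\<theta> y)) x"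
proof (induction m arbitrary: f)
  case (Suc m)
  have "vanishes_to_order m (partial_deriv i (\<lambda>y. f (\<theta> y))) x" for i
  proof (rule vanishes_to_order_cong)
    show V: "open V" using \<theta>(1) by (rule smooth_on_open_openD)
    show "x \<in> V" by fact
    show "partial_deriv i (\<lambda>x. f (\<theta> x)) y =
        (\<Sum>j\<in>UNIV. partial_deriv i (\<lambda>x. \<theta> x $ j) y *\<^sub>R partial_deriv j f (\<theta> y))" if "y \<in> V" for y
      using that \<theta>(2) by (intro partial_deriv_compose smooth_on_open_differentiable[OF \<theta>(1)]
        smooth_on_open_differentiable[OF Suc.prems(1)]) auto
    have "smooth_on_open V (partial_deriv i (\<lambda>x. \<theta> x $ j))" for j
      by (rule smooth_on_open_partial_deriv[OF smooth_on_open_bounded_linear[OF bounded_linear_vec_nth \<theta>(1)]])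
    moreover have "smooth_on_open V (\<lambda>y. partial_deriv j f (\<theta> y))" for j
      by (rule smooth_on_open_compose[OF \<theta> smooth_on_open_partial_deriv[OF Suc.prems(1)]])
    moreover have "vanishes_to_order m (\<lambda>y. partial_deriv j f (\<theta> y)) x" for j
      using Suc.prems by (intro Suc.IH smooth_on_open_partial_deriv) (auto simp: vanishes_to_order_Suc)
    ultimately show "vanishes_to_order m
        (\<lambda>y. \<Sum>j\<in>UNIV. partial_deriv i (\<lambda>x. \<theta> x $ j) y *\<^sub>R partial_deriv j f (\<theta> y)) x"
      using V x by (intro vanishes_to_order_sum[of _ V] vanishes_to_order_scaleR[of x V] smooth_on_open_scaleR) auto
  qed
  then show ?case using Suc.prems by (simp add: vanishes_to_order_Suc)
qed (simp add: vanishes_to_order_def)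

lemma local_parameterization_smooth:
  assumes "local_parameterization M U \<Psi>" shows "smooth_on_open U \<Psi>"
proof (rule smooth_on_openI_local)
  show U: "open U" using assms by (simp add: local_parameterization_def)
  fix x assume x: "x \<in> U"
  have "smooth_map_on U \<Psi>" using assms by (simp add: local_parameterization_def diffeomorphism_def)
  then obtain W g where W: "x \<in> W" "smooth_on_open W g" "\<forall>y\<in>U \<inter> W. g y = \<Psi> y"
    using x unfolding smooth_map_on_def by blast
  have "smooth_on_open (U \<inter> W) g"
    using U smooth_on_open_openD[OF W(2)] by (intro smooth_on_open_subset[OF W(2)]) auto
  then have "smooth_on_open (U \<inter> W) \<Psi>" by (rule smooth_on_open_cong) (use W in auto)
  then show "\<exists>V. x \<in> V \<and> smooth_on_open V \<Psi>" using x W by blast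
qed

text \<open>
  The inverse of a parameterization extends to a smooth map \<open>G\<close> on an open subset of the ambient space.
  After shrinking that subset, \<open>G\<close> maps every point of \<open>M\<close> in it to its parameter, because the image of \<open>\<Psi>\<close>
  is relatively open in \<open>M\<close>.
\<close>

lemma local_parameterization_inverse:
  assumes par: "local_parameterization M U \<Psi>" and u: "u \<in> U"
  obtains W G where "\<Psi> u \<in> W" "smooth_on_open W G"
    "\<And>r. r \<in> M \<Longrightarrow> r \<in> W \<Longrightarrow> G r \<in> U \<and> \<Psi> (G r) = r"
    "\<And>v. v \<in> U \<Longrightarrow> \<Psi> v \<in> W \<Longrightarrow> G (\<Psi> v) = v"
proof -
  have inj: "inj_on \<Psi> U" and sm: "smooth_map_on (\<Psi> ` U) (inv_into U \<Psi>)"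
    and op: "openin (top_of_set M) (\<Psi> ` U)"
    using par by (auto simp: local_parameterization_def diffeomorphism_def bij_betw_def)
  obtain T where T: "open T" "\<Psi> ` U = M \<inter> T" using op by (auto simp: openin_open)
  obtain W G where W: "\<Psi> u \<in> W" "smooth_on_open W G" "\<forall>y\<in>\<Psi> ` U \<inter> W. G y = inv_into U \<Psi> y"
    using sm u unfolding smooth_map_on_def by blast
  show ?thesis
  proof (rule that[of "W \<inter> T" G])
    show "\<Psi> u \<in> W \<inter> T" using W(1) T u by blast
    show "smooth_on_open (W \<inter> T) G"
      using T smooth_on_open_openD[OF W(2)] by (intro smooth_on_open_subset[OF W(2)]) auto
    show "G r \<in> U \<and> \<Psi> (G r) = r" if "r \<in> M" "r \<in> W \<inter> T" for r
    proof -
      have r: "r \<in> \<Psi> ` U" "r \<in> W" using that T by auto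
      then have "G r = inv_into U \<Psi> r" using W(3) by blast
      then show ?thesis using r inv_into_into[of r \<Psi> U] f_inv_into_f[of r \<Psi> U] by simp
    qed
    show "G (\<Psi> v) = v" if "v \<in> U" "\<Psi> v \<in> W \<inter> T" for v
      using that W(3) inv_into_f_f[OF inj] by auto
  qed
qed

lemma inner_iter_partial:
  fixes \<Psi> :: "real^'k \<Rightarrow> real^'d"
  assumes "smooth_on_open U \<Psi>" "v \<in> U"
  shows "iter_partial is (\<lambda>y. a \<bullet> \<Psi> y) v = a \<bullet> iter_partial is \<Psi> v"
  by (rule iter_partial_bounded_linear[OF bounded_linear_inner_right assms])

lemma smooth_on_open_inner:
  "smooth_on_open U \<Psi> \<Longrightarrow> smooth_on_open U (\<lambda>y. a \<bullet> \<Psi> y)"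
  by (rule smooth_on_open_bounded_linear[OF bounded_linear_inner_right])

lemma iter_partial_affine:
  fixes \<Psi> :: "real^'k \<Rightarrow> real^'d"
  assumes "smooth_on_open U \<Psi>" "v \<in> U" "is \<noteq> []"
  shows "iter_partial is (\<lambda>y. a \<bullet> \<Psi> y - b) v = a \<bullet> iter_partial is \<Psi> v"
  using iter_partial_minus_const[OF smooth_on_open_inner[OF assms(1)] assms(2)] assms(3)
  by (simp add: inner_iter_partial[OF assms(1,2)])

lemma smooth_on_open_affine:
  "smooth_on_open U \<Psi> \<Longrightarrow> smooth_on_open U (\<lambda>y. a \<bullet> \<Psi> y - b)"
  by (intro smooth_on_open_minus_const smooth_on_open_inner)

lemma multi_partial_eq_iter_partial:
  fixes \<alpha> :: "'n::finite \<Rightarrow> nat"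
  obtains "is" where "length is = (\<Sum>i\<in>UNIV. \<alpha> i)" "\<And>f x. multi_partial \<alpha> f x = iter_partial is f x"
proof -
  define js where "js = (SOME is. \<forall>i. count_list is i = \<alpha> i)"
  obtain M where M: "count M = \<alpha>" using count_Abs_multiset[of \<alpha>] by (metis finite)
  obtain ks where "mset ks = M" using ex_mset by blast
  then have "\<forall>i. count_list ks i = \<alpha> i" using M by (metis count_mset)
  then have js: "\<forall>i. count_list js i = \<alpha> i" unfolding js_def by (rule someI)
  have "length js = (\<Sum>i\<in>UNIV. count_list js i)" by (rule sum_count_set[symmetric]) auto
  then show ?thesis using js by (intro that[of js]) (auto simp: multi_partial_def js_def)
qed

text \<open>
  If \<open>\<Phi>\<close> is the parameterization that witnesses nondegeneracy, then \<open>\<Phi> = \<Psi> \<circ> \<theta>\<close> near the point with a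
  smooth \<open>\<theta>\<close>. Were all derivatives of \<open>a \<bullet> \<Psi>\<close> of orders \<open>1\<close> to \<open>D\<close> zero at \<open>u\<close>, those of \<open>a \<bullet> \<Phi>\<close> would be
  zero too, and the osculating space of \<open>\<Phi>\<close> would be contained in the orthogonal complement of \<open>a\<close>.
\<close>

lemma nondegenerate_point_parameterization:
  fixes \<Psi> :: "real^'k \<Rightarrow> real^'d"
  assumes par: "local_parameterization M U \<Psi>" and u: "u \<in> U"
    and nd: "nondegenerate_point TYPE('k) M (\<Psi> u)"
  obtains D where "D \<ge> 1"
    "\<And>a. a \<noteq> 0 \<Longrightarrow> \<exists>is. is \<noteq> [] \<and> length is \<le> D \<and> a \<bullet> iter_partial is \<Psi> u \<noteq> 0"
proof -
  obtain V and \<Phi> :: "real^'k \<Rightarrow> real^'d" and v D where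
    V: "local_parameterization M V \<Phi>" "v \<in> V" "\<Phi> v = \<Psi> u" "D \<ge> 1" "osculating_space D \<Phi> v = UNIV"
    using nd unfolding nondegenerate_point_def by blast
  obtain W G where W: "\<Psi> u \<in> W" "smooth_on_open W G"
    "\<And>r. r \<in> M \<Longrightarrow> r \<in> W \<Longrightarrow> G r \<in> U \<and> \<Psi> (G r) = r"
    "\<And>v. v \<in> U \<Longrightarrow> \<Psi> v \<in> W \<Longrightarrow> G (\<Psi> v) = v"
    using local_parameterization_inverse[OF par u] by blast
  note smU = local_parameterization_smooth[OF par] and smV = local_parameterization_smooth[OF V(1)]
  define V' where "V' = V \<inter> \<Phi> -` W"
  have V': "open V'"
    unfolding V'_def using smooth_on_open_continuous[OF smV] smooth_on_open_openD[OF smV]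
      smooth_on_open_openD[OF W(2)] by (rule continuous_open_preimage)
  have \<Phi>M: "\<Phi> ` V \<subseteq> M" using V(1) by (auto simp: local_parameterization_def dest!: openin_imp_subset)
  have v: "v \<in> V'" using V W by (simp add: V'_def)
  have sm\<theta>: "smooth_on_open V' (\<lambda>y. G (\<Phi> y))"
    by (rule smooth_on_open_compose[OF smooth_on_open_subset[OF smV V'] _ W(2)]) (auto simp: V'_def)
  have im: "(\<lambda>y. G (\<Phi> y)) ` V' \<subseteq> U" using W(3) \<Phi>M by (auto simp: V'_def)
  have lft: "\<Psi> (G (\<Phi> y)) = \<Phi> y" if "y \<in> V'" for y using W(3) \<Phi>M that by (auto simp: V'_def)
  have \<theta>v: "G (\<Phi> v) = u" using V(3) W u by simp
  show ?thesis
  proof (rule that[OF V(4)], rule ccontr)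
    fix a :: "real^'d"
    assume "a \<noteq> 0" and no: "\<not> (\<exists>is. is \<noteq> [] \<and> length is \<le> D \<and> a \<bullet> iter_partial is \<Psi> u \<noteq> 0)"
    define g where "g y = a \<bullet> \<Psi> y - a \<bullet> \<Psi> u" for y
    have g: "smooth_on_open U g" unfolding g_def by (rule smooth_on_open_affine[OF smU])
    have "iter_partial is g u = 0" if "length is \<le> D" for "is"
      using no that iter_partial_affine[OF smU u, of "is" a "a \<bullet> \<Psi> u"]
      by (cases "is = []") (auto simp: g_def[abs_def])
    then have "vanishes_to_order D g (G (\<Phi> v))" by (simp add: \<theta>v vanishes_to_order_def)
    then have "vanishes_to_order D (\<lambda>y. g (G (\<Phi> y))) v"
      by (rule vanishes_to_order_compose[OF sm\<theta> im v g])
    then have van: "vanishes_to_order D (\<lambda>y. a \<bullet> \<Phi> y - a \<bullet> \<Psi> u) v"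
      by (rule vanishes_to_order_cong[OF V' v, rotated]) (simp add: g_def lft)
    have "osculating_space D \<Phi> v \<subseteq> {w. a \<bullet> w = 0}"
      unfolding osculating_space_def
    proof (rule span_minimal[OF _ subspace_hyperplane], safe)
      fix \<alpha> :: "'k \<Rightarrow> nat" assume \<alpha>: "0 < (\<Sum>i\<in>UNIV. \<alpha> i)" "(\<Sum>i\<in>UNIV. \<alpha> i) \<le> D"
      obtain "is" where len: "length is = (\<Sum>i\<in>UNIV. \<alpha> i)" "\<And>f :: real^'k \<Rightarrow> real^'d. \<And>x. multi_partial \<alpha> f x = iter_partial is f x"
        using multi_partial_eq_iter_partial[of \<alpha>] by metis
      then have ne: "is \<noteq> []" using \<alpha> by auto
      have "iter_partial is (\<lambda>y. a \<bullet> \<Phi> y - a \<bullet> \<Psi> u) v = 0"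
        using van len \<alpha> by (simp add: vanishes_to_order_def)
      then show "a \<bullet> multi_partial \<alpha> \<Phi> v = 0"
        using iter_partial_affine[OF smV V(2) ne, of a] len by simp
    qed
    then have "a \<in> {w. a \<bullet> w = 0}" using V(5) by blast
    then have "a \<bullet> a = 0" by blast
    then show False using \<open>a \<noteq> 0\<close> by simp
  qed
qed

lemma compact_bound:
  fixes f :: "'a::topological_space \<Rightarrow> real"
  assumes "compact S" "continuous_on S f"
  obtains K where "K \<ge> 0" "\<And>x. x \<in> S \<Longrightarrow> \<bar>f x\<bar> \<le> K"
proof -
  have "bounded (f ` S)" using assms compact_continuous_image compact_imp_bounded by blast
  then obtain K where "\<forall>y\<in>f ` S. norm y \<le> K" unfolding bounded_iff by blast
  then show ?thesis by (intro that[of "max K 0"]) (auto simp: le_max_iff_disj)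
qed

lemma iter_partial_uniform_bound:
  fixes f :: "real^'n \<Rightarrow> real^'m"
  assumes sm: "smooth_on_open W f" and S: "compact S" "S \<subseteq> W"
  obtains K where "K \<ge> 1" "\<And>is y i. length is \<le> N \<Longrightarrow> y \<in> S \<Longrightarrow> \<bar>iter_partial is f y $ i\<bar> \<le> K"
proof -
  have "\<exists>K\<ge>0. \<forall>y\<in>S. \<bar>iter_partial (fst p) f y $ snd p\<bar> \<le> K" for p
    using compact_bound[OF S(1) continuous_on_component[OF continuous_on_iter_partial[OF sm S(2)]]] by metis
  then obtain K where K: "\<And>p. K p \<ge> 0" "\<And>p y. y \<in> S \<Longrightarrow> \<bar>iter_partial (fst p) f y $ snd p\<bar> \<le> K p"
    by metis
  define P where "P = {is :: 'n list. length is \<le> N} \<times> (UNIV :: 'm set)"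
  have fin: "finite P" using finite_lists_length_le[of "UNIV :: 'n set" N] by (simp add: P_def)
  show ?thesis
  proof (rule that[of "1 + sum K P"])
    show "1 \<le> 1 + sum K P" using K by (simp add: sum_nonneg)
    fix "is" :: "'n list" and y i assume "length is \<le> N" "y \<in> S"
    then have "\<bar>iter_partial is f y $ i\<bar> \<le> K (is, i)" using K(2)[of y "(is, i)"] by simp
    also have "\<dots> \<le> sum K P" using K(1) fin \<open>length is \<le> N\<close> by (intro member_le_sum) (auto simp: P_def)
    finally show "\<bar>iter_partial is f y $ i\<bar> \<le> 1 + sum K P" by simp
  qed
qed

lemma component_le_infnorm_diff: "\<bar>x $ i - y $ i\<bar> \<le> maxdist x y"
  using component_le_infnorm_cart[of "x - y" i] by simp

text \<open>
  A rational point of the manifold near \<open>\<Psi> v\<close> has a parameter \<open>z\<close> that is near \<open>v\<close>, up to a constant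
  factor: apply the mean value theorem to the smooth extension of the inverse.
\<close>

lemma local_parameterization_inverse_lipschitz:
  fixes \<Psi> :: "real^'k \<Rightarrow> real^'d"
  assumes par: "local_parameterization M U \<Psi>" and u: "u \<in> U"
  obtains R \<sigma> L where "R > 0" "\<sigma> > 0" "L > 0"
    "\<And>v r. v \<in> max_cball u R \<Longrightarrow> v \<in> U \<Longrightarrow> r \<in> M \<Longrightarrow> maxdist (\<Psi> v) r \<le> \<sigma> \<Longrightarrow>
       \<exists>z\<in>U. \<Psi> z = r \<and> z \<in> max_cball v (L * maxdist (\<Psi> v) r)"
proof -
  obtain W G where W: "\<Psi> u \<in> W" "smooth_on_open W G"
    "\<And>r. r \<in> M \<Longrightarrow> r \<in> W \<Longrightarrow> G r \<in> U \<and> \<Psi> (G r) = r"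
    "\<And>v. v \<in> U \<Longrightarrow> \<Psi> v \<in> W \<Longrightarrow> G (\<Psi> v) = v"
    using local_parameterization_inverse[OF par u] by blast
  obtain \<tau> where \<tau>: "0 < \<tau>" "max_cball (\<Psi> u) \<tau> \<subseteq> W"
    using max_cball_subset_open[OF smooth_on_open_openD[OF W(2)] W(1)] by metis
  obtain K where K: "K \<ge> 1"
    "\<And>is y i. length is \<le> 1 \<Longrightarrow> y \<in> max_cball (\<Psi> u) \<tau> \<Longrightarrow> \<bar>iter_partial is G y $ i\<bar> \<le> K"
    using iter_partial_uniform_bound[OF W(2) compact_max_cball \<tau>(2), of 1] by metis
  note sm = local_parameterization_smooth[OF par]
  define \<sigma> where "\<sigma> = \<tau> / 2"
  have "isCont \<Psi> u" using smooth_on_open_continuous[OF sm] smooth_on_open_openD[OF sm] u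
    by (simp add: continuous_on_eq_continuous_at)
  then obtain e where e: "e > 0" "\<And>y. dist y u < e \<Longrightarrow> dist (\<Psi> y) (\<Psi> u) < \<sigma>"
    using \<tau>(1) unfolding continuous_at_eps_delta \<sigma>_def by (meson half_gt_zero)
  obtain R where R: "0 < R" "max_cball u R \<subseteq> ball u e"
    using max_cball_subset_open[of "ball u e" u] e(1) by (metis centre_in_ball open_ball)
  define L where "L = real CARD('d) * K"
  have near: "\<Psi> v \<in> max_cball (\<Psi> u) \<sigma>" if "v \<in> max_cball u R" for v
    using e(2)[of v] R(2) that cball_subset_max_cball[of "\<Psi> u" \<sigma>] by (force simp: dist_commute)
  show ?thesis
  proof (rule that[of R \<sigma> L])
    show "R > 0" "\<sigma> > 0" "L > 0" using R \<tau> K by (auto simp: \<sigma>_def L_def)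
    fix v r assume v: "v \<in> max_cball u R" "v \<in> U" and r: "r \<in> M" "maxdist (\<Psi> v) r \<le> \<sigma>"
    have "r \<in> max_cball (\<Psi> v) \<sigma>" using r(2) by (simp add: max_cball_def infnorm_sub)
    then have rt: "r \<in> max_cball (\<Psi> u) \<tau>"
      by (rule max_cball_trans[OF near[OF v(1)]]) (simp add: \<sigma>_def)
    have vt: "\<Psi> v \<in> max_cball (\<Psi> u) \<tau>"
      using near[OF v(1)] max_cball_mono[of \<sigma> \<tau> "\<Psi> u"] \<tau>(1) by (auto simp: \<sigma>_def)
    have "\<bar>G r $ i - G (\<Psi> v) $ i\<bar> \<le> real CARD('d) * K * maxdist (\<Psi> v) r" for i
    proof (rule mean_value_bound[OF _ convex_max_cball \<tau>(2) vt rt])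
      show smi: "smooth_on_open W (\<lambda>y. G y $ i)"
        by (rule smooth_on_open_bounded_linear[OF bounded_linear_vec_nth W(2)])
      show "\<bar>partial_deriv j (\<lambda>y. G y $ i) z\<bar> \<le> K" if z: "z \<in> max_cball (\<Psi> u) \<tau>" for z j
        using iter_partial_bounded_linear[OF bounded_linear_vec_nth W(2), of z "[j]" i] z \<tau>(2) K(2)[of "[j]" z i]
        by (auto simp: iter_partial_Cons)
      show "\<bar>r $ j - \<Psi> v $ j\<bar> \<le> maxdist (\<Psi> v) r" for j
        using component_le_infnorm_diff[of r j "\<Psi> v"] by (simp add: infnorm_sub)
    qed
    moreover have "G (\<Psi> v) = v" "G r \<in> U" "\<Psi> (G r) = r"
      using W(3,4) v r(1) rt vt \<tau>(2) by auto
    ultimately show "\<exists>z\<in>U. \<Psi> z = r \<and> z \<in> max_cball v (L * maxdist (\<Psi> v) r)"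
      by (intro bexI[of _ "G r"]) (auto simp: mem_max_cball L_def)
  qed
qed

section \<open>Determinants of Taylor expansions\<close>

text \<open>
  Homogeneous coordinates, with the additional coordinate at \<open>None\<close>: a set lies on an affine hyperplane iff
  its homogenization spans a proper subspace.
\<close>

definition homogenize :: "real^'d \<Rightarrow> real^('d option)" where
  "homogenize r = (\<chi> q. case q of None \<Rightarrow> 1 | Some i \<Rightarrow> r $ i)"

lemma homogenize_nth [simp]: "homogenize r $ None = 1" "homogenize r $ Some i = r $ i"
  by (simp_all add: homogenize_def)

lemma abs_det_le:
  fixes A :: "real^'n^'n"
  assumes "\<And>i j. \<bar>A $ i $ j\<bar> \<le> B"
  shows "\<bar>det A\<bar> \<le> fact CARD('n) * B ^ CARD('n)"
proof -
  have "\<bar>det A\<bar> \<le> (\<Sum>p | p permutes (UNIV::'n set). \<bar>of_int (sign p) * (\<Prod>i\<in>UNIV. A $ i $ p i)\<bar>)"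
    unfolding det_def by (rule sum_abs)
  also have "\<dots> \<le> (\<Sum>p | p permutes (UNIV::'n set). B ^ CARD('n))"
  proof (intro sum_mono)
    fix p
    have "\<bar>of_int (sign p) * (\<Prod>i\<in>UNIV. A $ i $ p i)\<bar> = (\<Prod>i\<in>UNIV. \<bar>A $ i $ p i\<bar>)"
      by (simp add: abs_mult abs_prod sign_def)
    also have "\<dots> \<le> (\<Prod>i\<in>(UNIV::'n set). B)" using assms by (intro prod_mono) auto
    finally show "\<bar>of_int (sign p) * (\<Prod>i\<in>UNIV. A $ i $ p i)\<bar> \<le> B ^ CARD('n)" by simp
  qed
  also have "\<dots> = fact CARD('n) * B ^ CARD('n)"
    by (simp add: card_permutations[of "UNIV::'n set"])
  finally show ?thesis .
qed

lemma det_rows_sum: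
  fixes a :: "'n::finite \<Rightarrow> 's \<Rightarrow> real^'n"
  assumes "finite S"
  shows "det (\<chi> p. \<Sum>s\<in>S. a p s) = (\<Sum>f\<in>(UNIV \<rightarrow>\<^sub>E S). det (\<chi> p. a p (f p)))"
proof -
  have "(\<Prod>i\<in>UNIV. \<Sum>s\<in>S. a i s $ p i) = (\<Sum>f\<in>(UNIV \<rightarrow>\<^sub>E S). \<Prod>i\<in>UNIV. a i (f i) $ p i)" for p :: "'n \<Rightarrow> 'n"
    by (rule prod_sum_PiE) (use assms in auto)
  then have "det (\<chi> p. \<Sum>s\<in>S. a p s) =
     (\<Sum>p | p permutes (UNIV::'n set). \<Sum>f\<in>(UNIV \<rightarrow>\<^sub>E S). of_int (sign p) * (\<Prod>i\<in>UNIV. a i (f i) $ p i))"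
    by (simp add: det_def sum_distrib_left)
  also have "\<dots> = (\<Sum>f\<in>(UNIV \<rightarrow>\<^sub>E S). det (\<chi> p. a p (f p)))"
    by (subst sum.swap) (simp add: det_def)
  finally show ?thesis .
qed

text \<open>
  Expand the determinant multilinearly in the rows. Each choice \<open>f\<close> of one term per row contributes
  at most a constant times \<open>\<rho>\<close> to the power of the total degree of the chosen terms, unless the determinant
  of the coefficient rows \<open>\<gamma> p (f p)\<close> vanishes.
\<close>

lemma abs_det_graded_rows_le:
  fixes \<gamma> :: "'n::finite \<Rightarrow> 's \<Rightarrow> real^'n" and \<tau> :: "'n \<Rightarrow> 's \<Rightarrow> real" and deg :: "'s \<Rightarrow> nat"
  assumes S: "finite S" and \<rho>: "0 \<le> \<rho>" "\<rho> \<le> 1"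
    and \<tau>: "\<And>p s. s \<in> S \<Longrightarrow> \<bar>\<tau> p s\<bar> \<le> \<rho> ^ deg s"
    and \<gamma>: "\<And>p s q. s \<in> S \<Longrightarrow> \<bar>\<gamma> p s $ q\<bar> \<le> B"
    and N: "\<And>f. (\<forall>p. f p \<in> S) \<Longrightarrow> det (\<chi> p. \<gamma> p (f p)) \<noteq> 0 \<Longrightarrow> N \<le> (\<Sum>p\<in>UNIV. deg (f p))"
  shows "\<bar>det (\<chi> p. \<Sum>s\<in>S. \<tau> p s *s \<gamma> p s)\<bar>
     \<le> real (card S ^ CARD('n)) * (fact CARD('n) * B ^ CARD('n)) * \<rho> ^ N"
proof -
  let ?F = "UNIV \<rightarrow>\<^sub>E S :: ('n \<Rightarrow> 's) set" and ?B = "fact CARD('n) * B ^ CARD('n) :: real"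
  have term_le: "\<bar>det (\<chi> p. \<tau> p (f p) *s \<gamma> p (f p))\<bar> \<le> ?B * \<rho> ^ N" if f: "f \<in> ?F" for f
  proof (cases "det (\<chi> p. \<gamma> p (f p)) = 0")
    case True
    have "0 \<le> B" using \<gamma>[of "f undefined" undefined undefined] f by (auto simp: PiE_iff dest: order_trans[OF abs_ge_zero])
    then show ?thesis using True \<rho> by (simp add: det_rows_mul)
  next
    case False
    have fS: "\<forall>p. f p \<in> S" using f by auto
    have "\<bar>\<Prod>p\<in>UNIV. \<tau> p (f p)\<bar> \<le> (\<Prod>p\<in>UNIV. \<rho> ^ deg (f p))"
      unfolding abs_prod using \<tau> fS by (intro prod_mono) auto
    also have "\<dots> = \<rho> ^ (\<Sum>p\<in>UNIV. deg (f p))" by (simp add: power_sum)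
    also have "\<dots> \<le> \<rho> ^ N" using N[OF fS False] \<rho> by (intro power_decreasing) auto
    finally have 1: "\<bar>\<Prod>p\<in>UNIV. \<tau> p (f p)\<bar> \<le> \<rho> ^ N" .
    have "\<bar>det (\<chi> p. \<gamma> p (f p))\<bar> \<le> ?B" using \<gamma> fS by (intro abs_det_le) auto
    with 1 show ?thesis
      unfolding det_rows_mul abs_mult by (subst mult.commute) (intro mult_mono, auto)
  qed
  have "\<bar>det (\<chi> p. \<Sum>s\<in>S. \<tau> p s *s \<gamma> p s)\<bar> \<le> (\<Sum>f\<in>?F. \<bar>det (\<chi> p. \<tau> p (f p) *s \<gamma> p (f p))\<bar>)"
    unfolding det_rows_sum[OF S] by (rule sum_abs)
  also have "\<dots> \<le> (\<Sum>f\<in>?F. ?B * \<rho> ^ N)" by (intro sum_mono term_le)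
  also have "\<dots> = real (card S ^ CARD('n)) * ?B * \<rho> ^ N"
    by (simp add: card_PiE)
  finally show ?thesis .
qed

abbreviation monomials :: "nat \<Rightarrow> 'k multiset set" where
  "monomials n \<equiv> {m. size m \<le> n}"

lemma monomials_eq: "monomials n = (\<Union>j\<in>{..n}. multisets_of_size UNIV j)"
  by (auto simp: multisets_of_size_def)

lemma finite_monomials [simp]: "finite (monomials n :: 'k::finite multiset set)"
  by (auto simp: monomials_eq)

lemma card_multisets_of_size_bracket:
  "card (multisets_of_size (UNIV :: 'k::finite set) j) = bracket (CARD('k) - 1) j"
proof -
  have "CARD('k) + j - 1 = CARD('k) - 1 + j"
    using zero_less_card_finite[where 'a='k] by linarith
  then show ?thesis by (simp add: card_multisets_of_size bracket_def)
qed

lemma sum_monomials: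
  fixes h :: "nat \<Rightarrow> nat"
  shows "(\<Sum>m\<in>(monomials n :: 'k::finite multiset set). h (size m)) = (\<Sum>j\<le>n. h j * bracket (CARD('k) - 1) j)"
proof -
  have "(\<Sum>m\<in>(monomials n :: 'k multiset set). h (size m))
      = (\<Sum>j\<in>{..n}. \<Sum>m\<in>multisets_of_size (UNIV :: 'k set) j. h (size m))"
    unfolding monomials_eq by (rule sum.UNION_disjoint) (auto, auto simp: multisets_of_size_def)
  also have "\<dots> = (\<Sum>j\<le>n. h j * bracket (CARD('k) - 1) j)"
  proof (intro sum.cong refl)
    fix j
    have "(\<Sum>m\<in>multisets_of_size (UNIV :: 'k set) j. h (size m)) = (\<Sum>m\<in>multisets_of_size (UNIV :: 'k set) j. h j)"
      by (intro sum.cong) (auto simp: multisets_of_size_def)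
    then show "(\<Sum>m\<in>multisets_of_size (UNIV :: 'k set) j. h (size m)) = h j * bracket (CARD('k) - 1) j"
      by (simp only: sum_constant card_multisets_of_size_bracket) simp
  qed
  finally show ?thesis .
qed

text \<open>
  The terms of a Taylor expansion of order \<open>n\<close>: \<open>Some m\<close> stands for the monomial with the factors in the
  multiset \<open>m\<close>, and \<open>None\<close> for the remainder, which has order \<open>Suc n\<close>.
\<close>

fun term_degree :: "nat \<Rightarrow> 'k multiset option \<Rightarrow> nat" where
  "term_degree n None = Suc n"
| "term_degree n (Some m) = size m"

text \<open>
  Only the remainder may be used in several rows. The total degree is therefore least if the rows use up
  all the monomials of degree at most \<open>n\<close>, and the remainder in the other \<open>r\<close> rows. To compare with this
  choice it is convenient to sum the deficits \<open>Suc n - term_degree n (f p)\<close>: they are nonnegative, those of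
  the remainder vanish, and the others are summed over distinct monomials.
\<close>

lemma sum_term_degree_ge:
  fixes f :: "'p::finite \<Rightarrow> 'k::finite multiset option"
  assumes f: "\<And>p m. f p = Some m \<Longrightarrow> size m \<le> n"
    and inj: "\<And>p q m. f p = Some m \<Longrightarrow> f q = Some m \<Longrightarrow> p = q"
    and card: "CARD('p) = Suc ((\<Sum>j=1..n. bracket (CARD('k) - 1) j) + r)"
  shows "(\<Sum>j=1..n. j * bracket (CARD('k) - 1) j) + Suc n * r \<le> (\<Sum>p\<in>UNIV. term_degree n (f p))"
proof -
  let ?b = "bracket (CARD('k) - 1)"
  define P where "P = {p. f p \<noteq> None}"
  have b0: "?b 0 = 1" by (simp add: bracket_def)
  have split0: "(\<Sum>j\<le>n. g j) = g 0 + (\<Sum>j=1..n. g j)" for g :: "nat \<Rightarrow> nat"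
    by (simp add: atMost_atLeast0 sum.atLeast_Suc_atMost)
  have le: "term_degree n (f p) \<le> Suc n" for p using f[of p] by (cases "f p") auto
  have "(\<Sum>p\<in>UNIV. Suc n - term_degree n (f p)) = (\<Sum>p\<in>P. Suc n - size (the (f p)))"
    by (rule sum.mono_neutral_cong_right) (auto simp: P_def)
  also have "\<dots> = (\<Sum>m\<in>(\<lambda>p. the (f p)) ` P. Suc n - size m)"
    by (subst sum.reindex) (auto simp: P_def inj_on_def intro: inj)
  also have "\<dots> \<le> (\<Sum>m\<in>(monomials n :: 'k multiset set). Suc n - size m)"
    using f by (intro sum_mono2) (auto simp: P_def)
  also have "\<dots> = (\<Sum>j\<le>n. (Suc n - j) * ?b j)" by (rule sum_monomials)
  finally have 1: "(\<Sum>p\<in>UNIV. Suc n - term_degree n (f p)) \<le> (\<Sum>j\<le>n. (Suc n - j) * ?b j)" .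
  have 2: "(\<Sum>p\<in>UNIV. Suc n - term_degree n (f p)) + (\<Sum>p\<in>UNIV. term_degree n (f p)) = Suc n * CARD('p)"
    using le by (simp flip: sum.distrib)
  have "(\<Sum>j\<le>n. (Suc n - j) * ?b j) + (\<Sum>j\<le>n. j * ?b j) = (\<Sum>j\<le>n. Suc n * ?b j)"
    unfolding sum.distrib[symmetric] by (intro sum.cong) (auto simp flip: add_mult_distrib)
  also have "\<dots> = Suc n * (1 + (\<Sum>j=1..n. ?b j))"
    by (simp only: sum_distrib_left[symmetric] split0 b0)
  finally have 3: "(\<Sum>j\<le>n. (Suc n - j) * ?b j) + (\<Sum>j\<le>n. j * ?b j) = Suc n * (1 + (\<Sum>j=1..n. ?b j))" .
  have 4: "(\<Sum>j\<le>n. j * ?b j) = (\<Sum>j=1..n. j * ?b j)" by (simp add: split0)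
  have 5: "Suc n * CARD('p) = Suc n * (1 + (\<Sum>j=1..n. ?b j)) + Suc n * r"
    by (simp add: card algebra_simps)
  show ?thesis using 1 2 3 4 5 by linarith
qed

lemma N_kd_decomposition:
  assumes "1 \<le> k" "k \<le> d"
  obtains n r where "1 \<le> n" "d = (\<Sum>j=1..n. bracket (k - 1) j) + r"
    "N_kd k d = (\<Sum>j=1..n. j * bracket (k - 1) j) + Suc n * r"
proof -
  let ?P = "\<lambda>n. n \<ge> 1 \<and> (\<exists>m. d = (\<Sum>j=1..n. bracket (k - 1) j) + m)"
  have b1: "1 \<le> bracket (k - 1) j" for j
    unfolding bracket_def by (simp add: Suc_le_eq)
  have "?P 1" using assms by (auto simp: bracket_def le_iff_add)
  moreover have "n \<le> d" if "?P n" for n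
  proof -
    have "n = (\<Sum>j=1..n. 1)" by simp
    also have "\<dots> \<le> (\<Sum>j=1..n. bracket (k - 1) j)" by (intro sum_mono b1)
    finally show ?thesis using that by auto
  qed
  ultimately have "?P (n_kd k d)" unfolding n_kd_def by (rule GreatestI_nat) blast
  then obtain m where m: "d = (\<Sum>j=1..n_kd k d. bracket (k - 1) j) + m" and n: "n_kd k d \<ge> 1" by blast
  have "m_kd k d = m" unfolding m_kd_def using m by (intro the_equality) auto
  then show ?thesis using m n by (intro that[of "n_kd k d" m]) (simp_all add: N_kd_def)
qed

lemma list_monomial_eq_prod_mset: "list_monomial w is = prod_mset (image_mset (($) w) (mset is))"
  by (simp flip: prod_mset_prod_list)

text \<open>
  The rows are expanded around \<open>x\<close> in the monomials of degree at most \<open>n\<close>, with a remainder of order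
  \<open>Suc n\<close>, where \<open>n\<close> is the order that enters the definition of \<open>N_kd\<close>. Two rows that use the
  same monomial have the same coefficient vector, so such a choice contributes nothing.
\<close>

lemma det_taylor_bound:
  fixes \<Psi> :: "real^'k \<Rightarrow> real^'d"
  assumes card: "CARD('k) \<le> CARD('d)"
    and sm: "smooth_on_open W \<Psi>" and S: "compact S" "convex S" "S \<subseteq> W"
  obtains C where "C > 0"
    "\<And>x \<rho> z. x \<in> S \<Longrightarrow> 0 < \<rho> \<Longrightarrow> \<rho> \<le> 1 \<Longrightarrow> (\<And>p::'d option. z p \<in> S \<inter> max_cball x \<rho>) \<Longrightarrow>
      \<bar>det (\<chi> p. homogenize (\<Psi> (z p)))\<bar> \<le> C * \<rho> ^ N_kd CARD('k) CARD('d)"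
proof -
  have "1 \<le> CARD('k)" using zero_less_card_finite[where 'a='k] by linarith
  then obtain n r where n: "1 \<le> n" "CARD('d) = (\<Sum>j=1..n. bracket (CARD('k) - 1) j) + r"
    "N_kd CARD('k) CARD('d) = (\<Sum>j=1..n. j * bracket (CARD('k) - 1) j) + Suc n * r"
    using card by (rule N_kd_decomposition)
  obtain K where K: "K \<ge> 1"
    "\<And>is y i. length is \<le> Suc n \<Longrightarrow> y \<in> S \<Longrightarrow> \<bar>iter_partial is \<Psi> y $ i\<bar> \<le> K"
    using iter_partial_uniform_bound[OF sm S(1,3), of "Suc n"] by metis
  define T where "T = insert None (Some ` (monomials n :: 'k multiset set))"
  have T: "finite T" by (simp add: T_def)
  define B where "B = real CARD('k) ^ Suc n * K"
  define C where "C = real (card T ^ CARD('d option)) * (fact CARD('d option) * B ^ CARD('d option))"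
  have k1: "1 \<le> real CARD('k)" using \<open>1 \<le> CARD('k)\<close> by simp
  have B1: "1 \<le> B" unfolding B_def using mult_mono[OF one_le_power[OF k1, of "Suc n"] K(1)] by simp
  have "card T > 0" using T by (auto simp: T_def card_gt_0_iff)
  then have "C > 0" using B1 by (simp add: C_def)
  show ?thesis
  proof (rule that[OF \<open>C > 0\<close>])
    fix x \<rho> and z :: "'d option \<Rightarrow> real^'k"
    assume x: "x \<in> S" and \<rho>: "0 < \<rho>" "\<rho> \<le> 1" and z: "\<And>p. z p \<in> S \<inter> max_cball x \<rho>"
    define w where "w p = z p - x" for p
    have w: "\<bar>w p $ i\<bar> \<le> \<rho>" for p i using z[of p] by (simp add: w_def mem_max_cball)
    have smi: "smooth_on_open W (\<lambda>y. \<Psi> y $ i)" for i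
      by (rule smooth_on_open_bounded_linear[OF bounded_linear_vec_nth sm])
    have iti: "iter_partial is (\<lambda>y. \<Psi> y $ i) y = iter_partial is \<Psi> y $ i" if "y \<in> S" for "is" y i
      using that S(3) by (intro iter_partial_bounded_linear[OF bounded_linear_vec_nth sm]) auto
    define c where "c m i = (\<Sum>is | mset is = m. iter_partial is \<Psi> x $ i / fact (size m))" for m i
    have fin_mset: "finite {is :: 'k list. mset is = m}" for m
      by (rule finite_subset[of _ "index_lists (size m)"]) auto
    have "\<exists>R. \<bar>R\<bar> \<le> B \<and> \<Psi> (z p) $ i = (\<Sum>m\<in>monomials n. prod_mset (image_mset (($) (w p)) m) * c m i) + \<rho> ^ Suc n * R"
      for p i
    proof -
      obtain \<xi> where \<xi>: "\<xi> \<in> S" and e: "\<Psi> (x + w p) $ i =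
        (\<Sum>j<Suc n. (\<Sum>is\<in>index_lists j. iter_partial is (\<lambda>y. \<Psi> y $ i) x * list_monomial (w p) is) / fact j)
        + (\<Sum>is\<in>index_lists (Suc n). iter_partial is (\<lambda>y. \<Psi> y $ i) \<xi> * list_monomial (w p) is) / fact (Suc n)"
        using taylor_index_lists[OF smi S(2,3) x, of "w p" "Suc n" i] z[of p] by (auto simp: w_def)
      define Q where "Q = (\<Sum>is\<in>index_lists (Suc n). iter_partial is (\<lambda>y. \<Psi> y $ i) \<xi> * list_monomial (w p) is)
         / fact (Suc n)"
      define R where "R = Q / \<rho> ^ Suc n"
      have "\<bar>Q\<bar> \<le> B * \<rho> ^ Suc n"
        unfolding B_def Q_def by (intro taylor_remainder_bound) (use w \<xi> K(2) iti in auto)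
      moreover have "0 < \<rho> ^ Suc n" using \<rho>(1) by (rule zero_less_power)
      ultimately have R: "\<bar>R\<bar> \<le> B" by (simp only: R_def abs_divide abs_of_pos pos_divide_le_eq)
      have Q: "Q = \<rho> ^ Suc n * R" using \<rho>(1) by (simp add: R_def)
      have "(\<Sum>j<Suc n. (\<Sum>is\<in>index_lists j. iter_partial is (\<lambda>y. \<Psi> y $ i) x * list_monomial (w p) is) / fact j)
        = (\<Sum>j\<in>{..n}. \<Sum>is\<in>index_lists j. iter_partial is \<Psi> x $ i / fact (length is) * list_monomial (w p) is)"
        by (simp add: iti[OF x] sum_divide_distrib lessThan_Suc_atMost)
      also have "\<dots> = (\<Sum>is\<in>(\<Union>j\<in>{..n}. index_lists j). iter_partial is \<Psi> x $ i / fact (length is) * list_monomial (w p) is)"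
        by (rule sum.UNION_disjoint[symmetric]) auto
      also have "(\<Union>j\<in>{..n}. index_lists j) = {is :: 'k list. length is \<le> n}" by auto
      also have "(\<Sum>is | length is \<le> n. iter_partial is \<Psi> x $ i / fact (length is) * list_monomial (w p) is)
        = (\<Sum>m\<in>monomials n. \<Sum>is\<in>{is. is \<in> {is. length is \<le> n} \<and> mset is = m}.
             iter_partial is \<Psi> x $ i / fact (length is) * list_monomial (w p) is)"
        using finite_lists_length_le[of "UNIV :: 'k set" n] by (intro sum.group[symmetric]) auto
      also have "\<dots> = (\<Sum>m\<in>monomials n. prod_mset (image_mset (($) (w p)) m) * c m i)"
      proof (intro sum.cong refl)
        fix m :: "'k multiset" assume "m \<in> monomials n"
        then have "{is. is \<in> {is. length is \<le> n} \<and> mset is = m} = {is. mset is = m}" by auto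
        then show "(\<Sum>is\<in>{is. is \<in> {is. length is \<le> n} \<and> mset is = m}.
             iter_partial is \<Psi> x $ i / fact (length is) * list_monomial (w p) is)
           = prod_mset (image_mset (($) (w p)) m) * c m i"
          by (auto simp: c_def sum_distrib_left list_monomial_eq_prod_mset mult_ac intro!: sum.cong)
      qed
      finally have "\<Psi> (z p) $ i = (\<Sum>m\<in>monomials n. prod_mset (image_mset (($) (w p)) m) * c m i) + \<rho> ^ Suc n * R"
        using e unfolding Q_def[symmetric] Q by (simp add: w_def)
      with R show ?thesis by blast
    qed
    then obtain R where R: "\<And>p i. \<bar>R p i\<bar> \<le> B"
      "\<And>p i. \<Psi> (z p) $ i = (\<Sum>m\<in>monomials n. prod_mset (image_mset (($) (w p)) m) * c m i) + \<rho> ^ Suc n * R p i"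
      by metis
    define \<tau> where "\<tau> p s = (case s of None \<Rightarrow> \<rho> ^ Suc n | Some m \<Rightarrow> prod_mset (image_mset (($) (w p)) m))" for p s
    define \<gamma> :: "'d option \<Rightarrow> 'k multiset option \<Rightarrow> real^('d option)" where
      "\<gamma> p s = (\<chi> q. case q of
           None \<Rightarrow> (if s = Some {#} then 1 else 0)
         | Some i \<Rightarrow> (case s of None \<Rightarrow> R p i | Some m \<Rightarrow> c m i))" for p s
    have row: "homogenize (\<Psi> (z p)) = (\<Sum>s\<in>T. \<tau> p s *s \<gamma> p s)" for p
    proof -
      have sumT: "(\<Sum>s\<in>T. F s) = F None + (\<Sum>m\<in>monomials n. F (Some m))" for F :: "_ \<Rightarrow> real"
        by (simp add: T_def sum.reindex)
      have "homogenize (\<Psi> (z p)) $ q = (\<Sum>s\<in>T. \<tau> p s *s \<gamma> p s) $ q" for q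
      proof (cases q)
        case None
        have "\<gamma> p s $ None = (if s = Some {#} then 1 else 0)" for s by (simp add: \<gamma>_def)
        then show ?thesis
          using None by (simp add: sumT \<tau>_def if_distrib[of "(*) _"] sum.delta cong: if_cong)
      next
        case (Some i)
        then show ?thesis by (simp add: sumT \<gamma>_def \<tau>_def R(2))
      qed
      then show ?thesis by (simp add: vec_eq_iff)
    qed
    have "\<bar>det (\<chi> p. \<Sum>s\<in>T. \<tau> p s *s \<gamma> p s)\<bar> \<le> C * \<rho> ^ N_kd CARD('k) CARD('d)"
      unfolding C_def
    proof (rule abs_det_graded_rows_le[OF T])
      show "0 \<le> \<rho>" "\<rho> \<le> 1" using \<rho> by auto
      show "\<bar>\<tau> p s\<bar> \<le> \<rho> ^ term_degree n s" if "s \<in> T" for p s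
      proof (cases s)
        case (Some m)
        obtain js where js: "mset js = m" using ex_mset by blast
        have "\<bar>list_monomial (w p) js\<bar> \<le> \<rho> ^ length js" by (rule abs_list_monomial_le[OF w])
        then show ?thesis using Some js by (auto simp: \<tau>_def list_monomial_eq_prod_mset)
      qed (use \<rho> in \<open>simp add: \<tau>_def\<close>)
      show "\<bar>\<gamma> p s $ q\<bar> \<le> B" if s: "s \<in> T" for p s q
      proof -
        have "\<bar>c m i\<bar> \<le> B" if m: "size m \<le> n" for m i
        proof -
          have "\<bar>c m i\<bar> \<le> (\<Sum>is | mset is = m. \<bar>iter_partial is \<Psi> x $ i / fact (size m)\<bar>)"
            unfolding c_def by (rule sum_abs)
          also have "\<dots> \<le> (\<Sum>is | mset is = m. K)"
          proof (intro sum_mono)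
            fix "is" assume "is \<in> {is. mset is = m}"
            then have "length is \<le> Suc n" using m by auto
            then have "\<bar>iter_partial is \<Psi> x $ i\<bar> \<le> K" using K(2) x by blast
            moreover have "\<bar>iter_partial is \<Psi> x $ i / fact (size m)\<bar> \<le> \<bar>iter_partial is \<Psi> x $ i\<bar> / 1"
              unfolding abs_divide by (intro divide_left_mono frac_le) (auto simp: fact_ge_1)
            ultimately show "\<bar>iter_partial is \<Psi> x $ i / fact (size m)\<bar> \<le> K" by simp
          qed
          also have "\<dots> = real (card {is :: 'k list. mset is = m}) * K" by simp
          also have "\<dots> \<le> real (CARD('k) ^ size m) * K"
          proof -
            have "card {is :: 'k list. mset is = m} \<le> card (index_lists (size m) :: 'k list set)"
              by (intro card_mono finite_index_lists) auto
            then show ?thesis using K(1) unfolding card_index_lists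
              by (intro mult_right_mono) (simp_all del: of_nat_power)
          qed
          also have "\<dots> \<le> B"
            unfolding B_def of_nat_power using m k1 K(1) by (intro mult_right_mono power_increasing) auto
          finally show ?thesis .
        qed
        then show ?thesis using s R(1) B1
          by (auto simp: \<gamma>_def T_def split: option.splits)
      qed
      show "N_kd CARD('k) CARD('d) \<le> (\<Sum>p\<in>UNIV. term_degree n (f p))"
        if f: "\<forall>p. f p \<in> T" and nz: "det (\<chi> p. \<gamma> p (f p)) \<noteq> 0" for f
        unfolding n(3)
      proof (rule sum_term_degree_ge)
        show "size m \<le> n" if "f p = Some m" for p m using f[rule_format, of p] that by (auto simp: T_def)
        show "p = q" if "f p = Some m" "f q = Some m" for p q m
        proof (rule ccontr)
          assume "p \<noteq> q"
          moreover have "row p (\<chi> p. \<gamma> p (f p)) = row q (\<chi> p. \<gamma> p (f p))"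
            using that by (simp add: row_def \<gamma>_def vec_eq_iff)
          ultimately show False using nz det_identical_rows by blast
        qed
        show "CARD('d option) = Suc ((\<Sum>j=1..n. bracket (CARD('k) - 1) j) + r)" using n(2) by simp
      qed
    qed
    then show "\<bar>det (\<chi> p. homogenize (\<Psi> (z p)))\<bar> \<le> C * \<rho> ^ N_kd CARD('k) CARD('d)"
      by (simp only: row)
  qed
qed

section \<open>Rational points in a small cube lie on a hyperplane\<close>

lemma det_Ints:
  fixes A :: "real^'n^'n"
  assumes "\<And>i j. A $ i $ j \<in> \<int>" shows "det A \<in> \<int>"
  unfolding det_def by (intro Ints_sum Ints_mult Ints_prod Ints_of_int assms)

text \<open>
  Clearing the denominators \<open>q p\<close> turns the determinant into a nonzero integer.
\<close>

lemma abs_det_homogenize_rational_ge: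
  fixes r :: "'d option \<Rightarrow> real^'d" and q :: "'d option \<Rightarrow> nat"
  assumes q: "\<And>p. 1 \<le> q p" "\<And>p. real (q p) \<le> T" and int: "\<And>p i. real (q p) * r p $ i \<in> \<int>"
    and nz: "det (\<chi> p. homogenize (r p)) \<noteq> 0"
  shows "1 \<le> T ^ Suc CARD('d) * \<bar>det (\<chi> p. homogenize (r p))\<bar>"
proof -
  let ?D = "det (\<chi> p. homogenize (r p))"
  have "det (\<chi> p. real (q p) *s homogenize (r p)) \<in> \<int>"
    by (rule det_Ints) (auto simp: homogenize_def int split: option.splits)
  then have "(\<Prod>p\<in>UNIV. real (q p)) * ?D \<in> \<int>" by (simp add: det_rows_mul)
  moreover have pos: "0 < (\<Prod>p\<in>UNIV. real (q p))" using q(1) by (intro prod_pos) (auto intro: less_le_trans[OF zero_less_one])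
  moreover have "(\<Prod>p\<in>UNIV. real (q p)) * ?D \<noteq> 0" using pos nz by (metis less_irrefl mult_eq_0_iff)
  ultimately have "1 \<le> \<bar>(\<Prod>p\<in>UNIV. real (q p)) * ?D\<bar>" by (intro Ints_nonzero_abs_ge1)
  also have "\<dots> = (\<Prod>p\<in>UNIV. real (q p)) * \<bar>?D\<bar>" using pos by (simp add: abs_mult)
  also have "\<dots> \<le> (\<Prod>p\<in>(UNIV::'d option set). T) * \<bar>?D\<bar>"
    using q by (intro mult_right_mono prod_mono) auto
  finally show ?thesis by simp
qed

text \<open>
  If the homogenizations spanned the whole space, some of them would form a basis, and the determinant of
  that basis would not vanish. So they are orthogonal to some \<open>c \<noteq> 0\<close>, and the coordinates of \<open>c\<close> are the
  coefficients of the hyperplane. Since \<open>X\<close> is nonempty, they are not all concentrated at \<open>None\<close>.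
\<close>

lemma hyperplane_if_dets_vanish:
  fixes X :: "(real^'d) set"
  assumes "\<And>r :: 'd option \<Rightarrow> real^'d. (\<forall>p. r p \<in> X) \<Longrightarrow> det (\<chi> p. homogenize (r p)) = 0"
  obtains a b where "a \<noteq> 0" "\<And>r. r \<in> X \<Longrightarrow> a \<bullet> r = b"
proof (cases "X = {}")
  case True
  then show ?thesis using that[of "axis undefined 1"] by (simp add: axis_eq_0_iff)
next
  case False
  have "span (homogenize ` X) \<noteq> UNIV"
  proof
    assume sp: "span (homogenize ` X) = UNIV"
    obtain B where B: "B \<subseteq> homogenize ` X" "independent B" "span B = UNIV"
      using maximal_independent_subset[of "homogenize ` X"] sp by (metis span_mono span_span top.extremum_uniqueI)
    have "card B = CARD('d option)" using B(2,3) by (metis dim_UNIV dim_eq_card_independent dim_span DIM_cart DIM_real mult_1_right)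
    then have "\<exists>e. bij_betw e (UNIV :: 'd option set) B"
      using B(2) by (intro finite_same_card_bij) (auto simp: independent_bound)
    then obtain e where e: "bij_betw e (UNIV :: 'd option set) B" by blast
    have "e p \<in> homogenize ` X" for p using e B(1) by (auto simp: bij_betw_def)
    then have "\<forall>p. \<exists>r. r \<in> X \<and> homogenize r = e p" by (metis imageE)
    then obtain r where r: "\<And>p. r p \<in> X" "\<And>p. homogenize (r p) = e p" by metis
    have "rows (\<chi> p. e p) = B" using e by (auto simp: rows_def row_def bij_betw_def)
    then have "\<exists>A. A ** (\<chi> p. e p) = mat 1" using B(3) by (simp add: matrix_left_invertible_span_rows)
    then have "det (\<chi> p. e p) \<noteq> 0" using invertible_det_nz invertible_left_inverse by blast
    moreover have "det (\<chi> p. homogenize (r p)) = 0" using assms[of r] r(1) by simp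
    ultimately show False by (simp add: r(2))
  qed
  then obtain c where c: "c \<noteq> 0" "\<And>r. r \<in> X \<Longrightarrow> c \<bullet> homogenize r = 0"
    using span_not_UNIV_orthogonal[of "homogenize ` X"] by (metis image_eqI span_base)
  define a :: "real^'d" where "a = (\<chi> i. c $ Some i)"
  have eq: "c \<bullet> homogenize r = c $ None + a \<bullet> r" for r
  proof -
    have "c \<bullet> homogenize r = (\<Sum>q\<in>insert None (range Some). c $ q * homogenize r $ q)"
      by (simp add: inner_vec_def flip: UNIV_option_conv)
    also have "\<dots> = c $ None + a \<bullet> r" by (simp add: sum.reindex inner_vec_def a_def)
    finally show ?thesis .
  qed
  have "a \<noteq> 0"
  proof
    assume "a = 0"
    then have "c $ None = 0" using eq c(2) False by fastforce
    then have "c $ q = 0" for q using \<open>a = 0\<close> by (cases q) (auto simp: a_def vec_eq_iff)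
    then show False using c(1) by (simp add: vec_eq_iff)
  qed
  moreover have "a \<bullet> r = - c $ None" if "r \<in> X" for r using eq[of r] c(2)[OF that] by simp
  ultimately show ?thesis by (rule that)
qed

abbreviation denominator_le :: "real \<Rightarrow> real^'d \<Rightarrow> bool" where
  "denominator_le T r \<equiv> \<exists>q::nat. 1 \<le> q \<and> real q \<le> T \<and> (\<forall>i. real q * r $ i \<in> \<int>)"

text \<open>
  If the cube is so small that the Taylor bound is less than the reciprocal of the common denominator, then
  all determinants of rational points in it vanish.
\<close>

lemma rational_points_on_hyperplane:
  fixes \<Psi> :: "real^'k \<Rightarrow> real^'d"
  assumes card: "CARD('k) \<le> CARD('d)"
    and sm: "smooth_on_open W \<Psi>" and S: "compact S" "convex S" "S \<subseteq> W"
  obtains C where "C > 0"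
    "\<And>x \<rho> T. x \<in> S \<Longrightarrow> 0 < \<rho> \<Longrightarrow> \<rho> \<le> 1 \<Longrightarrow> 0 \<le> T \<Longrightarrow>
       C * T ^ Suc CARD('d) * \<rho> ^ N_kd CARD('k) CARD('d) < 1 \<Longrightarrow>
       \<exists>a b. a \<noteq> 0 \<and> (\<forall>z\<in>S \<inter> max_cball x \<rho>.
         denominator_le T (\<Psi> z) \<longrightarrow> a \<bullet> \<Psi> z = b)"
proof -
  obtain C where C: "C > 0"
    "\<And>x \<rho> z. x \<in> S \<Longrightarrow> 0 < \<rho> \<Longrightarrow> \<rho> \<le> 1 \<Longrightarrow> (\<And>p::'d option. z p \<in> S \<inter> max_cball x \<rho>) \<Longrightarrow>
      \<bar>det (\<chi> p. homogenize (\<Psi> (z p)))\<bar> \<le> C * \<rho> ^ N_kd CARD('k) CARD('d)"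
    using det_taylor_bound[OF card sm S] by blast
  show ?thesis
  proof (rule that[OF C(1)])
    fix x \<rho> T assume x: "x \<in> S" "0 < \<rho>" "\<rho> \<le> 1" and T: "0 \<le> T"
      and small: "C * T ^ Suc CARD('d) * \<rho> ^ N_kd CARD('k) CARD('d) < 1"
    define X where "X = \<Psi> ` {z \<in> S \<inter> max_cball x \<rho>.
       denominator_le T (\<Psi> z)}"
    have "det (\<chi> p. homogenize (r p)) = 0" if r: "\<forall>p. r p \<in> X" for r :: "'d option \<Rightarrow> real^'d"
    proof (rule ccontr)
      assume nz: "det (\<chi> p. homogenize (r p)) \<noteq> 0"
      have "\<forall>p. \<exists>z q. r p = \<Psi> z \<and> z \<in> S \<inter> max_cball x \<rho> \<and> 1 \<le> q \<and> real q \<le> T \<and> (\<forall>i. real q * r p $ i \<in> \<int>)"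
        using r by (force simp: X_def)
      then obtain z q where z: "\<And>p. r p = \<Psi> (z p)" "\<And>p. z p \<in> S \<inter> max_cball x \<rho>"
        and q: "\<And>p. 1 \<le> q p" "\<And>p. real (q p) \<le> T" "\<And>p i. real (q p) * r p $ i \<in> \<int>"
        by metis
      have "1 \<le> T ^ Suc CARD('d) * \<bar>det (\<chi> p. homogenize (r p))\<bar>"
        by (rule abs_det_homogenize_rational_ge[OF q nz])
      also have "\<dots> \<le> T ^ Suc CARD('d) * (C * \<rho> ^ N_kd CARD('k) CARD('d))"
        unfolding z(1) using C(2)[OF x z(2)] T by (intro mult_left_mono) auto
      finally show False using small by (simp add: mult_ac)
    qed
    then obtain a b where "a \<noteq> 0" "\<And>r. r \<in> X \<Longrightarrow> a \<bullet> r = b" using hyperplane_if_dets_vanish by blast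
    then show "\<exists>a b. a \<noteq> 0 \<and> (\<forall>z\<in>S \<inter> max_cball x \<rho>.
         denominator_le T (\<Psi> z) \<longrightarrow> a \<bullet> \<Psi> z = b)"
      by (intro exI[of _ a] exI[of _ b]) (auto simp: X_def)
  qed
qed

section \<open>Measures that decay near hyperplanes\<close>

abbreviation slab :: "real^'k \<Rightarrow> real \<Rightarrow> real \<Rightarrow> (real^'k) set" where
  "slab a b e \<equiv> {y. \<bar>a \<bullet> y - b\<bar> \<le> e}"

text \<open>
  Absolute decay in the form that is used below. A slab of half-width \<open>\<bar>a $ i\<bar> * e\<close> around a hyperplane with
  normal vector \<open>a\<close> is contained in the \<open>e\<close>-thickening of the hyperplane if \<open>a $ i\<close> is nonzero: move in direction \<open>i\<close>.
  In the applications \<open>a\<close> is a gradient and \<open>i\<close> is a direction in which it is known to be large.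
\<close>

definition hyperplane_decay :: "(real^'k) set \<Rightarrow> (real^'k) measure \<Rightarrow> real \<Rightarrow> real \<Rightarrow> bool" where
  "hyperplane_decay U \<mu> C \<alpha> \<longleftrightarrow>
     (\<forall>x\<in>measure_support U \<mu>. \<forall>\<rho>. 0 < \<rho> \<longrightarrow> \<rho> \<le> 1 \<longrightarrow> max_cball x \<rho> \<subseteq> U \<longrightarrow>
        (\<forall>\<epsilon>>0. \<forall>a b i. a $ i \<noteq> 0 \<longrightarrow>
           emeasure \<mu> (slab a b (\<bar>a $ i\<bar> * (\<epsilon> * \<rho>)) \<inter> max_cball x \<rho>)
             \<le> ennreal (C * \<epsilon> powr \<alpha>) * emeasure \<mu> (max_cball x \<rho>)))"

lemma hyperplane_decayD:
  assumes "hyperplane_decay U \<mu> C \<alpha>" "x \<in> measure_support U \<mu>" "0 < \<rho>" "\<rho> \<le> 1"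
    "max_cball x \<rho> \<subseteq> U" "0 < \<epsilon>" "a $ i \<noteq> 0"
  shows "emeasure \<mu> (slab a b (\<bar>a $ i\<bar> * (\<epsilon> * \<rho>)) \<inter> max_cball x \<rho>)
             \<le> ennreal (C * \<epsilon> powr \<alpha>) * emeasure \<mu> (max_cball x \<rho>)"
  using assms(1)[unfolded hyperplane_decay_def, rule_format, OF assms(2-7)] .

lemma hyperplane_slab_subset_thickening:
  fixes a :: "real^'k"
  assumes "a $ i \<noteq> 0"
  shows "slab a b (\<bar>a $ i\<bar> * e) \<subseteq> thickening {y. a \<bullet> y = b} e"
proof
  fix y assume "y \<in> slab a b (\<bar>a $ i\<bar> * e)"
  then have y: "\<bar>a \<bullet> y - b\<bar> \<le> \<bar>a $ i\<bar> * e" by simp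
  define s where "s = y - ((a \<bullet> y - b) / a $ i) *\<^sub>R axis i 1"
  have s: "s \<in> {y. a \<bullet> y = b}" using assms by (simp add: s_def inner_diff_right inner_axis)
  have "maxdist y s \<le> norm (y - s)" by (rule infnorm_le_norm)
  also have "\<dots> = \<bar>a \<bullet> y - b\<bar> / \<bar>a $ i\<bar>" by (simp add: s_def)
  also have "\<dots> \<le> e" using y assms by (simp add: field_simps)
  finally have "maxdist y s \<le> e" .
  moreover have "(INF s\<in>{y. a \<bullet> y = b}. maxdist y s) \<le> maxdist y s"
    by (rule cINF_lower[OF _ s]) (auto intro!: bdd_belowI[of _ 0] simp: infnorm_pos_le)
  ultimately show "y \<in> thickening {y. a \<bullet> y = b} e" using s unfolding thickening_def by auto
qed

text \<open>
  The infimum that defines the thickening need not be attained, but it is at most \<open>e\<close> iff there are points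
  of \<open>S\<close> at distance less than \<open>e + 1/n\<close> for all \<open>n\<close>.
\<close>

lemma thickening_borel: "thickening S e \<in> sets borel"
proof (cases "S = {}")
  case False
  have "thickening S e = (\<Inter>n. \<Union>s\<in>S. {y. maxdist y s < e + inverse (real (Suc n))})"
  proof (intro set_eqI iffI)
    fix y assume "y \<in> thickening S e"
    then have "(INF s\<in>S. maxdist y s) < e + inverse (real (Suc n))" for n
      unfolding thickening_def by (intro le_less_trans[of "INF s\<in>S. maxdist y s" e]) auto
    then have "\<exists>s\<in>S. maxdist y s < e + inverse (real (Suc n))" for n
      using False cInf_lessD[of "(\<lambda>s. maxdist y s) ` S"] by (metis (no_types, lifting) image_iff image_is_empty)
    then show "y \<in> (\<Inter>n. \<Union>s\<in>S. {y. maxdist y s < e + inverse (real (Suc n))})" by auto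
  next
    fix y assume y: "y \<in> (\<Inter>n. \<Union>s\<in>S. {y. maxdist y s < e + inverse (real (Suc n))})"
    have "(INF s\<in>S. maxdist y s) \<le> e + inverse (real (Suc n))" for n
    proof -
      obtain s where s: "s \<in> S" "maxdist y s < e + inverse (real (Suc n))" using y by auto
      have "(INF s\<in>S. maxdist y s) \<le> maxdist y s"
        by (rule cINF_lower[OF _ s(1)]) (auto intro!: bdd_belowI[of _ 0] simp: infnorm_pos_le)
      with s show ?thesis by linarith
    qed
    moreover have "(\<lambda>n. e + inverse (real (Suc n))) \<longlonglongrightarrow> e + 0"
      by (intro tendsto_intros LIMSEQ_inverse_real_of_nat)
    ultimately have "(INF s\<in>S. maxdist y s) \<le> e"
      by (intro LIMSEQ_le_const[of _ e]) auto
    then show "y \<in> thickening S e" using False by (simp add: thickening_def)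
  qed
  moreover have "open (\<Union>s\<in>S. {y. maxdist y s < c})" for c
    by (intro open_UN ballI open_Collect_less continuous_intros)
  ultimately show ?thesis by auto
qed (simp add: thickening_def)

lemma sets_on_open:
  assumes "open U" "sets \<mu> = sets (restrict_space borel U)"
  shows "A \<in> sets \<mu> \<longleftrightarrow> A \<in> sets borel \<and> A \<subseteq> U"
  using assms by (auto simp: sets_restrict_space_iff)

lemma absolutely_decaying_imp_hyperplane_decay:
  assumes U: "open U" "sets \<mu> = sets (restrict_space borel U)" and dec: "absolutely_decaying U \<mu>"
  obtains C \<alpha> where "C > 0" "\<alpha> > 0" "hyperplane_decay U \<mu> C \<alpha>"
proof -
  obtain C \<alpha> where C: "C > 0" "\<alpha> > 0" and
    D: "\<forall>x\<in>measure_support U \<mu>. \<forall>\<rho>. 0 < \<rho> \<and> \<rho> \<le> 1 \<and> max_cball x \<rho> \<subseteq> U \<longrightarrow>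
      (\<forall>\<epsilon>>0. \<forall>a b. a \<noteq> 0 \<longrightarrow>
        emeasure \<mu> (thickening {y. a \<bullet> y = b} (\<epsilon> * \<rho>) \<inter> max_cball x \<rho> \<inter> U)
             \<le> ennreal (C * \<epsilon> powr \<alpha>) * emeasure \<mu> (max_cball x \<rho> \<inter> U))"
    using dec unfolding absolutely_decaying_def by (elim exE conjE)
  have "hyperplane_decay U \<mu> C \<alpha>"
    unfolding hyperplane_decay_def
  proof (intro ballI allI impI)
    fix x :: "real^'a" and \<rho> \<epsilon> b :: real and i and a :: "real^'a"
    assume *: "x \<in> measure_support U \<mu>" "0 < \<rho>" "\<rho> \<le> 1" "max_cball x \<rho> \<subseteq> U" "0 < \<epsilon>" "a $ i \<noteq> 0"
    have "emeasure \<mu> (slab a b (\<bar>a $ i\<bar> * (\<epsilon> * \<rho>)) \<inter> max_cball x \<rho>)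
      \<le> emeasure \<mu> (thickening {y. a \<bullet> y = b} (\<epsilon> * \<rho>) \<inter> max_cball x \<rho> \<inter> U)"
      using hyperplane_slab_subset_thickening[OF *(6), of b "\<epsilon> * \<rho>"] *(4) U(1)
      by (intro emeasure_mono) (auto simp: sets_on_open[OF U] intro!: sets.Int thickening_borel)
    also have "\<dots> \<le> ennreal (C * \<epsilon> powr \<alpha>) * emeasure \<mu> (max_cball x \<rho> \<inter> U)"
    proof -
      have "a \<noteq> 0" using *(6) by auto
      then show ?thesis using D[rule_format, of x \<rho> \<epsilon> a b] * by blast
    qed
    also have "max_cball x \<rho> \<inter> U = max_cball x \<rho>" using *(4) by auto
    finally show "emeasure \<mu> (slab a b (\<bar>a $ i\<bar> * (\<epsilon> * \<rho>)) \<inter> max_cball x \<rho>)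
             \<le> ennreal (C * \<epsilon> powr \<alpha>) * emeasure \<mu> (max_cball x \<rho>)" .
  qed
  with C show ?thesis by (rule that)
qed

lemma measure_support_eq:
  "measure_support U \<mu> = U - \<Union>{W. open W \<and> emeasure \<mu> (W \<inter> U) = 0}"
  by (auto simp: measure_support_def zero_less_iff_neq_zero)

lemma measure_support_sets:
  assumes "open U" "sets \<mu> = sets (restrict_space borel U)"
  shows "measure_support U \<mu> \<in> sets \<mu>"
  unfolding sets_on_open[OF assms] measure_support_eq
  by (intro conjI sets.Diff borel_open open_Union assms(1)) auto

lemma AE_measure_support:
  assumes U: "open U" "sets \<mu> = sets (restrict_space borel U)"
  shows "AE v in \<mu>. v \<in> measure_support U \<mu>"
proof -
  obtain \<W> where \<W>: "\<W> \<subseteq> {W. open W \<and> emeasure \<mu> (W \<inter> U) = 0}" "countable \<W>"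
    "\<Union>\<W> = \<Union>{W. open W \<and> emeasure \<mu> (W \<inter> U) = 0}"
    using Lindelof[of "{W. open W \<and> emeasure \<mu> (W \<inter> U) = 0}"] by auto
  have "(\<Union>W\<in>\<W>. W \<inter> U) \<in> null_sets \<mu>"
    using \<W>(1,2) U(1) by (intro null_sets_UN') (auto simp: null_sets_def sets_on_open[OF U])
  moreover have "space \<mu> = U" using sets_eq_imp_space_eq[OF U(2)] by (simp add: space_restrict_space)
  ultimately show ?thesis
    using \<W>(3) by (intro AE_I'[of "\<Union>W\<in>\<W>. W \<inter> U"]) (auto simp: measure_support_eq)
qed

text \<open>
  From a local to a global estimate. Choose one point of \<open>E\<close> in every cell of a grid of side length \<open>s\<close>
  that meets \<open>E\<close>. The cubes of radius \<open>s\<close> around the chosen points cover \<open>E\<close>, and a given point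
  is in at most \<open>(2 m + 3) ^ k\<close> of the enlarged cubes of radius \<open>m s\<close>, because there are only that many cells
  nearby. The centres belong to \<open>E\<close>, which is essential since the decay condition concerns cubes
  centred at points of the support.
\<close>

lemma emeasure_le_by_grid:
  fixes E V :: "(real^'k) set" and m :: nat and s :: real
  assumes U: "open U" "sets \<mu> = sets (restrict_space borel U)"
    and E: "E \<in> sets \<mu>" "bounded E" and V: "V \<in> sets \<mu>" and s: "0 < s"
    and sub: "\<And>x. x \<in> E \<Longrightarrow> max_cball x (m * s) \<subseteq> V"
    and le: "\<And>x. x \<in> E \<Longrightarrow> emeasure \<mu> (E \<inter> max_cball x s) \<le> \<beta> * emeasure \<mu> (max_cball x (m * s))"
  shows "emeasure \<mu> E \<le> \<beta> * (ennreal (real (2 * m + 3) ^ CARD('k)) * emeasure \<mu> V)"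
proof -
  define g :: "real^'k \<Rightarrow> 'k \<Rightarrow> int" where "g y = (\<lambda>i. \<lfloor>y $ i / s\<rfloor>)" for y
  have "finite (g ` E)"
  proof -
    obtain b where b: "\<And>y. y \<in> E \<Longrightarrow> norm y \<le> b" using E(2) by (auto simp: bounded_iff)
    have "g y \<in> UNIV \<rightarrow>\<^sub>E {\<lfloor>- b / s\<rfloor>..\<lfloor>b / s\<rfloor>}" if "y \<in> E" for y
    proof -
      have "- b \<le> y $ i" "y $ i \<le> b" for i using b[OF that] component_le_norm_cart[of y i] by linarith+
      then have "- b / s \<le> y $ i / s" "y $ i / s \<le> b / s" for i
        using s by (intro divide_right_mono; simp)+
      then show ?thesis by (auto simp: g_def intro!: floor_mono)
    qed
    then have "g ` E \<subseteq> UNIV \<rightarrow>\<^sub>E {\<lfloor>- b / s\<rfloor>..\<lfloor>b / s\<rfloor>}" by auto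
    then show ?thesis by (rule finite_subset) (auto intro!: finite_PiE)
  qed
  define G where "G = g ` E"
  define c where "c h = (SOME y. y \<in> E \<and> g y = h)" for h
  have c: "c h \<in> E" "g (c h) = h" if "h \<in> G" for h
    using someI_ex[of "\<lambda>y. y \<in> E \<and> g y = h"] that by (auto simp: c_def G_def)
  have msr: "max_cball x r \<inter> E \<in> sets \<mu>" for x r using E(1) by (auto simp: sets_on_open[OF U])
  have ballm: "max_cball (c h) (m * s) \<in> sets \<mu>" if "h \<in> G" for h
    using sub[OF c(1)[OF that]] V by (auto simp: sets_on_open[OF U])
  have cell: "y \<in> max_cball x s" if "g x = g y" for x y
    unfolding mem_max_cball
  proof
    fix i
    have "\<lfloor>x $ i / s\<rfloor> = \<lfloor>y $ i / s\<rfloor>" using that by (auto simp: g_def fun_eq_iff)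
    then have "\<bar>y $ i / s - x $ i / s\<bar> \<le> 1" by linarith
    then have "\<bar>(y $ i - x $ i) / s\<bar> \<le> 1" by (simp add: diff_divide_distrib)
    then show "\<bar>y $ i - x $ i\<bar> \<le> s" using s by (simp add: field_simps)
  qed
  have "E \<subseteq> (\<Union>h\<in>G. E \<inter> max_cball (c h) s)"
  proof
    fix y assume "y \<in> E"
    then have "g y \<in> G" by (simp add: G_def)
    with c[OF this] cell \<open>y \<in> E\<close> show "y \<in> (\<Union>h\<in>G. E \<inter> max_cball (c h) s)" by blast
  qed
  then have "emeasure \<mu> E \<le> emeasure \<mu> (\<Union>h\<in>G. E \<inter> max_cball (c h) s)"
    using \<open>finite (g ` E)\<close> msr by (intro emeasure_mono sets.finite_UN) (auto simp: G_def Int_commute)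
  also have "\<dots> \<le> (\<Sum>h\<in>G. emeasure \<mu> (E \<inter> max_cball (c h) s))"
    using \<open>finite (g ` E)\<close> msr by (intro emeasure_subadditive_finite) (auto simp: G_def Int_commute)
  also have "\<dots> \<le> (\<Sum>h\<in>G. \<beta> * emeasure \<mu> (max_cball (c h) (m * s)))"
    by (intro sum_mono le c)
  also have "\<dots> = \<beta> * (\<Sum>h\<in>G. emeasure \<mu> (max_cball (c h) (m * s)))" by (simp add: sum_distrib_left)
  also have "(\<Sum>h\<in>G. emeasure \<mu> (max_cball (c h) (m * s)))
     = (\<Sum>h\<in>G. \<integral>\<^sup>+y. indicator (max_cball (c h) (m * s)) y \<partial>\<mu>)"
    using ballm by (intro sum.cong) auto
  also have "\<dots> = (\<integral>\<^sup>+y. (\<Sum>h\<in>G. indicator (max_cball (c h) (m * s)) y) \<partial>\<mu>)"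
    using ballm by (intro nn_integral_sum[symmetric]) auto
  also have "\<dots> \<le> (\<integral>\<^sup>+y. ennreal (real (2 * m + 3) ^ CARD('k)) * indicator V y \<partial>\<mu>)"
  proof (intro nn_integral_mono)
    fix y
    define H where "H = {h \<in> G. y \<in> max_cball (c h) (m * s)}"
    have eq: "(\<Sum>h\<in>G. indicator (max_cball (c h) (m * s)) y) = (of_nat (card H) :: ennreal)"
      using \<open>finite (g ` E)\<close> by (simp add: H_def G_def indicator_def sum.If_cases Int_def)
    show "(\<Sum>h\<in>G. indicator (max_cball (c h) (m * s)) y)
      \<le> ennreal (real (2 * m + 3) ^ CARD('k)) * indicator V y"
    proof (cases "y \<in> V")
      case False
      then have "H = {}" using sub c by (auto simp: H_def)
      then show ?thesis by (simp only: eq) simp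
    next
      case True
      have "H \<subseteq> PiE UNIV (\<lambda>i. {\<lfloor>y $ i / s\<rfloor> - int m - 1..\<lfloor>y $ i / s\<rfloor> + int m + 1})"
      proof
        fix h assume "h \<in> H"
        then have h: "h \<in> G" "y \<in> max_cball (c h) (m * s)" by (auto simp: H_def)
        have "h i \<in> {\<lfloor>y $ i / s\<rfloor> - int m - 1..\<lfloor>y $ i / s\<rfloor> + int m + 1}" for i
        proof -
          have "\<bar>y $ i - c h $ i\<bar> \<le> m * s" using h(2) by (simp add: mem_max_cball)
          then have "\<bar>y $ i / s - c h $ i / s\<bar> \<le> m" using s by (simp add: field_simps flip: diff_divide_distrib)
          moreover have "h i = \<lfloor>c h $ i / s\<rfloor>" using c(2)[OF h(1)] by (auto simp: g_def fun_eq_iff)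
          ultimately show ?thesis by (simp, linarith)
        qed
        then show "h \<in> PiE UNIV (\<lambda>i. {\<lfloor>y $ i / s\<rfloor> - int m - 1..\<lfloor>y $ i / s\<rfloor> + int m + 1})" by auto
      qed
      then have "card H \<le> card (PiE UNIV (\<lambda>i::'k. {\<lfloor>y $ i / s\<rfloor> - int m - 1..\<lfloor>y $ i / s\<rfloor> + int m + 1}))"
        by (intro card_mono finite_PiE) auto
      also have "\<dots> = (2 * m + 3) ^ CARD('k)"
      proof -
        have "nat (\<lfloor>y $ i / s\<rfloor> + int m + 1 - (\<lfloor>y $ i / s\<rfloor> - int m - 1) + 1) = 2 * m + 3" for i by simp
        then show ?thesis by (simp add: card_PiE)
      qed
      finally have "real (card H) \<le> real (2 * m + 3) ^ CARD('k)" unfolding of_nat_power[symmetric] by (rule of_nat_mono)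
      then show ?thesis using True unfolding eq by (simp add: ennreal_of_nat_eq_real_of_nat ennreal_leI)
    qed
  qed
  also have "\<dots> = ennreal (real (2 * m + 3) ^ CARD('k)) * emeasure \<mu> V"
    using V by (simp add: nn_integral_cmult_indicator)
  finally show ?thesis by (simp add: mult_left_mono)
qed

lemma sets_slab: "slab a b c \<in> sets (borel :: (real^'k) measure)"
  by (intro borel_closed closed_Collect_le continuous_intros)

text \<open>
  At scale \<open>r\<close> the function differs from its linearization at \<open>v\<close> by a multiple of \<open>K r\<^sup>2\<close> only.
  So in the cube of radius \<open>r\<close> around \<open>v\<close> the set where \<open>\<bar>h\<bar> \<le> s\<close> is contained in a slab around a
  hyperplane whose normal vector, the gradient at \<open>v\<close>, has a coordinate of size at least \<open>t\<close>.
\<close>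

lemma small_value_large_gradient_measure:
  fixes h :: "real^'k \<Rightarrow> real"
  assumes U: "open U" "sets \<mu> = sets (restrict_space borel U)" and dec: "hyperplane_decay U \<mu> C \<alpha>"
    and ball: "max_cball x (2 * \<rho>) \<subseteq> U" and h: "smooth_on_open U h"
    and K: "\<And>y j l. y \<in> max_cball x (2 * \<rho>) \<Longrightarrow> \<bar>iter_partial [j, l] h y\<bar> \<le> K"
    and r: "0 < r" "r \<le> \<rho>" "\<rho> \<le> 1" and t: "0 < t" and \<epsilon>: "0 < \<epsilon>"
    and small: "s + (real CARD('k))\<^sup>2 * K * r\<^sup>2 \<le> t * (\<epsilon> * r)"
  shows "emeasure \<mu> {v \<in> max_cball x \<rho> \<inter> measure_support U \<mu>. \<bar>h v\<bar> \<le> s \<and> t \<le> \<bar>partial_deriv i h v\<bar>}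
     \<le> ennreal (C * \<epsilon> powr \<alpha>) * (ennreal (5 ^ CARD('k)) * emeasure \<mu> (max_cball x (2 * \<rho>)))" (is "emeasure \<mu> ?E \<le> _")
proof -
  have sub: "max_cball x \<rho> \<subseteq> max_cball x (2 * \<rho>)" using r by (intro max_cball_mono) auto
  have closed1: "closed {v \<in> max_cball x \<rho>. \<bar>h v\<bar> \<le> s \<and> t \<le> \<bar>partial_deriv i h v\<bar>}"
  proof -
    have c: "continuous_on (max_cball x \<rho>) h" "continuous_on (max_cball x \<rho>) (partial_deriv i h)"
      using smooth_on_open_continuous[OF h] smooth_on_open_continuous[OF smooth_on_open_partial_deriv[OF h]]
        sub ball continuous_on_subset by blast+
    have "{v \<in> max_cball x \<rho>. \<bar>h v\<bar> \<le> s \<and> t \<le> \<bar>partial_deriv i h v\<bar>}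
      = (max_cball x \<rho> \<inter> (\<lambda>v. \<bar>h v\<bar>) -` {..s}) \<inter> (max_cball x \<rho> \<inter> (\<lambda>v. \<bar>partial_deriv i h v\<bar>) -` {t..})" by auto
    also have "closed \<dots>"
      by (intro closed_Int continuous_closed_preimage continuous_on_rabs c) auto
    finally show ?thesis .
  qed
  have "?E = {v \<in> max_cball x \<rho>. \<bar>h v\<bar> \<le> s \<and> t \<le> \<bar>partial_deriv i h v\<bar>} \<inter> measure_support U \<mu>" by auto
  also have "\<dots> \<in> sets \<mu>"
    using measure_support_sets[OF U] closed1 by (auto simp: sets_on_open[OF U])
  finally have E: "?E \<in> sets \<mu>" .
  have "emeasure \<mu> ?E \<le> ennreal (C * \<epsilon> powr \<alpha>) *
      (ennreal (real (2 * 1 + 3) ^ CARD('k)) * emeasure \<mu> (max_cball x (2 * \<rho>)))"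
  proof (rule emeasure_le_by_grid[OF U E, where s=r])
    show "bounded ?E" by (rule bounded_subset[of "max_cball x \<rho>"]) (auto simp: compact_imp_bounded)
    show "max_cball x (2 * \<rho>) \<in> sets \<mu>" using ball by (simp add: sets_on_open[OF U])
    show "0 < r" by fact
    fix v assume v: "v \<in> ?E"
    show sub': "max_cball v (real 1 * r) \<subseteq> max_cball x (2 * \<rho>)"
      using v r by (auto intro: max_cball_trans)
    define a :: "real^'k" where "a = (\<chi> j. partial_deriv j h v)"
    have "?E \<inter> max_cball v r \<subseteq> slab a (a \<bullet> v - h v) (\<bar>a $ i\<bar> * (\<epsilon> * r)) \<inter> max_cball v r"
    proof
      fix y assume y: "y \<in> ?E \<inter> max_cball v r"
      have "\<bar>h y - h v - (\<Sum>j\<in>UNIV. (y $ j - v $ j) * partial_deriv j h v)\<bar> \<le> (real CARD('k))\<^sup>2 * K * r\<^sup>2"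
      proof (rule second_order_bound[OF h convex_max_cball ball _ _ K])
        show "v \<in> max_cball x (2 * \<rho>)" "y \<in> max_cball x (2 * \<rho>)" using y v sub by auto
        show "\<bar>y $ j - v $ j\<bar> \<le> r" for j using y by (simp add: mem_max_cball)
      qed
      moreover have "(\<Sum>j\<in>UNIV. (y $ j - v $ j) * partial_deriv j h v) = a \<bullet> y - a \<bullet> v"
        by (simp add: a_def inner_vec_def algebra_simps sum_subtractf)
      moreover have "\<bar>h y\<bar> \<le> s" "t \<le> \<bar>a $ i\<bar>" using y v by (auto simp: a_def)
      moreover have "t * (\<epsilon> * r) \<le> \<bar>a $ i\<bar> * (\<epsilon> * r)" using \<open>t \<le> \<bar>a $ i\<bar>\<close> \<epsilon> r by (intro mult_right_mono) auto
      ultimately have "\<bar>a \<bullet> y - (a \<bullet> v - h v)\<bar> \<le> \<bar>a $ i\<bar> * (\<epsilon> * r)" using small by linarith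
      then show "y \<in> slab a (a \<bullet> v - h v) (\<bar>a $ i\<bar> * (\<epsilon> * r)) \<inter> max_cball v r" using y by simp
    qed
    then have "emeasure \<mu> (?E \<inter> max_cball v r)
       \<le> emeasure \<mu> (slab a (a \<bullet> v - h v) (\<bar>a $ i\<bar> * (\<epsilon> * r)) \<inter> max_cball v r)"
      using sub' ball by (intro emeasure_mono) (auto simp: sets_on_open[OF U] sets_slab)
    also have "\<dots> \<le> ennreal (C * \<epsilon> powr \<alpha>) * emeasure \<mu> (max_cball v r)"
      by (rule hyperplane_decayD[OF dec]) (use v r \<epsilon> t sub' ball in \<open>auto simp: a_def\<close>)
    finally show "emeasure \<mu> (?E \<inter> max_cball v r) \<le> ennreal (C * \<epsilon> powr \<alpha>) * emeasure \<mu> (max_cball v (real 1 * r))"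
      by simp
  qed
  then show ?thesis by simp
qed

lemma sets_sublevel:
  fixes h :: "real^'k \<Rightarrow> real"
  assumes U: "open U" "sets \<mu> = sets (restrict_space borel U)"
    and "smooth_on_open U h" "max_cball x \<rho> \<subseteq> U"
  shows "{v \<in> max_cball x \<rho> \<inter> measure_support U \<mu>. \<bar>h v\<bar> \<le> s} \<in> sets \<mu>"
proof -
  have "continuous_on (max_cball x \<rho>) (\<lambda>v. \<bar>h v\<bar>)"
    using smooth_on_open_continuous[OF assms(3)] assms(4) by (intro continuous_on_rabs) (rule continuous_on_subset)
  then have "closed (max_cball x \<rho> \<inter> (\<lambda>v. \<bar>h v\<bar>) -` {..s})"
    by (rule continuous_closed_preimage) auto
  moreover have "{v \<in> max_cball x \<rho> \<inter> measure_support U \<mu>. \<bar>h v\<bar> \<le> s} =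
      (max_cball x \<rho> \<inter> (\<lambda>v. \<bar>h v\<bar>) -` {..s}) \<inter> measure_support U \<mu>" by auto
  ultimately show ?thesis
    using measure_support_sets[OF U] by (auto simp: sets_on_open[OF U])
qed

text \<open>
  Either the derivative of \<open>h\<close> in the direction that is applied first is larger than a threshold, and the
  previous lemma applies, or that derivative is itself small, and the induction hypothesis applies to it.
  The derivative at the end of this chain is at least \<open>1/2\<close>, hence not small. Each step costs a fourth root: if
  \<open>\<bar>h\<bar> \<le> w ^ 4\<close> and the rescaled derivative is at least \<open>w\<close>, then at scale \<open>\<rho> w\<^sup>2\<close> both \<open>h\<close> and the error of its
  linearization are of order \<open>w ^ 4\<close>, and the slab has relative width of order \<open>w ^ 4 / (w * w\<^sup>2) = w\<close>.
\<close>

lemma sublevel_measure: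
  fixes h :: "real^'k \<Rightarrow> real"
  assumes U: "open U" "sets \<mu> = sets (restrict_space borel U)"
    and dec: "hyperplane_decay U \<mu> C \<alpha>" "C > 0" "\<alpha> > 0"
    and ball: "max_cball x (2 * \<rho>) \<subseteq> U" and \<rho>: "0 < \<rho>" "\<rho> \<le> \<sigma>" "\<rho> \<le> 1"
    and \<theta>: "0 < \<theta>" "\<theta> < 1/2" and K: "0 \<le> K"
  shows "smooth_on_open U h \<Longrightarrow>
    (\<And>js y. js \<noteq> [] \<Longrightarrow> length js \<le> Suc (length is) \<Longrightarrow> y \<in> max_cball x (2 * \<rho>) \<Longrightarrow>
        \<sigma> ^ length js * \<bar>iter_partial js h y\<bar> \<le> K) \<Longrightarrow>
    (\<And>y. y \<in> max_cball x \<rho> \<Longrightarrow> 1/2 \<le> \<sigma> ^ length is * \<bar>iter_partial is h y\<bar>) \<Longrightarrow>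
    emeasure \<mu> {v \<in> max_cball x \<rho> \<inter> measure_support U \<mu>. \<bar>h v\<bar> \<le> \<theta> ^ (4 ^ length is)}
     \<le> of_nat (length is) *
       (ennreal (C * ((1 + (real CARD('k))\<^sup>2 * K) * (\<sigma> / \<rho>) * \<theta>) powr \<alpha>) *
         (ennreal (5 ^ CARD('k)) * emeasure \<mu> (max_cball x (2 * \<rho>))))"
proof (induction "is" arbitrary: h rule: rev_induct)
  case Nil
  have "{v \<in> max_cball x \<rho> \<inter> measure_support U \<mu>. \<bar>h v\<bar> \<le> \<theta> ^ (4 ^ length ([] :: 'k list))} = {}"
    using Nil(3) \<theta> by force
  then show ?case by (simp only: emeasure_empty) simp
next
  case (snoc i "is")
  define q :: nat where "q = 4 ^ length is"
  have q: "1 \<le> q" "4 ^ length (is @ [i]) = 4 * q" by (simp_all add: q_def)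
  have \<sigma>: "0 < \<sigma>" using \<rho> by simp
  \<comment> \<open>The factor \<open>\<sigma>\<close> makes the assumptions on the rescaled derivatives of \<open>h\<close> hold for \<open>h'\<close>.\<close>
  define h' where "h' y = \<sigma> * partial_deriv i h y" for y
  note smp = smooth_on_open_partial_deriv[OF snoc.prems(1), of i]
  have h': "smooth_on_open U h'"
    unfolding h'_def by (rule smooth_on_open_bounded_linear[OF bounded_linear_mult_right smp])
  have it: "iter_partial js h' y = \<sigma> * iter_partial (js @ [i]) h y" if "y \<in> max_cball x (2 * \<rho>)" for js y
    using iter_partial_bounded_linear[OF bounded_linear_mult_right smp, of y js \<sigma>] that ball
    by (auto simp: h'_def[abs_def] iter_partial_append iter_partial_Cons)
  have sub: "max_cball x \<rho> \<subseteq> max_cball x (2 * \<rho>)" using \<rho> by (intro max_cball_mono) auto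
  let ?S = "max_cball x \<rho> \<inter> measure_support U \<mu>"
  let ?\<epsilon> = "(1 + (real CARD('k))\<^sup>2 * K) * (\<sigma> / \<rho>) * \<theta>"
  let ?X = "ennreal (C * ?\<epsilon> powr \<alpha>) * (ennreal (5 ^ CARD('k)) * emeasure \<mu> (max_cball x (2 * \<rho>)))"
  let ?E1 = "{v \<in> ?S. \<bar>h v\<bar> \<le> \<theta> ^ (4 * q) \<and> \<theta> ^ q / \<sigma> \<le> \<bar>partial_deriv i h v\<bar>}"
  let ?E2 = "{v \<in> ?S. \<bar>h' v\<bar> \<le> \<theta> ^ q}"
  have IH: "emeasure \<mu> ?E2 \<le> of_nat (length is) * ?X"
    unfolding q_def
  proof (rule snoc.IH[OF h'])
    show "\<sigma> ^ length js * \<bar>iter_partial js h' y\<bar> \<le> K"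
      if "js \<noteq> []" "length js \<le> Suc (length is)" "y \<in> max_cball x (2 * \<rho>)" for js y
      using snoc.prems(2)[of "js @ [i]" y] that \<sigma> by (simp add: it abs_mult mult_ac)
    show "1/2 \<le> \<sigma> ^ length is * \<bar>iter_partial is h' y\<bar>" if "y \<in> max_cball x \<rho>" for y
      using snoc.prems(3)[OF that] that sub \<sigma> by (simp add: it subset_iff abs_mult mult_ac)
  qed
  have E1: "emeasure \<mu> ?E1 \<le> ?X"
  proof (rule small_value_large_gradient_measure[OF U dec(1) ball snoc.prems(1), where K="K / \<sigma>\<^sup>2" and r="\<rho> * \<theta> ^ (2 * q)"])
    show "\<bar>iter_partial [j, l] h y\<bar> \<le> K / \<sigma>\<^sup>2" if "y \<in> max_cball x (2 * \<rho>)" for y j l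
      using snoc.prems(2)[of "[j, l]" y] that \<sigma> by (simp add: field_simps power2_eq_square)
    show "0 < \<rho> * \<theta> ^ (2 * q)" "0 < \<theta> ^ q / \<sigma>" "\<rho> \<le> 1" using \<rho> \<theta> \<sigma> by auto
    show "\<rho> * \<theta> ^ (2 * q) \<le> \<rho>" using \<rho> \<theta> by (simp add: mult_left_le power_le_one)
    show "0 < ?\<epsilon>" using \<rho> \<theta> \<sigma> K by (intro mult_pos_pos add_pos_nonneg) auto
    define w where "w = \<theta> ^ q"
    have w: "0 < w" "w \<le> \<theta>" "\<theta> ^ (2 * q) = w\<^sup>2" "\<theta> ^ (4 * q) = w ^ 4"
      using \<theta> q(1) power_decreasing[of 1 q \<theta>] by (simp_all add: w_def flip: power_mult) (simp_all add: mult.commute)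
    have "(real CARD('k))\<^sup>2 * (K / \<sigma>\<^sup>2) * (\<rho> * w\<^sup>2)\<^sup>2 = (real CARD('k))\<^sup>2 * K * (\<rho> / \<sigma>)\<^sup>2 * w ^ 4"
      by (simp add: power2_eq_square power4_eq_xxxx field_simps)
    also have "\<dots> \<le> (real CARD('k))\<^sup>2 * K * 1 * w ^ 4"
      using \<rho> \<sigma> K w by (intro mult_right_mono mult_left_mono) (auto intro!: power_le_one)
    finally have "w ^ 4 + (real CARD('k))\<^sup>2 * (K / \<sigma>\<^sup>2) * (\<rho> * w\<^sup>2)\<^sup>2 \<le> (1 + (real CARD('k))\<^sup>2 * K) * w ^ 4"
      by (simp add: algebra_simps)
    also have "\<dots> = (1 + (real CARD('k))\<^sup>2 * K) * w ^ 3 * w"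
      by (simp add: power3_eq_cube power4_eq_xxxx)
    also have "\<dots> \<le> (1 + (real CARD('k))\<^sup>2 * K) * w ^ 3 * \<theta>"
      using w K by (intro mult_left_mono mult_nonneg_nonneg add_nonneg_nonneg) auto
    also have "\<dots> = w / \<sigma> * (?\<epsilon> * (\<rho> * w\<^sup>2))"
      using \<sigma> \<rho> by (simp add: field_simps power2_eq_square power3_eq_cube)
    finally show "\<theta> ^ (4 * q) + (real CARD('k))\<^sup>2 * (K / \<sigma>\<^sup>2) * (\<rho> * \<theta> ^ (2 * q))\<^sup>2
       \<le> \<theta> ^ q / \<sigma> * (?\<epsilon> * (\<rho> * \<theta> ^ (2 * q)))"
      unfolding w(3,4) by (simp add: w_def)
  qed
  have ballU: "max_cball x \<rho> \<subseteq> U" using sub ball by blast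
  have E2s: "?E2 \<in> sets \<mu>" by (rule sets_sublevel[OF U h' ballU])
  have E1s: "?E1 \<in> sets \<mu>"
  proof -
    have "?E1 = {v \<in> ?S. \<bar>h v\<bar> \<le> \<theta> ^ (4 * q)} \<inter>
        (max_cball x \<rho> \<inter> (\<lambda>v. \<bar>partial_deriv i h v\<bar>) -` {\<theta> ^ q / \<sigma>..})" by auto
    moreover have "continuous_on (max_cball x \<rho>) (\<lambda>v. \<bar>partial_deriv i h v\<bar>)"
      using smooth_on_open_continuous[OF smp] ballU by (intro continuous_on_rabs) (rule continuous_on_subset)
    then have "closed (max_cball x \<rho> \<inter> (\<lambda>v. \<bar>partial_deriv i h v\<bar>) -` {\<theta> ^ q / \<sigma>..})"
      by (rule continuous_closed_preimage) auto
    then have "max_cball x \<rho> \<inter> (\<lambda>v. \<bar>partial_deriv i h v\<bar>) -` {\<theta> ^ q / \<sigma>..} \<in> sets \<mu>"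
      using ballU by (auto simp: sets_on_open[OF U])
    ultimately show ?thesis using sets_sublevel[OF U snoc.prems(1) ballU] by auto
  qed
  have "{v \<in> ?S. \<bar>h v\<bar> \<le> \<theta> ^ (4 ^ length (is @ [i]))} \<subseteq> ?E1 \<union> ?E2"
    unfolding q(2) using \<sigma> by (auto simp: h'_def abs_mult field_simps)
  then have "emeasure \<mu> {v \<in> ?S. \<bar>h v\<bar> \<le> \<theta> ^ (4 ^ length (is @ [i]))} \<le> emeasure \<mu> (?E1 \<union> ?E2)"
    using E1s E2s by (intro emeasure_mono) auto
  also have "\<dots> \<le> emeasure \<mu> ?E1 + emeasure \<mu> ?E2" using E1s E2s by (rule emeasure_subadditive)
  also have "\<dots> \<le> ?X + of_nat (length is) * ?X" by (intro add_mono E1 IH)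
  also have "\<dots> = of_nat (length (is @ [i])) * ?X" by (simp add: distrib_right)
  finally show ?case .
qed

section \<open>Neighbourhoods of hyperplane sections\<close>

text \<open>
  At \<open>u\<close> the lower bound holds by compactness of the unit sphere. It persists nearby because only finitely many
  derivatives, which are continuous, are involved.
\<close>

lemma uniform_nondegeneracy:
  fixes \<Psi> :: "real^'k \<Rightarrow> real^'d"
  assumes sm: "smooth_on_open U \<Psi>" and u: "u \<in> U"
    and nd: "\<And>a. a \<noteq> 0 \<Longrightarrow> \<exists>is. is \<noteq> [] \<and> length is \<le> D \<and> a \<bullet> iter_partial is \<Psi> u \<noteq> 0"
  obtains R c where "0 < R" "R \<le> 1" "0 < c" "max_cball u R \<subseteq> U"
    "\<And>v a. v \<in> max_cball u R \<Longrightarrow>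
       \<exists>is. is \<noteq> [] \<and> length is \<le> D \<and> c * norm a \<le> \<bar>a \<bullet> iter_partial is \<Psi> v\<bar>"
proof -
  define I where "I = {is :: 'k list. is \<noteq> [] \<and> length is \<le> D}"
  have fin: "finite I"
    using finite_lists_length_le[of "UNIV :: 'k set" D] by (auto simp: I_def elim: rev_finite_subset)
  define F where "F v a = (\<Sum>is\<in>I. \<bar>a \<bullet> iter_partial is \<Psi> v\<bar>)" for v a
  have sphere: "sphere (0 :: real^'d) 1 \<noteq> {}" by simp
  have "continuous_on (sphere 0 1) (F u)" unfolding F_def by (intro continuous_intros)
  then obtain a0 where a0: "a0 \<in> sphere 0 1" "\<And>a. a \<in> sphere 0 1 \<Longrightarrow> F u a0 \<le> F u a"
    using continuous_attains_inf[OF compact_sphere sphere] by blast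
  obtain is0 where is0: "is0 \<in> I" "a0 \<bullet> iter_partial is0 \<Psi> u \<noteq> 0"
    using nd[of a0] a0(1) by (force simp: I_def)
  define n where "n = real (card I)"
  have n: "0 < n" using is0(1) fin by (auto simp: n_def card_gt_0_iff)
  have "0 < \<bar>a0 \<bullet> iter_partial is0 \<Psi> u\<bar>" using is0 by simp
  also have "\<dots> \<le> F u a0" unfolding F_def using is0(1) fin by (intro member_le_sum) auto
  finally have pos: "0 < F u a0" .
  \<comment> \<open>If all summands of \<open>F\<close> were below \<open>\<eta> / 2\<close> at a point where the derivatives differ from those at \<open>u\<close> by
    less than \<open>\<eta>\<close>, then \<open>F u\<close> would be below \<open>3 n \<eta> / 2\<close>, which is less than its minimum.\<close>
  define \<eta> where "\<eta> = F u a0 / (2 * n)"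
  have \<eta>: "0 < \<eta>" using pos n by (simp add: \<eta>_def)
  have "isCont (iter_partial is \<Psi>) u" for "is"
    using continuous_on_iter_partial[OF sm order_refl, of "is"] smooth_on_open_openD[OF sm] u
    by (simp add: continuous_on_eq_continuous_at)
  then have "\<forall>\<^sub>F v in nhds u. dist (iter_partial is \<Psi> v) (iter_partial is \<Psi> u) < \<eta>" for "is"
    using \<eta> by (metis isCont_def tendsto_at_iff_tendsto_nhds tendstoD)
  then have "\<forall>\<^sub>F v in nhds u. \<forall>is\<in>I. dist (iter_partial is \<Psi> v) (iter_partial is \<Psi> u) < \<eta>"
    using fin by (intro eventually_ball_finite) auto
  then obtain V where V: "open V" "u \<in> V"
    "\<And>v is. v \<in> V \<Longrightarrow> is \<in> I \<Longrightarrow> dist (iter_partial is \<Psi> v) (iter_partial is \<Psi> u) < \<eta>"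
    unfolding eventually_nhds by blast
  have "open (V \<inter> U)" "u \<in> V \<inter> U" using V u smooth_on_open_openD[OF sm] by auto
  then obtain R where R: "0 < R" "R \<le> 1" "max_cball u R \<subseteq> V \<inter> U" by (rule max_cball_subset_open)
  have ex: "\<exists>is. is \<noteq> [] \<and> length is \<le> D \<and> \<eta> / 2 * norm a \<le> \<bar>a \<bullet> iter_partial is \<Psi> v\<bar>"
    if v: "v \<in> max_cball u R" for v and a :: "real^'d"
  proof (cases "a = 0")
    case True
    then show ?thesis using is0 by (auto simp: I_def)
  next
    case False
    define e where "e = (1 / norm a) *\<^sub>R a"
    have e: "norm e = 1" using False by (simp add: e_def)
    have ae: "a \<bullet> y = norm a * (e \<bullet> y)" for y using False by (simp add: e_def)
    have "\<exists>is\<in>I. \<eta> / 2 \<le> \<bar>e \<bullet> iter_partial is \<Psi> v\<bar>"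
    proof (rule ccontr)
      assume "\<not> (\<exists>is\<in>I. \<eta> / 2 \<le> \<bar>e \<bullet> iter_partial is \<Psi> v\<bar>)"
      then have small: "\<bar>e \<bullet> iter_partial is \<Psi> v\<bar> < \<eta> / 2" if "is \<in> I" for "is" using that by force
      have "F u a0 \<le> F u e" using a0(2)[of e] e by simp
      also have "\<dots> < (\<Sum>is\<in>I. \<eta> + \<eta> / 2)"
        unfolding F_def
      proof (intro sum_strict_mono fin)
        show "I \<noteq> {}" using is0 by auto
        fix "is" assume i: "is \<in> I"
        have "\<bar>e \<bullet> (iter_partial is \<Psi> u - iter_partial is \<Psi> v)\<bar>
          \<le> norm e * norm (iter_partial is \<Psi> u - iter_partial is \<Psi> v)" by (rule Cauchy_Schwarz_ineq2)
        also have "\<dots> \<le> \<eta>" using V(3)[of v "is"] R(3) v i e by (auto simp: dist_norm norm_minus_commute)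
        finally show "\<bar>e \<bullet> iter_partial is \<Psi> u\<bar> < \<eta> + \<eta> / 2"
          using small[OF i] by (simp add: inner_diff_right)
      qed
      also have "\<dots> = n * (\<eta> + \<eta> / 2)" by (simp add: n_def)
      also have "\<dots> \<le> F u a0" using pos n by (simp add: \<eta>_def field_simps)
      finally show False by simp
    qed
    then obtain "is" where i: "is \<in> I" "\<eta> / 2 \<le> \<bar>e \<bullet> iter_partial is \<Psi> v\<bar>" by blast
    then have "norm a * (\<eta> / 2) \<le> \<bar>a \<bullet> iter_partial is \<Psi> v\<bar>"
      unfolding ae abs_mult using \<eta> by (intro mult_mono) auto
    then show ?thesis using i(1) by (auto simp: I_def mult.commute)
  qed
  show ?thesis
    using R \<eta> ex by (intro that[of R "\<eta> / 2"]) auto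
qed

text \<open>
  Bounds for the derivatives of orders up to \<open>D\<close> at the centre of a cube and for those of order \<open>D + 1\<close> on the
  whole cube give bounds for all of them on the cube, by the mean value theorem and descending
  induction on the order. Each step multiplies the bound by at most \<open>1 + 2 k\<close>.
\<close>

lemma rescaled_derivatives_bounded:
  fixes h :: "real^'k \<Rightarrow> real"
  assumes h: "smooth_on_open U h" and ball: "max_cball x (2 * \<sigma>) \<subseteq> U" and \<sigma>: "0 < \<sigma>"
    and centre: "\<And>js. js \<noteq> [] \<Longrightarrow> length js \<le> D \<Longrightarrow> \<sigma> ^ length js * \<bar>iter_partial js h x\<bar> \<le> 1"
    and top: "\<And>js y. length js = Suc D \<Longrightarrow> y \<in> max_cball x (2 * \<sigma>) \<Longrightarrow>
       \<sigma> ^ Suc D * \<bar>iter_partial js h y\<bar> \<le> 1"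
    and js: "js \<noteq> []" "length js \<le> Suc D" "y \<in> max_cball x (2 * \<sigma>)"
  shows "\<sigma> ^ length js * \<bar>iter_partial js h y\<bar> \<le> (1 + 2 * real CARD('k)) ^ Suc D"
proof -
  let ?k = "real CARD('k)"
  have x: "x \<in> max_cball x (2 * \<sigma>)" using \<sigma> by (simp add: mem_max_cball)
  have bound: "\<sigma> ^ length js * \<bar>iter_partial js h y\<bar> \<le> (1 + 2 * ?k) ^ l"
    if "l \<le> D" "length js = Suc D - l" "y \<in> max_cball x (2 * \<sigma>)" for l js y
    using that
  proof (induction l arbitrary: js y)
    case 0
    then show ?case using top[of js y] by simp
  next
    case (Suc l)
    define m where "m = length js"
    have m: "1 \<le> m" "m \<le> D" "Suc m = Suc D - l" using Suc.prems by (auto simp: m_def)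
    have "\<bar>iter_partial js h y - iter_partial js h x\<bar> \<le> ?k * ((1 + 2 * ?k) ^ l / \<sigma> ^ Suc m) * (2 * \<sigma>)"
    proof (rule mean_value_bound[OF smooth_on_open_iter_partial[OF h] convex_max_cball ball x Suc.prems(3)])
      fix z i assume "z \<in> max_cball x (2 * \<sigma>)"
      then have "\<sigma> ^ length (i # js) * \<bar>iter_partial (i # js) h z\<bar> \<le> (1 + 2 * ?k) ^ l"
        using m Suc.prems by (intro Suc.IH) (auto simp: m_def)
      then show "\<bar>partial_deriv i (iter_partial js h) z\<bar> \<le> (1 + 2 * ?k) ^ l / \<sigma> ^ Suc m"
        using \<sigma> by (simp add: iter_partial_Cons m_def field_simps)
    next
      show "\<bar>y $ i - x $ i\<bar> \<le> 2 * \<sigma>" for i using Suc.prems by (simp add: mem_max_cball)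
    qed
    then have "\<sigma> ^ m * \<bar>iter_partial js h y - iter_partial js h x\<bar>
        \<le> \<sigma> ^ m * (?k * ((1 + 2 * ?k) ^ l / \<sigma> ^ Suc m) * (2 * \<sigma>))"
      using \<sigma> by (intro mult_left_mono) auto
    also have "\<dots> = 2 * ?k * (1 + 2 * ?k) ^ l" using \<sigma> by simp
    finally have 1: "\<sigma> ^ m * \<bar>iter_partial js h y - iter_partial js h x\<bar> \<le> 2 * ?k * (1 + 2 * ?k) ^ l" .
    have 2: "\<sigma> ^ m * \<bar>iter_partial js h x\<bar> \<le> 1" using centre[of js] m by (cases js) (auto simp: m_def)
    have "\<sigma> ^ m * \<bar>iter_partial js h y\<bar>
        \<le> \<sigma> ^ m * (\<bar>iter_partial js h x\<bar> + \<bar>iter_partial js h y - iter_partial js h x\<bar>)"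
      using \<sigma> by (intro mult_left_mono) auto
    also have "\<dots> \<le> 1 + 2 * ?k * (1 + 2 * ?k) ^ l" using 1 2 by (simp add: distrib_left)
    also have "\<dots> \<le> (1 + 2 * ?k) ^ Suc l" using one_le_power[of "1 + 2 * ?k" l] by (simp add: distrib_right)
    finally show ?case by (simp add: m_def)
  qed
  have "\<sigma> ^ length js * \<bar>iter_partial js h y\<bar> \<le> (1 + 2 * ?k) ^ (Suc D - length js)"
    using js by (intro bound) (cases js, auto)
  also have "\<dots> \<le> (1 + 2 * ?k) ^ Suc D" by (intro power_increasing) auto
  finally show ?thesis .
qed

text \<open>
  The function \<open>a \<bullet> \<Psi> - b\<close> is divided by the largest rescaled derivative \<open>\<sigma> ^ length is * \<bar>a \<bullet> iter_partial is \<Psi> x\<bar>\<close>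
  of order between \<open>1\<close> and \<open>D\<close>. By nondegeneracy this number is at least of order \<open>\<sigma> ^ D\<close>, so after the
  division the derivatives of order \<open>D + 1\<close> are at most of order \<open>\<sigma>\<close>, which is harmless for small \<open>\<sigma>\<close>,
  and \<open>sublevel_measure\<close> applies on a cube of smaller radius \<open>r0 * \<sigma>\<close>, where the maximal derivative
  stays above \<open>1/2\<close>. A point at distance \<open>\<delta>\<close> from a zero has a value of order \<open>\<delta> / \<sigma>\<close>.
\<close>

lemma hyperplane_section_neighbourhood_measure:
  fixes \<Psi> :: "real^'k \<Rightarrow> real^'d"
  assumes U: "open U" "sets \<mu> = sets (restrict_space borel U)"
    and dec: "hyperplane_decay U \<mu> C \<alpha>" "C > 0" "\<alpha> > 0"
    and sm: "smooth_on_open U \<Psi>" and S: "compact S" "S \<subseteq> U" and c: "0 < c" and D: "1 \<le> D"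
    and nd: "\<And>v a. v \<in> S \<Longrightarrow>
       \<exists>is. is \<noteq> [] \<and> length is \<le> D \<and> c * norm a \<le> \<bar>a \<bullet> iter_partial is \<Psi> v\<bar>"
  obtains \<sigma>0 r0 \<eta>0 Q \<gamma> where "0 < \<sigma>0" "\<sigma>0 \<le> 1" "0 < r0" "r0 \<le> 1/2" "0 < \<eta>0" "\<eta>0 \<le> 1/2" "0 < Q" "0 < \<gamma>"
    "\<And>x \<sigma> \<delta> a b. 0 < \<sigma> \<Longrightarrow> \<sigma> \<le> \<sigma>0 \<Longrightarrow> max_cball x (2 * \<sigma>) \<subseteq> S \<Longrightarrow> 0 < \<delta> \<Longrightarrow> \<delta> \<le> \<eta>0 * \<sigma> \<Longrightarrow> a \<noteq> 0 \<Longrightarrow>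
       \<exists>F\<in>sets \<mu>. (\<forall>v\<in>max_cball x (r0 * \<sigma>) \<inter> measure_support U \<mu>.
           (\<exists>z\<in>max_cball v \<delta>. a \<bullet> \<Psi> z = b) \<longrightarrow> v \<in> F) \<and>
         emeasure \<mu> F \<le> ennreal (Q * (\<delta> / \<sigma>) powr \<gamma>) * emeasure \<mu> (max_cball x (2 * (r0 * \<sigma>)))"
proof -
  define k where "k = real CARD('k)"
  have k: "1 \<le> k" using zero_less_card_finite[where 'a='k] by (simp add: k_def Suc_le_eq)
  obtain K0 where K0: "K0 \<ge> 1"
    "\<And>is y i. length is \<le> Suc D \<Longrightarrow> y \<in> S \<Longrightarrow> \<bar>iter_partial is \<Psi> y $ i\<bar> \<le> K0"
    using iter_partial_uniform_bound[OF sm S, of "Suc D"] by metis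
  define B where "B = real CARD('d) * K0"
  have B: "0 < B" using K0(1) by (simp add: B_def)
  have normB: "norm (iter_partial is \<Psi> y) \<le> B" if "length is \<le> Suc D" "y \<in> S" for "is" y
  proof -
    have "norm (iter_partial is \<Psi> y) \<le> (\<Sum>i\<in>UNIV. \<bar>iter_partial is \<Psi> y $ i\<bar>)" by (rule norm_le_l1_cart)
    also have "\<dots> \<le> (\<Sum>i\<in>(UNIV :: 'd set). K0)" using K0(2) that by (intro sum_mono) auto
    finally show ?thesis by (simp add: B_def)
  qed
  define K where "K = (1 + 2 * k) ^ Suc D"
  have K: "1 \<le> K" unfolding K_def using k by (intro one_le_power) simp
  \<comment> \<open>For \<open>\<sigma> \<le> \<sigma>0\<close> the rescaled derivatives of order \<open>D + 1\<close> are at most \<open>1\<close>; on the cube of radius \<open>r0 * \<sigma>\<close>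
    the maximal derivative changes by at most \<open>1/2\<close>; \<open>\<eta>0\<close> ensures that \<open>\<theta> < 1/2\<close> below.\<close>
  define \<sigma>0 where "\<sigma>0 = min 1 (c / B)"
  define r0 where "r0 = 1 / (2 * k * K)"
  define q :: nat where "q = 4 ^ D"
  define \<eta>0 where "\<eta>0 = min (1/2) ((1/2) ^ q / (2 * k * K))"
  define \<gamma> where "\<gamma> = \<alpha> / real q"
  define M where "M = ((1 + k\<^sup>2 * K) / r0) powr \<alpha> * (k * K) powr \<gamma>"
  define Q where "Q = real D * 5 ^ CARD('k) * C * M"
  have kK: "1 \<le> k * K" using k K mult_mono[of 1 k 1 K] by simp
  have r0: "0 < r0" "r0 \<le> 1/2" using kK by (auto simp: r0_def divide_simps mult.assoc)
  have q: "0 < q" by (simp add: q_def)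
  have pos: "0 < \<sigma>0" "0 < \<eta>0" "0 < \<gamma>" using c B kK dec(3) q by (auto simp: \<sigma>0_def \<eta>0_def \<gamma>_def mult.assoc)
  have "0 < 1 + k\<^sup>2 * K" using K by (intro add_pos_nonneg) auto
  then have "0 < M" using r0 k K by (simp add: M_def)
  then have Q: "0 < Q" unfolding Q_def using D dec(2) by simp
  show ?thesis
  proof (rule that[of \<sigma>0 r0 \<eta>0 Q \<gamma>])
    show "0 < \<sigma>0" "\<sigma>0 \<le> 1" "0 < r0" "r0 \<le> 1/2" "0 < \<eta>0" "\<eta>0 \<le> 1/2" "0 < Q" "0 < \<gamma>"
      using pos r0 Q by (auto simp: \<sigma>0_def \<eta>0_def)
    fix x \<sigma> \<delta> b and a :: "real^'d"
    assume \<sigma>: "0 < \<sigma>" "\<sigma> \<le> \<sigma>0" and ball: "max_cball x (2 * \<sigma>) \<subseteq> S"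
      and \<delta>: "0 < \<delta>" "\<delta> \<le> \<eta>0 * \<sigma>" and a: "a \<noteq> 0"
    have \<sigma>1: "\<sigma> \<le> 1" "\<sigma> * B \<le> c" using \<sigma> B by (auto simp: \<sigma>0_def field_simps)
    have x: "x \<in> max_cball x (2 * \<sigma>)" using \<sigma> by (simp add: mem_max_cball)
    define I where "I = {is :: 'k list. is \<noteq> [] \<and> length is \<le> D}"
    have fin: "finite I"
      using finite_lists_length_le[of "UNIV :: 'k set" D] by (auto simp: I_def elim: rev_finite_subset)
    define w where "w is = \<sigma> ^ length is * \<bar>a \<bullet> iter_partial is \<Psi> x\<bar>" for "is"
    obtain is1 where is1: "is1 \<in> I" "c * norm a \<le> \<bar>a \<bullet> iter_partial is1 \<Psi> x\<bar>"
      using nd[of x a] ball x by (auto simp: I_def)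
    then have "w ` I \<noteq> {}" by auto
    then have "Max (w ` I) \<in> w ` I" using fin by (intro Max_in) auto
    then obtain is0 where is0: "is0 \<in> I" "w is0 = Max (w ` I)" by (metis imageE)
    define A where "A = w is0"
    have wA: "w is \<le> A" if "is \<in> I" for "is" using that fin by (auto simp: A_def is0(2) intro!: Max_ge)
    have "\<sigma> ^ D * (c * norm a) \<le> \<sigma> ^ length is1 * \<bar>a \<bullet> iter_partial is1 \<Psi> x\<bar>"
      using is1 \<sigma> \<sigma>1 c by (intro mult_mono power_decreasing) (auto simp: I_def)
    also have "\<dots> \<le> A" using wA[OF is1(1)] by (simp add: w_def)
    finally have A_ge: "\<sigma> ^ D * (c * norm a) \<le> A" .
    have A: "0 < A" using A_ge \<sigma> c a by (smt (verit) mult_pos_pos zero_less_norm_iff zero_less_power)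
    define h where "h y = (a /\<^sub>R A) \<bullet> \<Psi> y - b / A" for y
    have smh: "smooth_on_open U h" unfolding h_def by (rule smooth_on_open_affine[OF sm])
    have it: "iter_partial js h y = a \<bullet> iter_partial js \<Psi> y / A" if "js \<noteq> []" "y \<in> max_cball x (2 * \<sigma>)" for js y
    proof -
      have "y \<in> U" using that ball S by blast
      then have "iter_partial js h y = (a /\<^sub>R A) \<bullet> iter_partial js \<Psi> y"
        unfolding h_def by (rule iter_partial_affine[OF sm _ that(1)])
      then show ?thesis by (simp add: divide_inverse_commute)
    qed
    have itabs: "s * \<bar>iter_partial js h y\<bar> = s * \<bar>a \<bullet> iter_partial js \<Psi> y\<bar> / A"
      if "js \<noteq> []" "y \<in> max_cball x (2 * \<sigma>)" for js y s
      using it[OF that] A by simp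
    have ballU: "max_cball x (2 * \<sigma>) \<subseteq> U" using ball S by blast
    have boundK: "\<sigma> ^ length js * \<bar>iter_partial js h y\<bar> \<le> K"
      if "js \<noteq> []" "length js \<le> Suc D" "y \<in> max_cball x (2 * \<sigma>)" for js y
      unfolding K_def k_def
    proof (rule rescaled_derivatives_bounded[OF smh ballU \<sigma>(1) _ _ that])
      fix js :: "'k list" assume js: "js \<noteq> []" "length js \<le> D"
      then have "\<sigma> ^ length js * \<bar>a \<bullet> iter_partial js \<Psi> x\<bar> \<le> A" using wA by (auto simp: w_def I_def)
      then show "\<sigma> ^ length js * \<bar>iter_partial js h x\<bar> \<le> 1"
        using x A js(1) by (subst itabs) (simp_all add: divide_le_eq)
    next
      fix js :: "'k list" and y assume js: "length js = Suc D" "y \<in> max_cball x (2 * \<sigma>)"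
      have "\<bar>a \<bullet> iter_partial js \<Psi> y\<bar> \<le> norm a * norm (iter_partial js \<Psi> y)" by (rule Cauchy_Schwarz_ineq2)
      also have "\<dots> \<le> norm a * B" using normB[of js y] js ball by (intro mult_left_mono) auto
      finally have "\<sigma> ^ Suc D * \<bar>a \<bullet> iter_partial js \<Psi> y\<bar> \<le> \<sigma> ^ Suc D * (norm a * B)"
        using \<sigma> by (intro mult_left_mono) auto
      also have "\<dots> = \<sigma> ^ D * norm a * (\<sigma> * B)" by simp
      also have "\<dots> \<le> \<sigma> ^ D * norm a * c" using \<sigma> \<sigma>1 by (intro mult_left_mono) auto
      also have "\<dots> \<le> A" using A_ge by (simp add: mult_ac)
      finally have "\<sigma> ^ Suc D * \<bar>a \<bullet> iter_partial js \<Psi> y\<bar> \<le> A" .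
      moreover have "js \<noteq> []" using js by auto
      ultimately show "\<sigma> ^ Suc D * \<bar>iter_partial js h y\<bar> \<le> 1"
        using js A by (subst itabs) (simp_all add: divide_le_eq)
    qed
    define \<rho> where "\<rho> = r0 * \<sigma>"
    have \<rho>: "0 < \<rho>" "\<rho> \<le> \<sigma>" "\<rho> \<le> 1" "2 * \<rho> \<le> \<sigma>"
      using mult_pos_pos[OF r0(1) \<sigma>(1)] r0 \<sigma> \<sigma>1(1) mult_right_mono[of r0 "1/2" \<sigma>]
      unfolding \<rho>_def by linarith+
    have sub: "max_cball x (2 * \<rho>) \<subseteq> max_cball x (2 * \<sigma>)" "max_cball x \<rho> \<subseteq> max_cball x (2 * \<sigma>)"
      using \<rho> \<sigma> by (auto intro!: max_cball_mono)
    define m where "m = length is0"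
    have m: "1 \<le> m" "m \<le> D" "is0 \<noteq> []" using is0(1) by (auto simp: I_def m_def Suc_le_eq)
    have lower: "1/2 \<le> \<sigma> ^ m * \<bar>iter_partial is0 h y\<bar>" if y: "y \<in> max_cball x \<rho>" for y
    proof -
      have "\<bar>iter_partial is0 h y - iter_partial is0 h x\<bar> \<le> real CARD('k) * (K / \<sigma> ^ Suc m) * \<rho>"
      proof (rule mean_value_bound[OF smooth_on_open_iter_partial[OF smh] convex_max_cball ballU x])
        show "y \<in> max_cball x (2 * \<sigma>)" using y sub by auto
        fix z i assume "z \<in> max_cball x (2 * \<sigma>)"
        then have "\<sigma> ^ length (i # is0) * \<bar>iter_partial (i # is0) h z\<bar> \<le> K"
          using m by (intro boundK) (auto simp: m_def)
        then show "\<bar>partial_deriv i (iter_partial is0 h) z\<bar> \<le> K / \<sigma> ^ Suc m"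
          using \<sigma> by (simp add: iter_partial_Cons m_def field_simps)
      next
        show "\<bar>y $ i - x $ i\<bar> \<le> \<rho>" for i using y by (simp add: mem_max_cball)
      qed
      then have "\<sigma> ^ m * \<bar>iter_partial is0 h y - iter_partial is0 h x\<bar> \<le> \<sigma> ^ m * (k * (K / \<sigma> ^ Suc m) * \<rho>)"
        using \<sigma> by (intro mult_left_mono) (auto simp: k_def)
      also have "\<dots> = k * K * r0" using \<sigma> by (simp add: \<rho>_def)
      also have "\<dots> = 1/2" using k K by (simp add: r0_def)
      finally have 1: "\<sigma> ^ m * \<bar>iter_partial is0 h y - iter_partial is0 h x\<bar> \<le> 1/2" .
      have "\<sigma> ^ m * \<bar>iter_partial is0 h x\<bar> = 1"
        using A unfolding itabs[OF m(3) x] by (simp add: A_def[unfolded w_def, symmetric] m_def)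
      moreover have "\<sigma> ^ m * \<bar>iter_partial is0 h x\<bar>
          \<le> \<sigma> ^ m * (\<bar>iter_partial is0 h y\<bar> + \<bar>iter_partial is0 h y - iter_partial is0 h x\<bar>)"
        using \<sigma> by (intro mult_left_mono) auto
      ultimately show ?thesis using 1 by (simp add: distrib_left)
    qed
    \<comment> \<open>\<open>t\<close> bounds \<open>\<bar>h\<bar>\<close> at distance \<open>\<delta>\<close> from a zero. The order of the maximal derivative depends on \<open>a\<close> and \<open>x\<close>
      but is at most \<open>D\<close>, so the root of order \<open>4 ^ D\<close> serves in all cases.\<close>
    define t where "t = k * K * \<delta> / \<sigma>"
    define \<theta> where "\<theta> = t powr (1 / real q)"
    have t: "0 < t" using kK \<delta> \<sigma> by (simp add: t_def)
    have "k * K * \<delta> \<le> k * K * (\<eta>0 * \<sigma>)" using kK \<delta> by (intro mult_left_mono) auto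
    also have "\<dots> \<le> k * K * ((1/2) ^ q / (2 * k * K) * \<sigma>)" using kK \<sigma> by (intro mult_left_mono mult_right_mono) (auto simp: \<eta>0_def)
    also have "\<dots> = (1/2) ^ q / 2 * \<sigma>" using k K by simp
    finally have "t \<le> (1/2) ^ q / 2" using \<sigma> by (simp add: t_def divide_simps)
    then have t2: "t < (1/2) ^ q" by (smt (verit) field_sum_of_halves zero_less_power)
    have \<theta>: "0 < \<theta>" "\<theta> ^ q = t" using t q by (simp_all add: \<theta>_def powr_power)
    have \<theta>2: "\<theta> < 1/2" using t2 \<theta> power_less_imp_less_base[of \<theta> q "1/2"] by auto
    define F where "F = {v \<in> max_cball x \<rho> \<inter> measure_support U \<mu>. \<bar>h v\<bar> \<le> \<theta> ^ (4 ^ length is0)}"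
    have "emeasure \<mu> F \<le> of_nat (length is0) *
       (ennreal (C * ((1 + (real CARD('k))\<^sup>2 * K) * (\<sigma> / \<rho>) * \<theta>) powr \<alpha>) *
         (ennreal (5 ^ CARD('k)) * emeasure \<mu> (max_cball x (2 * \<rho>))))"
      unfolding F_def
    proof (rule sublevel_measure[OF U dec _ \<rho>(1,2,3) \<theta>(1) \<theta>2 _ smh])
      show "max_cball x (2 * \<rho>) \<subseteq> U" using sub ballU by blast
      show "0 \<le> K" using K by simp
      show "\<sigma> ^ length js * \<bar>iter_partial js h y\<bar> \<le> K"
        if "js \<noteq> []" "length js \<le> Suc (length is0)" "y \<in> max_cball x (2 * \<rho>)" for js y
        using that m sub by (intro boundK) (auto simp: m_def)
      show "1/2 \<le> \<sigma> ^ length is0 * \<bar>iter_partial is0 h y\<bar>" if "y \<in> max_cball x \<rho>" for y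
        using lower[OF that] by (simp add: m_def)
    qed
    also have "\<dots> \<le> ennreal (real D) *
       (ennreal (C * ((1 + (real CARD('k))\<^sup>2 * K) * (\<sigma> / \<rho>) * \<theta>) powr \<alpha>) *
         (ennreal (5 ^ CARD('k)) * emeasure \<mu> (max_cball x (2 * \<rho>))))"
      using m(2) by (intro mult_right_mono) (auto simp: m_def ennreal_of_nat_eq_real_of_nat)
    also have "\<dots> = ennreal (real D * 5 ^ CARD('k) * C * ((1 + k\<^sup>2 * K) * (\<sigma> / \<rho>) * \<theta>) powr \<alpha>) * emeasure \<mu> (max_cball x (2 * \<rho>))"
      using dec(2) by (simp add: k_def ennreal_mult' mult_ac)
    also have "real D * 5 ^ CARD('k) * C * ((1 + k\<^sup>2 * K) * (\<sigma> / \<rho>) * \<theta>) powr \<alpha> = Q * (\<delta> / \<sigma>) powr \<gamma>"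
    proof -
      have "(1 + k\<^sup>2 * K) * (\<sigma> / \<rho>) * \<theta> = (1 + k\<^sup>2 * K) / r0 * \<theta>" using \<sigma> by (simp add: \<rho>_def)
      moreover have "((1 + k\<^sup>2 * K) / r0 * \<theta>) powr \<alpha> = ((1 + k\<^sup>2 * K) / r0) powr \<alpha> * \<theta> powr \<alpha>"
        using r0 \<theta> K by (intro powr_mult)
      moreover have "\<theta> powr \<alpha> = t powr \<gamma>" by (simp add: \<theta>_def powr_powr \<gamma>_def)
      moreover have "t powr \<gamma> = (k * K) powr \<gamma> * (\<delta> / \<sigma>) powr \<gamma>"
        unfolding t_def using kK \<delta> \<sigma> by (subst powr_mult[symmetric]) auto
      ultimately show ?thesis by (simp add: Q_def M_def)
    qed
    finally have mF: "emeasure \<mu> F \<le> ennreal (Q * (\<delta> / \<sigma>) powr \<gamma>) * emeasure \<mu> (max_cball x (2 * (r0 * \<sigma>)))"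
      by (simp add: \<rho>_def)
    have Fs: "F \<in> sets \<mu>" unfolding F_def using sub ballU by (intro sets_sublevel[OF U smh]) auto
    have "v \<in> F" if v: "v \<in> max_cball x (r0 * \<sigma>) \<inter> measure_support U \<mu>" and z: "z \<in> max_cball v \<delta>" "a \<bullet> \<Psi> z = b" for v z
    proof -
      have v\<rho>: "v \<in> max_cball x \<rho>" using v by (simp add: \<rho>_def)
      have "\<eta>0 * \<sigma> \<le> 1 * \<sigma>" using \<sigma> by (intro mult_right_mono) (auto simp: \<eta>0_def)
      then have "\<delta> \<le> \<sigma>" using \<delta> by linarith
      then have zb: "z \<in> max_cball x (2 * \<sigma>)" using \<rho> by (intro max_cball_trans[OF v\<rho> z(1)]) auto
      have "\<bar>h v - h z\<bar> \<le> real CARD('k) * (K / \<sigma>) * \<delta>"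
      proof (rule mean_value_bound[OF smh convex_max_cball ballU zb])
        show "v \<in> max_cball x (2 * \<sigma>)" using v\<rho> sub by auto
        fix y i assume "y \<in> max_cball x (2 * \<sigma>)"
        then show "\<bar>partial_deriv i h y\<bar> \<le> K / \<sigma>"
          using boundK[of "[i]" y] D \<sigma> by (simp add: iter_partial_Cons field_simps)
      next
        show "\<bar>v $ i - z $ i\<bar> \<le> \<delta>" for i using z(1) by (simp add: mem_max_cball abs_minus_commute)
      qed
      moreover have "h z = 0" using z(2) A by (simp add: h_def divide_inverse_commute)
      ultimately have "\<bar>h v\<bar> \<le> t" by (simp add: t_def k_def)
      also have "t \<le> \<theta> ^ (4 ^ length is0)"
        unfolding \<theta>(2)[symmetric] q_def using \<theta> \<theta>2 m by (intro power_decreasing power_increasing) (auto simp: m_def)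
      finally show ?thesis using v v\<rho> by (simp add: F_def)
    qed
    then show "\<exists>F\<in>sets \<mu>. (\<forall>v\<in>max_cball x (r0 * \<sigma>) \<inter> measure_support U \<mu>.
           (\<exists>z\<in>max_cball v \<delta>. a \<bullet> \<Psi> z = b) \<longrightarrow> v \<in> F) \<and>
         emeasure \<mu> F \<le> ennreal (Q * (\<delta> / \<sigma>) powr \<gamma>) * emeasure \<mu> (max_cball x (2 * (r0 * \<sigma>)))"
      using Fs mF by blast
  qed
qed

section \<open>Heights and the structure of the approximable set\<close>

lemma ex_int_vec:
  fixes r :: "real^'d"
  assumes "\<And>i. real q * r $ i \<in> \<int>" "q \<ge> 1"
  obtains p :: "int^'d" where "r = (\<chi> i. real_of_int (p $ i) / real q)"
proof -
  have "\<forall>i. \<exists>z. real q * r $ i = of_int z" using assms(1) by (auto elim: Ints_cases)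
  then obtain z where z: "\<And>i. real q * r $ i = of_int (z i)" by metis
  have "r $ i = of_int (z i) / real q" for i using z[of i] assms(2) by (simp add: field_simps)
  then show ?thesis by (intro that[of "\<chi> i. z i"]) (simp add: vec_eq_iff)
qed

lemma ex_common_denominator:
  fixes r :: "real^'d"
  assumes "r \<in> rational_points"
  obtains q :: nat where "q \<ge> 1" "\<And>i. real q * r $ i \<in> \<int>"
proof -
  have "\<forall>i. \<exists>b::nat. b \<ge> 1 \<and> real b * r $ i \<in> \<int>"
  proof
    fix i
    have "r $ i \<in> \<rat>" using assms by (simp add: rational_points_def)
    then obtain a :: int and b :: int where "b > 0" "r $ i = of_int a / of_int b"
      by (rule Rats_cases') auto
    then show "\<exists>b::nat. b \<ge> 1 \<and> real b * r $ i \<in> \<int>"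
      by (intro exI[of _ "nat b"]) auto
  qed
  then obtain b where b: "\<And>i. b i \<ge> (1::nat)" "\<And>i. real (b i) * r $ i \<in> \<int>" by metis
  show ?thesis
  proof (rule that[of "\<Prod>i\<in>UNIV. b i"])
    show "1 \<le> (\<Prod>i\<in>UNIV. b i)" using b(1) by (intro prod_ge_1) auto
    show "real (\<Prod>i\<in>UNIV. b i) * r $ i \<in> \<int>" for i
    proof -
      have "(\<Prod>i\<in>UNIV. b i) = b i * (\<Prod>j\<in>UNIV - {i}. b j)" by (rule prod.remove) auto
      then have "real (\<Prod>i\<in>UNIV. b i) * r $ i = real (\<Prod>j\<in>UNIV - {i}. b j) * (real (b i) * r $ i)" by simp
      also have "\<dots> \<in> \<int>" by (intro Ints_mult b Ints_of_nat)
      finally show ?thesis .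
    qed
  qed
qed

text \<open>
  Each \<open>q' * p $ i\<close> is a multiple of \<open>q\<close>, and so is \<open>q' * q\<close>; hence \<open>q\<close> divides \<open>q'\<close> times the greatest
  common divisor, which is \<open>1\<close>.
\<close>

lemma reduced_denominator_dvd:
  fixes p p' :: "int^'d" and q q' :: nat
  assumes eq: "(\<chi> i. real_of_int (p $ i) / real q) = (\<chi> i. real_of_int (p' $ i) / real q')"
    and q: "q \<ge> 1" "q' \<ge> 1" and red: "Gcd (insert (int q) (range (\<lambda>i. p $ i))) = 1"
  shows "q dvd q'"
proof -
  have e: "int q' * p $ i = int q * p' $ i" for i
  proof -
    have "real_of_int (p $ i) / real q = real_of_int (p' $ i) / real q'" using eq by (simp add: vec_eq_iff)
    then have "real_of_int (int q' * p $ i) = real_of_int (int q * p' $ i)" using q by (simp add: field_simps)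
    then show ?thesis by (simp only: of_int_eq_iff)
  qed
  have "int q dvd Gcd ((*) (int q') ` insert (int q) (range (\<lambda>i. p $ i)))"
    by (rule Gcd_greatest) (auto simp: e)
  then show ?thesis unfolding Gcd_mult red by simp
qed

text \<open>
  The least common denominator belongs to a reduced representation, because a common factor could be
  cancelled; and reduced denominators divide each other.
\<close>

lemma height_props:
  assumes "r \<in> rational_points"
  shows "height r \<ge> 1" "real (height r) * r $ i \<in> \<int>"
proof -
  let ?P = "\<lambda>q::nat. q \<ge> 1 \<and> (\<exists>p. r = (\<chi> i. real_of_int (p $ i) / real q) \<and>
        Gcd (insert (int q) (range (\<lambda>i. p $ i))) = 1)"
  define Q where "Q q \<longleftrightarrow> q \<ge> 1 \<and> (\<forall>i. real q * r $ i \<in> \<int>)" for q :: nat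
  have "\<exists>q. Q q" using ex_common_denominator[OF assms] by (auto simp: Q_def)
  define q where "q = (LEAST q. Q q)"
  have q: "Q q" unfolding q_def by (rule LeastI_ex) fact
  have least: "q \<le> q'" if "Q q'" for q' unfolding q_def using that by (rule Least_le)
  obtain p :: "int^'a" where p: "r = (\<chi> i. real_of_int (p $ i) / real q)"
    using ex_int_vec[of q r] q by (auto simp: Q_def)
  \<comment> \<open>Cancelling \<open>G\<close> would give a smaller denominator.\<close>
  define G where "G = Gcd (insert (int q) (range (\<lambda>i. p $ i)))"
  have "G dvd int q" "\<And>i. G dvd p $ i" unfolding G_def by (rule Gcd_dvd; simp)+
  then have "\<exists>a. int q = G * a" "\<forall>i. \<exists>b. p $ i = G * b" by (auto simp: dvd_def)
  then obtain a b where a: "int q = G * a" and b: "\<And>i. p $ i = G * b i" by metis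
  have G0: "G > 0" using a q Gcd_int_greater_eq_0[of "insert (int q) (range (\<lambda>i. p $ i))"]
    by (cases "G = 0") (auto simp: Q_def G_def)
  have "0 < G * a" using a q by (simp add: Q_def flip: a)
  then have a0: "a > 0" using G0 by (simp add: zero_less_mult_iff)
  have "Q (nat a)"
  proof -
    have "real (nat a) * r $ i = of_int (b i)" for i
    proof -
      have "real q = of_int G * of_int a" using a by (metis of_int_mult of_int_of_nat_eq)
      then show ?thesis using G0 a0 by (simp add: p b)
    qed
    then show ?thesis using a0 by (simp add: Q_def)
  qed
  then have "int q \<le> a" using least[of "nat a"] a0 by simp
  then have "G * a \<le> 1 * a" using a by simp
  then have "G = 1" using a0 G0 by (simp only: mult_le_cancel_right) simp
  then have ex: "?P q" using q p by (auto simp: Q_def G_def)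
  have uniq: "q' = q" if q': "?P q'" for q'
  proof -
    obtain p' :: "int^'a" where "q' \<ge> 1" "r = (\<chi> i. real_of_int (p' $ i) / real q')"
      "Gcd (insert (int q') (range (\<lambda>i. p' $ i))) = 1" using q' by blast
    then have "q' dvd q" "q dvd q'"
      using reduced_denominator_dvd[of p' q' p q] reduced_denominator_dvd[of p q p' q'] p q \<open>G = 1\<close>
      by (auto simp: Q_def G_def)
    then show ?thesis by (rule dvd_antisym)
  qed
  have "height r = q" unfolding height_def using ex uniq by (rule the_equality)
  then show "height r \<ge> 1" "real (height r) * r $ i \<in> \<int>" using q by (auto simp: Q_def)
qed

lemma countable_rational_points: "countable (rational_points :: (real^'d) set)"
proof -
  have "rational_points \<subseteq> vec_lambda ` (UNIV \<rightarrow>\<^sub>E \<rat> :: ('d \<Rightarrow> real) set)"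
  proof
    fix r :: "real^'d" assume "r \<in> rational_points"
    then show "r \<in> vec_lambda ` (UNIV \<rightarrow>\<^sub>E \<rat> :: ('d \<Rightarrow> real) set)"
      by (intro image_eqI[of _ _ "($) r"]) (auto simp: rational_points_def)
  qed
  moreover have "countable (UNIV \<rightarrow>\<^sub>E \<rat> :: ('d \<Rightarrow> real) set)"
    by (rule countable_PiE) (auto simp: countable_rat)
  ultimately show ?thesis by (meson countable_image countable_subset)
qed

lemma finite_rational_points_bounded_height:
  "finite {r :: real^'d. r \<in> rational_points \<and> height r < T \<and> maxdist x r \<le> 1}"
proof -
  define P where "P q = (UNIV \<rightarrow>\<^sub>E {\<lfloor>- real T * (infnorm x + 1)\<rfloor>..\<lceil>real T * (infnorm x + 1)\<rceil>} :: ('d \<Rightarrow> int) set)" for q :: nat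
  have "{r :: real^'d. r \<in> rational_points \<and> height r < T \<and> maxdist x r \<le> 1}
    \<subseteq> (\<Union>q\<in>{..<T}. (\<lambda>p. \<chi> i. real_of_int (p i) / real q) ` P q)"
  proof
    fix r :: "real^'d" assume "r \<in> {r. r \<in> rational_points \<and> height r < T \<and> maxdist x r \<le> 1}"
    then have r: "r \<in> rational_points" "height r < T" "maxdist x r \<le> 1" by auto
    define q where "q = height r"
    have q: "q \<ge> 1" "q < T" "\<And>i. real q * r $ i \<in> \<int>"
      using height_props[OF r(1)] r(2) by (auto simp: q_def)
    obtain p :: "int^'d" where p: "r = (\<chi> i. real_of_int (p $ i) / real q)"
      using q by (rule_tac ex_int_vec) auto
    have "p $ i \<in> {\<lfloor>- real T * (infnorm x + 1)\<rfloor>..\<lceil>real T * (infnorm x + 1)\<rceil>}" for i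
    proof -
      have "\<bar>r $ i\<bar> \<le> infnorm x + 1"
        using component_le_infnorm_diff[of x i r] component_le_infnorm_cart[of x i] r(3) by linarith
      then have "real q * \<bar>r $ i\<bar> \<le> real T * (infnorm x + 1)" using q(2) by (intro mult_mono) auto
      moreover have "real_of_int (p $ i) = real q * r $ i" using q(1) by (simp add: p)
      ultimately have "\<bar>real_of_int (p $ i)\<bar> \<le> real T * (infnorm x + 1)" by (simp add: abs_mult)
      then show ?thesis by (simp, linarith)
    qed
    then have "($) p \<in> P q" by (auto simp: P_def)
    then show "r \<in> (\<Union>q\<in>{..<T}. (\<lambda>p. \<chi> i. real_of_int (p i) / real q) ` P q)"
      using q(2) p by (intro UN_I[of q] image_eqI[of _ _ "($) p"]) auto
  qed
  moreover have "finite (\<Union>q\<in>{..<T}. (\<lambda>p. (\<chi> i. real_of_int (p i) / real q) :: real^'d) ` P q)"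
    unfolding P_def by (intro finite_UN_I finite_imageI finite_PiE) auto
  ultimately show ?thesis by (rule finite_subset)
qed

lemma psi_antimono: "c \<le> c' \<Longrightarrow> 1 \<le> t \<Longrightarrow> psi c' t \<le> psi c t"
  unfolding psi_def by (intro powr_mono) auto

text \<open>
  The approximating sequence and the real number \<open>\<epsilon>\<close> are replaced by quantifiers over natural numbers and rational
  points. Since these are countable, the approximable set is Borel.
\<close>

lemma VWA_iff:
  "x \<in> VWA M c \<longleftrightarrow> x \<in> M \<and> (\<exists>m. \<forall>j. \<exists>r\<in>rational_points \<inter> M.
     maxdist x r < inverse (real (Suc j)) \<and> maxdist x r \<le> psi (c + inverse (real (Suc m))) (real (height r)))"
proof (intro iffI conjI)
  assume "x \<in> VWA M c"
  then obtain \<epsilon> r where x: "x \<in> M" and \<epsilon>: "\<epsilon> > 0" and r: "\<And>n. r n \<in> rational_points \<inter> M" "r \<longlonglongrightarrow> x"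
    "\<And>n. maxdist x (r n) \<le> psi (c + \<epsilon>) (real (height (r n)))"
    unfolding VWA_def by blast
  show "x \<in> M" by fact
  obtain m where m: "inverse (real (Suc m)) < \<epsilon>" using reals_Archimedean[OF \<epsilon>] by blast
  have "\<exists>r\<in>rational_points \<inter> M. maxdist x r < inverse (real (Suc j)) \<and>
      maxdist x r \<le> psi (c + inverse (real (Suc m))) (real (height r))" for j
  proof -
    have "\<forall>\<^sub>F n in sequentially. dist (r n) x < inverse (real (Suc j))" by (rule tendstoD[OF r(2)]) simp
    then obtain n where n: "dist (r n) x < inverse (real (Suc j))" by (auto simp: eventually_sequentially)
    have "maxdist x (r n) \<le> dist (r n) x"
      using infnorm_le_norm[of "x - r n"] by (simp add: dist_norm norm_minus_commute)
    moreover have "psi (c + \<epsilon>) (real (height (r n))) \<le> psi (c + inverse (real (Suc m))) (real (height (r n)))"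
      using m height_props(1)[of "r n"] r(1)[of n] by (intro psi_antimono) auto
    ultimately show ?thesis using n r(1)[of n] r(3)[of n] by (intro bexI[of _ "r n"]) auto
  qed
  then show "\<exists>m. \<forall>j. \<exists>r\<in>rational_points \<inter> M. maxdist x r < inverse (real (Suc j)) \<and>
      maxdist x r \<le> psi (c + inverse (real (Suc m))) (real (height r))" by blast
next
  assume "x \<in> M \<and> (\<exists>m. \<forall>j. \<exists>r\<in>rational_points \<inter> M.
     maxdist x r < inverse (real (Suc j)) \<and> maxdist x r \<le> psi (c + inverse (real (Suc m))) (real (height r)))"
  then obtain m r where x: "x \<in> M" and r: "\<And>j. r j \<in> rational_points \<inter> M"
    "\<And>j. maxdist x (r j) < inverse (real (Suc j))"
    "\<And>j. maxdist x (r j) \<le> psi (c + inverse (real (Suc m))) (real (height (r j)))" by metis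
  have "(\<lambda>j. r j $ i) \<longlonglongrightarrow> x $ i" for i
  proof (rule LIMSEQ_I)
    fix e :: real assume "e > 0"
    then obtain N where N: "inverse (real (Suc N)) < e" using reals_Archimedean by blast
    have "norm (r j $ i - x $ i) < e" if "N \<le> j" for j
    proof -
      have "\<bar>x $ i - r j $ i\<bar> < inverse (real (Suc j))"
        using component_le_infnorm_diff[of x i "r j"] r(2)[of j] by linarith
      also have "\<dots> \<le> inverse (real (Suc N))" using that by (simp add: le_imp_inverse_le)
      finally show ?thesis using N by (simp add: abs_minus_commute)
    qed
    then show "\<exists>N. \<forall>j\<ge>N. norm (r j $ i - x $ i) < e" by blast
  qed
  then have "r \<longlonglongrightarrow> x" by (rule vec_tendstoI)
  moreover have "inverse (real (Suc m)) > 0" by simp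
  ultimately show "x \<in> VWA M c" unfolding VWA_def using x r by blast
qed

lemma VWA_sets: "VWA M c \<in> sets (restrict_space borel M)"
proof -
  define B where "B = (\<Union>m. \<Inter>j. \<Union>r\<in>rational_points \<inter> M.
     {x. maxdist x r < inverse (real (Suc j)) \<and> maxdist x r \<le> psi (c + inverse (real (Suc m))) (real (height r))})"
  have "{x. maxdist x r < s \<and> maxdist x r \<le> t} \<in> sets borel" for r :: "real^'a" and s t
  proof -
    have "{x. maxdist x r < s \<and> maxdist x r \<le> t} = {x. maxdist x r < s} \<inter> {x. maxdist x r \<le> t}" by auto
    also have "\<dots> \<in> sets borel"
      by (intro sets.Int borel_open borel_closed open_Collect_less closed_Collect_le continuous_intros)
    finally show ?thesis .
  qed
  moreover have "countable (rational_points \<inter> M)"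
    by (rule countable_subset[OF _ countable_rational_points]) auto
  ultimately have "(\<Union>r\<in>rational_points \<inter> M. {x. maxdist x r < s \<and> maxdist x r \<le> t r}) \<in> sets borel" for s t
    by (intro sets.countable_UN') auto
  then have "B \<in> sets borel"
    unfolding B_def by (intro sets.countable_UN image_subsetI sets.countable_INT) auto
  moreover have "VWA M c = B \<inter> M"
    by (rule set_eqI) (unfold VWA_iff B_def Int_iff UN_iff INT_iff mem_Collect_eq, blast)
  ultimately show ?thesis by (auto simp: sets_restrict_space)
qed

abbreviation approximable_at_scale :: "(real^'d) set \<Rightarrow> real \<Rightarrow> nat \<Rightarrow> real^'d \<Rightarrow> bool" where
  "approximable_at_scale M s n x \<equiv> \<exists>r\<in>rational_points \<inter> M.
     2 ^ n \<le> height r \<and> height r < 2 ^ Suc n \<and> maxdist x r \<le> s ^ n"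

text \<open>
  Only finitely many rational points near \<open>x\<close> have height below a given bound, and an irrational \<open>x\<close> has
  positive distance from all of them. So the heights of the approximating points are unbounded.
\<close>

lemma VWA_infinitely_many_scales:
  assumes x: "x \<in> VWA M c" "x \<notin> rational_points" and c: "c > 0"
  shows "\<exists>m. \<exists>\<^sub>F n in sequentially. approximable_at_scale M (2 powr (- (c + inverse (real (Suc m))))) n x"
proof -
  obtain m where m: "\<And>j. \<exists>r\<in>rational_points \<inter> M. maxdist x r < inverse (real (Suc j)) \<and>
     maxdist x r \<le> psi (c + inverse (real (Suc m))) (real (height r))"
    using x(1) unfolding VWA_iff by blast
  define c' where "c' = c + inverse (real (Suc m))"
  have "0 < inverse (real (Suc m))" by simp
  then have "0 < c'" using c unfolding c'_def by linarith
  have "\<exists>\<^sub>F n in sequentially. approximable_at_scale M (2 powr (- c')) n x"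
    unfolding frequently_sequentially
  proof
    fix N :: nat
    \<comment> \<open>The points of height below \<open>2 ^ N\<close> stay away from \<open>x\<close>, so an approximation that is close enough has
      large height.\<close>
    define F where "F = {r. r \<in> rational_points \<and> height r < 2 ^ N \<and> maxdist x r \<le> 1}"
    have F: "finite F" unfolding F_def by (rule finite_rational_points_bounded_height)
    have "\<exists>j. \<forall>r\<in>F. inverse (real (Suc j)) \<le> maxdist x r"
      using F
    proof (induction rule: finite_subset_induct[OF F order_refl])
      case (2 r F')
      then obtain j where j: "\<forall>r\<in>F'. inverse (real (Suc j)) \<le> maxdist x r" by blast
      have "x \<noteq> r" using 2 x(2) by (auto simp: F_def)
      then have "0 < maxdist x r" by (simp add: infnorm_pos_lt)
      then obtain j' where j': "inverse (real (Suc j')) < maxdist x r" using reals_Archimedean by blast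
      have "inverse (real (Suc (max j j'))) \<le> inverse (real (Suc j))"
        "inverse (real (Suc (max j j'))) \<le> inverse (real (Suc j'))" by (auto intro!: le_imp_inverse_le)
      then have "\<forall>s\<in>insert r F'. inverse (real (Suc (max j j'))) \<le> maxdist x s"
        using j j' by (metis insert_iff less_imp_le order_trans)
      then show ?case by blast
    qed auto
    then obtain j where j: "\<And>r. r \<in> F \<Longrightarrow> inverse (real (Suc j)) \<le> maxdist x r" by blast
    obtain r where r: "r \<in> rational_points \<inter> M" "maxdist x r < inverse (real (Suc j))"
      "maxdist x r \<le> psi c' (real (height r))" using m[of j] by (auto simp: c'_def)
    have h: "1 \<le> height r" using height_props(1) r(1) by auto
    have "inverse (real (Suc j)) \<le> 1" by (simp add: inverse_le_1_iff)
    then have "r \<notin> F" "maxdist x r \<le> 1" using j[of r] r(2) by auto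
    then have big: "2 ^ N \<le> height r" using r(1) by (auto simp: F_def)
    obtain n where n: "2 ^ n \<le> height r" "height r < 2 ^ Suc n"
      using ex_power_ivl1[of 2 "height r"] h by auto
    have "(2::nat) ^ N < 2 ^ Suc n" using big n(2) by linarith
    then have "N < Suc n" by (rule power_less_imp_less_exp[rotated]) simp
    then have "N \<le> n" by simp
    have "psi c' (real (height r)) \<le> (2 powr (- c')) ^ n"
    proof -
      have "(2::real) ^ n \<le> real (height r)" using n(1) by (metis of_nat_le_iff of_nat_numeral of_nat_power)
      then have "real (height r) powr (- c') \<le> (2 ^ n) powr (- c')"
        using \<open>0 < c'\<close> by (intro powr_mono2') auto
      also have "\<dots> = (2 powr (- c')) ^ n" by (simp add: powr_powr powr_realpow[symmetric] mult.commute)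
      finally show ?thesis by (simp add: psi_def)
    qed
    then show "\<exists>n\<ge>N. approximable_at_scale M (2 powr (- c')) n x"
      using \<open>N \<le> n\<close> n r by (intro exI[of _ n]) (auto intro!: bexI[of _ r])
  qed
  then show ?thesis unfolding c'_def by blast
qed

section \<open>The convergence argument\<close>

lemma locally_finite_emeasure_compact:
  assumes lf: "locally_finite_borel_measure U \<mu>" and U: "open U" and S: "compact S" "S \<subseteq> U"
  shows "emeasure \<mu> S < \<infinity>"
proof -
  have Us: "sets \<mu> = sets (restrict_space borel U)" using lf by (simp add: locally_finite_borel_measure_def)
  have "\<forall>x\<in>S. \<exists>W. open W \<and> x \<in> W \<and> emeasure \<mu> (W \<inter> U) < \<infinity>"
    using lf S(2) unfolding locally_finite_borel_measure_def by blast
  then obtain W where W: "\<And>x. x \<in> S \<Longrightarrow> open (W x)" "\<And>x. x \<in> S \<Longrightarrow> x \<in> W x"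
    "\<And>x. x \<in> S \<Longrightarrow> emeasure \<mu> (W x \<inter> U) < \<infinity>" by metis
  obtain T where T: "T \<subseteq> S" "finite T" "S \<subseteq> (\<Union>x\<in>T. W x)"
    by (rule compactE_image[OF S(1), of S W]) (use W in auto)
  have Ws: "W x \<inter> U \<in> sets \<mu>" if "x \<in> T" for x
    using W(1) T(1) that U by (auto simp: sets_on_open[OF U Us])
  have "emeasure \<mu> S \<le> emeasure \<mu> (\<Union>x\<in>T. W x \<inter> U)"
    using T S(2) Ws by (intro emeasure_mono sets.finite_UN) auto
  also have "\<dots> \<le> (\<Sum>x\<in>T. emeasure \<mu> (W x \<inter> U))"
    using T(2) Ws by (intro emeasure_subadditive_finite) auto
  also have "\<dots> < \<infinity>" using W(3) T(1) by (auto simp: T(2) ennreal_sum_less_top subset_iff)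
  finally show ?thesis .
qed

lemma N_kd_pos:
  assumes "1 \<le> k" "k \<le> d" shows "1 \<le> N_kd k d"
proof -
  obtain n r where n: "1 \<le> n" "N_kd k d = (\<Sum>j=1..n. j * bracket (k - 1) j) + Suc n * r"
    using N_kd_decomposition[OF assms] by metis
  have "1 * bracket (k - 1) 1 \<le> (\<Sum>j=1..n. j * bracket (k - 1) j)"
    using n(1) by (intro member_le_sum) auto
  then show ?thesis using n(2) assms(1) by (simp add: bracket_def)
qed

text \<open>
  The scales \<open>\<sigma> = p ^ n\<close> and \<open>\<delta> = L * (p * e) ^ n\<close> are the two scales for heights of order \<open>2 ^ n\<close>, where the factor
  \<open>L\<close> accounts for the passage from the manifold to the parameters. The choice of \<open>p\<close>, slightly below the critical
  \<open>2 powr -c\<close>, makes \<open>(2 ^ n) ^ (d + 1) * \<sigma> ^ N\<close> tend to \<open>0\<close>, so that the rational points in each cube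
  lie on a hyperplane, while \<open>\<delta> / \<sigma>\<close> still decays exponentially, so that the measures are summable.
\<close>

lemma AE_eventually_not_approximable:
  fixes \<Psi> :: "real^'k \<Rightarrow> real^'d"
  assumes card: "CARD('k) \<le> CARD('d)" and par: "local_parameterization M U \<Psi>"
    and lf: "locally_finite_borel_measure U \<mu>"
    and dec: "hyperplane_decay U \<mu> C \<alpha>" "C > 0" "\<alpha> > 0"
    and u: "u \<in> U" and nd: "nondegenerate_point TYPE('k) M (\<Psi> u)"
  obtains R where "R > 0" "\<And>\<epsilon>. \<epsilon> > 0 \<Longrightarrow>
    AE v in \<mu>. v \<in> max_cball u R \<inter> measure_support U \<mu> \<longrightarrow>
     (\<forall>\<^sub>F n in sequentially. \<not> (approximable_at_scale M (2 powr (- (c_kd CARD('k) CARD('d) + \<epsilon>))) n (\<Psi> v)))"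
proof -
  note sm = local_parameterization_smooth[OF par]
  have U: "open U" "sets \<mu> = sets (restrict_space borel U)"
    using smooth_on_open_openD[OF sm] lf by (auto simp: locally_finite_borel_measure_def)
  define N where "N = N_kd CARD('k) CARD('d)"
  define c where "c = c_kd CARD('k) CARD('d)"
  have N: "1 \<le> N" unfolding N_def using card by (intro N_kd_pos) (simp_all add: Suc_le_eq)
  have c: "c * real N = real (Suc CARD('d))" using N by (simp add: c_def c_kd_def N_def)
  have c0: "0 < c" using N by (simp add: c_def c_kd_def N_def)
  obtain D where D: "D \<ge> 1" "\<And>a. a \<noteq> 0 \<Longrightarrow> \<exists>is. is \<noteq> [] \<and> length is \<le> D \<and> a \<bullet> iter_partial is \<Psi> u \<noteq> 0"
    by (rule nondegenerate_point_parameterization[OF par u nd]) blast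
  obtain R0 c1 where R0: "0 < R0" "R0 \<le> 1" "0 < c1" "max_cball u R0 \<subseteq> U"
    "\<And>v a. v \<in> max_cball u R0 \<Longrightarrow>
       \<exists>is. is \<noteq> [] \<and> length is \<le> D \<and> c1 * norm a \<le> \<bar>a \<bullet> iter_partial is \<Psi> v\<bar>"
    by (rule uniform_nondegeneracy[OF sm u D(2)]) blast+
  define S where "S = max_cball u R0"
  have S: "compact S" "convex S" "S \<subseteq> U" using R0 by (auto simp: S_def)
  have SS: "S \<in> sets \<mu>" using S by (simp add: sets_on_open[OF U] borel_compact)
  obtain Ri \<sigma>i L where L: "Ri > 0" "\<sigma>i > 0" "L > 0"
    "\<And>v r. v \<in> max_cball u Ri \<Longrightarrow> v \<in> U \<Longrightarrow> r \<in> M \<Longrightarrow> maxdist (\<Psi> v) r \<le> \<sigma>i \<Longrightarrow>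
       \<exists>z\<in>U. \<Psi> z = r \<and> z \<in> max_cball v (L * maxdist (\<Psi> v) r)"
    using local_parameterization_inverse_lipschitz[OF par u] by metis
  obtain \<sigma>0 r0 \<eta>0 Q \<gamma> where nb: "0 < \<sigma>0" "\<sigma>0 \<le> 1" "0 < r0" "r0 \<le> 1/2" "0 < \<eta>0" "\<eta>0 \<le> 1/2" "0 < Q" "0 < \<gamma>"
    "\<And>x \<sigma> \<delta> a b. 0 < \<sigma> \<Longrightarrow> \<sigma> \<le> \<sigma>0 \<Longrightarrow> max_cball x (2 * \<sigma>) \<subseteq> S \<Longrightarrow> 0 < \<delta> \<Longrightarrow> \<delta> \<le> \<eta>0 * \<sigma> \<Longrightarrow> a \<noteq> 0 \<Longrightarrow>
       \<exists>F\<in>sets \<mu>. (\<forall>v\<in>max_cball x (r0 * \<sigma>) \<inter> measure_support U \<mu>.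
           (\<exists>z\<in>max_cball v \<delta>. a \<bullet> \<Psi> z = b) \<longrightarrow> v \<in> F) \<and>
         emeasure \<mu> F \<le> ennreal (Q * (\<delta> / \<sigma>) powr \<gamma>) * emeasure \<mu> (max_cball x (2 * (r0 * \<sigma>)))"
    by (rule hyperplane_section_neighbourhood_measure[OF U dec sm S(1,3) R0(3) D(1)])
       (use R0(5) in \<open>simp add: S_def\<close>, blast)
  obtain Ch where Ch: "Ch > 0"
    "\<And>x \<rho> T. x \<in> S \<Longrightarrow> 0 < \<rho> \<Longrightarrow> \<rho> \<le> 1 \<Longrightarrow> 0 \<le> T \<Longrightarrow>
       Ch * T ^ Suc CARD('d) * \<rho> ^ N < 1 \<Longrightarrow>
       \<exists>a b. a \<noteq> 0 \<and> (\<forall>z\<in>S \<inter> max_cball x \<rho>.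
         denominator_le T (\<Psi> z) \<longrightarrow> a \<bullet> \<Psi> z = b)"
    unfolding N_def by (rule rational_points_on_hyperplane[OF card sm S]) blast
  define R where "R = min (R0 / 2) Ri"
  have R: "0 < R" "R \<le> R0 / 2" "R \<le> Ri" using R0 L by (auto simp: R_def)
  have subR: "max_cball u R \<subseteq> S" using R R0 by (auto simp: S_def intro!: max_cball_mono)
  show ?thesis
  proof (rule that[OF R(1)])
    fix \<epsilon> :: real assume \<epsilon>: "\<epsilon> > 0"
    define p where "p = 2 powr (- (c + \<epsilon> / 2))"
    define e where "e = 2 powr (- (\<epsilon> / 2))"
    have p: "0 < p" "p < 1" and e: "0 < e" "e < 1"
      using \<epsilon> c0 powr_less_cancel_iff[of 2 "- (c + \<epsilon> / 2)" 0] powr_less_cancel_iff[of 2 "- (\<epsilon> / 2)" 0]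
      by (auto simp: p_def e_def)
    have pe: "2 powr (- (c + \<epsilon>)) = p * e"
      unfolding p_def e_def powr_add[symmetric] by (rule arg_cong[of _ _ "(powr) 2"]) simp
    \<comment> \<open>This is the defining relation \<open>c * N = d + 1\<close> of the critical exponent.\<close>
    have pN: "2 ^ Suc CARD('d) * p ^ N = e ^ N"
    proof -
      have "p ^ N = 2 powr (- (c + \<epsilon> / 2) * real N)"
        using p(1) by (simp add: p_def powr_powr flip: powr_realpow)
      moreover have "(2::real) ^ Suc CARD('d) = 2 powr real (Suc CARD('d))"
        by (rule powr_realpow[symmetric]) simp
      ultimately have "2 ^ Suc CARD('d) * p ^ N
         = 2 powr real (Suc CARD('d)) * 2 powr (- (c + \<epsilon> / 2) * real N)" by (simp only:)
      also have "\<dots> = 2 powr (- (\<epsilon> / 2) * real N)"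
        unfolding powr_add[symmetric] c[symmetric]
        by (rule arg_cong[of _ _ "(powr) 2"]) (simp add: algebra_simps)
      also have "\<dots> = e ^ N" by (simp add: e_def powr_realpow[symmetric] powr_powr)
      finally show ?thesis .
    qed
    define close where "close n v r \<longleftrightarrow> 2 ^ n \<le> height r \<and> height r < 2 ^ Suc n \<and> maxdist (\<Psi> v) r \<le> (p * e) ^ n"
      for n v r
    define E where "E n = {v \<in> max_cball u R \<inter> measure_support U \<mu>. \<exists>r\<in>rational_points \<inter> M. close n v r}" for n
    have Es: "E n \<in> sets \<mu>" for n
    proof -
      have "closed (max_cball u R \<inter> (\<lambda>v. maxdist (\<Psi> v) r) -` {..(p * e) ^ n})" for r
        using continuous_on_subset[OF smooth_on_open_continuous[OF sm]] subR S(3)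
        by (intro continuous_closed_preimage continuous_on_infnorm continuous_on_diff) auto
      then have 1: "max_cball u R \<inter> (\<lambda>v. maxdist (\<Psi> v) r) -` {..(p * e) ^ n} \<in> sets \<mu>" for r
        using subR S(3) by (auto simp: sets_on_open[OF U])
      have "countable {r \<in> rational_points \<inter> M. 2 ^ n \<le> height r \<and> height r < 2 ^ Suc n}"
        by (rule countable_subset[OF _ countable_rational_points]) auto
      then have "(\<Union>r\<in>{r \<in> rational_points \<inter> M. 2 ^ n \<le> height r \<and> height r < 2 ^ Suc n}.
         max_cball u R \<inter> (\<lambda>v. maxdist (\<Psi> v) r) -` {..(p * e) ^ n}) \<inter> measure_support U \<mu> \<in> sets \<mu>"
        by (intro sets.Int sets.countable_UN' image_subsetI 1 measure_support_sets[OF U])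
      also have "(\<Union>r\<in>{r \<in> rational_points \<inter> M. 2 ^ n \<le> height r \<and> height r < 2 ^ Suc n}.
         max_cball u R \<inter> (\<lambda>v. maxdist (\<Psi> v) r) -` {..(p * e) ^ n}) \<inter> measure_support U \<mu> = E n"
        by (auto simp: E_def close_def)
      finally show ?thesis .
    qed
    have mS: "emeasure \<mu> S = ennreal (measure \<mu> S)"
      using locally_finite_emeasure_compact[OF lf U(1) S(1,3)] by (intro emeasure_eq_ennreal_measure) auto
    define b where "b n = Q * (L * e ^ n) powr \<gamma> * (7 ^ CARD('k) * measure \<mu> S)" for n
    have lim_p: "(\<lambda>n. p ^ n) \<longlonglongrightarrow> 0" and lim_e: "(\<lambda>n. e ^ n) \<longlonglongrightarrow> 0"
      using p e by (auto intro: LIMSEQ_realpow_zero)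
    have lim_pe: "(\<lambda>n. (p * e) ^ n) \<longlonglongrightarrow> 0"
      unfolding power_mult_distrib using tendsto_mult[OF lim_p lim_e] by simp
    have "e ^ N < 1" using e N by (intro power_less_one_iff[THEN iffD2]) auto
    then have lim_eN: "(\<lambda>n. Ch * 2 ^ Suc CARD('d) * 2 ^ N * (e ^ N) ^ n) \<longlonglongrightarrow> 0"
      using tendsto_mult_right_zero[OF LIMSEQ_realpow_zero[of "e ^ N"]] e by auto
    have lim_le: "(\<lambda>n. L * e ^ n) \<longlonglongrightarrow> 0" using tendsto_mult_right_zero[OF lim_e] .
    have "\<forall>\<^sub>F n in sequentially. p ^ n < min \<sigma>0 (R0 / 4) \<and> (p * e) ^ n < \<sigma>i \<and> L * e ^ n < \<eta>0 \<and>
       Ch * 2 ^ Suc CARD('d) * 2 ^ N * (e ^ N) ^ n < 1"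
      using nb R0 L(2)
      by (intro eventually_conj order_tendstoD(2)[OF lim_p] order_tendstoD(2)[OF lim_pe]
          order_tendstoD(2)[OF lim_le] order_tendstoD(2)[OF lim_eN]) auto
    then obtain n0 where n0: "\<And>n. n \<ge> n0 \<Longrightarrow> p ^ n < min \<sigma>0 (R0 / 4) \<and> (p * e) ^ n < \<sigma>i \<and> L * e ^ n < \<eta>0 \<and>
       Ch * 2 ^ Suc CARD('d) * 2 ^ N * (e ^ N) ^ n < 1" by (auto simp: eventually_sequentially)
    have bound: "emeasure \<mu> (E n) \<le> ennreal (b n)" if n: "n \<ge> n0" for n
    proof -
      define \<sigma> where "\<sigma> = p ^ n"
      define \<delta> where "\<delta> = L * (p * e) ^ n"
      have \<sigma>: "0 < \<sigma>" "\<sigma> \<le> \<sigma>0" "4 * \<sigma> \<le> R0" using n0[OF n] p by (auto simp: \<sigma>_def)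
      have small: "(p * e) ^ n \<le> \<sigma>i" using n0[OF n] by simp
      have \<delta>\<sigma>: "\<delta> = (L * e ^ n) * \<sigma>" by (simp add: \<delta>_def \<sigma>_def power_mult_distrib)
      have \<delta>: "0 < \<delta>" "\<delta> \<le> \<eta>0 * \<sigma>"
        using n0[OF n] L p e \<sigma> unfolding \<delta>\<sigma> by (auto intro!: mult_right_mono)
      have "\<eta>0 * \<sigma> \<le> 1/2 * \<sigma>" "r0 * \<sigma> \<le> 1/2 * \<sigma>" using nb \<sigma> by (auto intro!: mult_right_mono)
      then have \<delta>2: "r0 * \<sigma> + \<delta> \<le> 2 * \<sigma>" "2 * (r0 * \<sigma>) \<le> 2 * \<sigma>" using \<delta> \<sigma> by linarith+
      have hyp: "Ch * (2 ^ Suc n) ^ Suc CARD('d) * (2 * \<sigma>) ^ N < 1"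
      proof -
        have "(2 ^ Suc n) ^ Suc CARD('d) * (2 * \<sigma>) ^ N
           = 2 ^ Suc CARD('d) * 2 ^ N * (2 ^ Suc CARD('d) * p ^ N) ^ n"
          unfolding \<sigma>_def power_mult_distrib power_Suc[of 2 n] by (simp add: mult_ac flip: power_mult)
        then have "Ch * (2 ^ Suc n) ^ Suc CARD('d) * (2 * \<sigma>) ^ N = Ch * 2 ^ Suc CARD('d) * 2 ^ N * (e ^ N) ^ n"
          unfolding pN by (simp only: mult.assoc)
        then show ?thesis using n0[OF n] by (simp only:)
      qed
      have inS: "max_cball x (2 * \<sigma>) \<subseteq> S" if "x \<in> max_cball u R" for x
        unfolding S_def using that R \<sigma> by (auto intro: max_cball_trans)
      have "emeasure \<mu> (E n) \<le> ennreal (Q * (\<delta> / \<sigma>) powr \<gamma>) *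
         (ennreal (real (2 * 2 + 3) ^ CARD('k)) * emeasure \<mu> S)"
      proof (rule emeasure_le_by_grid[OF U Es _ SS, where s="r0 * \<sigma>"])
        show "bounded (E n)"
          by (rule bounded_subset[of "max_cball u R"]) (auto simp: compact_imp_bounded E_def)
        show "0 < r0 * \<sigma>" using nb \<sigma> by simp
        fix x assume x: "x \<in> E n"
        then have xR: "x \<in> max_cball u R" by (simp add: E_def)
        have sub2: "max_cball x (2 * (r0 * \<sigma>)) \<subseteq> S"
          using inS[OF xR] max_cball_mono[OF \<delta>2(2), of x] by blast
        then show "max_cball x (real 2 * (r0 * \<sigma>)) \<subseteq> S" by simp
        have xS: "x \<in> S" using xR subR by blast
        obtain a b where ab: "a \<noteq> 0" "\<forall>z\<in>S \<inter> max_cball x (2 * \<sigma>).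
           denominator_le (2 ^ Suc n) (\<Psi> z) \<longrightarrow> a \<bullet> \<Psi> z = b"
          using Ch(2)[OF xS _ _ _ hyp] \<sigma> R0(2) by auto
        obtain F where F: "F \<in> sets \<mu>"
          "\<And>v z. v \<in> max_cball x (r0 * \<sigma>) \<inter> measure_support U \<mu> \<Longrightarrow> z \<in> max_cball v \<delta> \<Longrightarrow> a \<bullet> \<Psi> z = b \<Longrightarrow> v \<in> F"
          "emeasure \<mu> F \<le> ennreal (Q * (\<delta> / \<sigma>) powr \<gamma>) * emeasure \<mu> (max_cball x (2 * (r0 * \<sigma>)))"
          using nb(9)[OF \<sigma>(1,2) inS[OF xR] \<delta> ab(1), of b] by blast
        have "E n \<inter> max_cball x (r0 * \<sigma>) \<subseteq> F"
        proof
          fix v assume v: "v \<in> E n \<inter> max_cball x (r0 * \<sigma>)"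
          then obtain r where r: "r \<in> rational_points" "r \<in> M" "close n v r" by (auto simp: E_def)
          have vR: "v \<in> max_cball u R" using v by (simp add: E_def)
          have "v \<in> max_cball u Ri" "v \<in> U" using vR max_cball_mono[OF R(3)] subR S(3) by auto
          moreover have d: "maxdist (\<Psi> v) r \<le> (p * e) ^ n" using r(3) by (simp add: close_def)
          ultimately obtain z where z: "z \<in> U" "\<Psi> z = r" "z \<in> max_cball v (L * maxdist (\<Psi> v) r)"
            using L(4)[of v r] r(2) small by force
          have "L * maxdist (\<Psi> v) r \<le> \<delta>" unfolding \<delta>_def using d L by (intro mult_left_mono) auto
          then have zv: "z \<in> max_cball v \<delta>" using z(3) max_cball_mono by blast
          then have zx: "z \<in> max_cball x (2 * \<sigma>)" using v \<delta>2(1) by (intro max_cball_trans[of v x "r0 * \<sigma>" z \<delta>]) auto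
          have "real (height r) \<le> 2 ^ Suc n"
            using r(3) unfolding close_def by (metis less_imp_le of_nat_le_iff of_nat_numeral of_nat_power)
          then have "a \<bullet> \<Psi> z = b"
            using ab(2) zx inS[OF xR] height_props[OF r(1)] z(2) by blast
          then show "v \<in> F" using F(2)[OF _ zv] v by (auto simp: E_def)
        qed
        then have "emeasure \<mu> (E n \<inter> max_cball x (r0 * \<sigma>)) \<le> emeasure \<mu> F"
          using F(1) by (rule emeasure_mono)
        with F(3) show "emeasure \<mu> (E n \<inter> max_cball x (r0 * \<sigma>))
          \<le> ennreal (Q * (\<delta> / \<sigma>) powr \<gamma>) * emeasure \<mu> (max_cball x (real 2 * (r0 * \<sigma>)))" by simp
      qed
      also have "\<delta> / \<sigma> = L * e ^ n" using \<sigma> by (simp add: \<delta>\<sigma>)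
      also have "ennreal (Q * (L * e ^ n) powr \<gamma>) * (ennreal (real (2 * 2 + 3) ^ CARD('k)) * emeasure \<mu> S) = ennreal (b n)"
        using nb(7) unfolding mS b_def by (simp add: ennreal_mult)
      finally show ?thesis .
    qed
    have b0: "0 \<le> b n" for n using nb(7) by (simp add: b_def)
    have b_eq: "b n = Q * L powr \<gamma> * (7 ^ CARD('k) * measure \<mu> S) * (e powr \<gamma>) ^ n" for n
    proof -
      have "(L * e ^ n) powr \<gamma> = L powr \<gamma> * (e ^ n) powr \<gamma>" by (rule powr_mult)
      also have "(e ^ n) powr \<gamma> = (e powr \<gamma>) ^ n" using e by (simp add: powr_realpow[symmetric] powr_powr mult.commute)
      finally show ?thesis by (simp add: b_def)
    qed
    have "e powr \<gamma> < 1" using e nb(8) powr_less_mono2[of \<gamma> e 1] by simp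
    then have "summable (\<lambda>n. (e powr \<gamma>) ^ n)" by (intro summable_geometric) simp
    then have sb: "summable b" unfolding b_eq[abs_def] by (rule summable_mult)
    have "AE v in \<mu>. \<forall>\<^sub>F n in sequentially. v \<in> space \<mu> - E (n + n0)"
    proof (rule borel_cantelli_AE1)
      show "E (n + n0) \<in> sets \<mu>" for n by (rule Es)
      have le: "emeasure \<mu> (E (n + n0)) \<le> ennreal (b (n + n0))" for n by (rule bound) simp
      then show "emeasure \<mu> (E (n + n0)) < \<infinity>" for n
        using le_less_trans[OF le[of n] ennreal_less_top] by simp
      show "summable (\<lambda>n. measure \<mu> (E (n + n0)))"
      proof (rule summable_comparison_test'[of "\<lambda>n. b (n + n0)" 0])
        show "summable (\<lambda>n. b (n + n0))" using sb by (simp add: summable_iff_shift)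
        show "norm (measure \<mu> (E (n + n0))) \<le> b (n + n0)" for n
          using enn2real_leI[OF b0 le[of n]] by (simp add: measure_def)
      qed
    qed
    then show "AE v in \<mu>. v \<in> max_cball u R \<inter> measure_support U \<mu> \<longrightarrow>
     (\<forall>\<^sub>F n in sequentially. \<not> (approximable_at_scale M (2 powr (- (c_kd CARD('k) CARD('d) + \<epsilon>))) n (\<Psi> v)))"
      unfolding c_def[symmetric] pe
    proof (eventually_elim, intro impI)
      fix v assume ev: "\<forall>\<^sub>F n in sequentially. v \<in> space \<mu> - E (n + n0)"
        and v: "v \<in> max_cball u R \<inter> measure_support U \<mu>"
      have "\<forall>\<^sub>F n in sequentially. v \<notin> E (n + n0)" using ev by eventually_elim auto
      then have "\<forall>\<^sub>F n in sequentially. v \<notin> E n"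
        using eventually_sequentially_seg[of "\<lambda>n. v \<notin> E n" n0] by blast
      then show "\<forall>\<^sub>F n in sequentially. \<not> (approximable_at_scale M (p * e) n (\<Psi> v))"
        by eventually_elim (use v in \<open>auto simp: E_def close_def\<close>)
    qed
  qed
qed

text \<open>
  A point lies on a hyperplane, so it is contained in arbitrarily thin slabs.
\<close>

lemma singleton_null:
  fixes \<mu> :: "(real^'k) measure"
  assumes lf: "locally_finite_borel_measure U \<mu>" and U: "open U"
    and dec: "hyperplane_decay U \<mu> C \<alpha>" "C > 0" "\<alpha> > 0" and v: "v \<in> measure_support U \<mu>"
  shows "{v} \<in> null_sets \<mu>"
proof -
  have Us: "sets \<mu> = sets (restrict_space borel U)" using lf by (simp add: locally_finite_borel_measure_def)
  have vU: "v \<in> U" using v by (simp add: measure_support_def)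
  obtain \<rho> where \<rho>: "0 < \<rho>" "\<rho> \<le> 1" "max_cball v \<rho> \<subseteq> U" using max_cball_subset_open[OF U vU] .
  define m where "m = measure \<mu> (max_cball v \<rho>)"
  have m: "emeasure \<mu> (max_cball v \<rho>) = ennreal m"
    unfolding m_def using locally_finite_emeasure_compact[OF lf U compact_max_cball \<rho>(3)]
    by (intro emeasure_eq_ennreal_measure) auto
  have m0: "0 \<le> m" by (simp add: m_def)
  have vs: "{v} \<in> sets \<mu>" using vU by (simp add: sets_on_open[OF U Us])
  have le: "emeasure \<mu> {v} \<le> ennreal (C * t * m)" if t: "t > 0" for t
  proof -
    define \<epsilon> where "\<epsilon> = t powr (1 / \<alpha>)"
    have \<epsilon>: "0 < \<epsilon>" "\<epsilon> powr \<alpha> = t" using t dec(3) by (auto simp: \<epsilon>_def powr_powr)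
    fix i :: 'k
    have "emeasure \<mu> {v} \<le> emeasure \<mu> (slab (axis i 1) (v $ i) (\<bar>axis i 1 $ i\<bar> * (\<epsilon> * \<rho>)) \<inter> max_cball v \<rho>)"
      using \<rho> \<epsilon> by (intro emeasure_mono)
        (auto simp: sets_on_open[OF U Us] sets_slab mem_max_cball inner_axis' intro!: sets.Int)
    also have "\<dots> \<le> ennreal (C * \<epsilon> powr \<alpha>) * emeasure \<mu> (max_cball v \<rho>)"
      using \<rho> \<epsilon> by (intro hyperplane_decayD[OF dec(1) v]) auto
    also have "\<dots> = ennreal (C * t * m)" using dec(2) t m0 by (simp add: m \<epsilon> ennreal_mult)
    finally show ?thesis .
  qed
  define x where "x = measure \<mu> {v}"
  have fin: "emeasure \<mu> {v} = ennreal x"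
    unfolding x_def using le_less_trans[OF le[of 1] ennreal_less_top] by (intro emeasure_eq_ennreal_measure) auto
  have "x \<le> 0"
  proof (rule ccontr)
    assume "\<not> x \<le> 0"
    define y where "y = C * m + 1"
    define t where "t = x / (2 * y)"
    have Cm: "0 < y" unfolding y_def using dec(2) m0 by (intro add_nonneg_pos) auto
    have t: "0 < t" using Cm \<open>\<not> x \<le> 0\<close> by (simp add: t_def)
    have "x \<le> C * t * m" using le[OF t] t m0 dec(2) unfolding fin by (subst (asm) ennreal_le_iff) auto
    also have "\<dots> = (C * m) * t" by simp
    also have "\<dots> \<le> y * t" using t by (simp add: y_def)
    also have "\<dots> = x / 2" using Cm by (simp add: t_def)
    finally show False using \<open>\<not> x \<le> 0\<close> by simp
  qed
  then have "emeasure \<mu> {v} = 0" unfolding fin by (simp add: ennreal_neg)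
  then show ?thesis using vs by auto
qed

text \<open>
  By the lemma of Lindelof, countably many of the neighbourhoods found above cover the nondegenerate
  points. Parameters of rational points are countably many, hence negligible.
\<close>

theorem AE_not_VWA:
  fixes \<Psi> :: "real^'k \<Rightarrow> real^'d"
  assumes card: "CARD('k) \<le> CARD('d)" and par: "local_parameterization M U \<Psi>"
    and lf: "locally_finite_borel_measure U \<mu>"
    and dec: "hyperplane_decay U \<mu> C \<alpha>" "C > 0" "\<alpha> > 0"
    and nd: "AE v in \<mu>. nondegenerate_point TYPE('k) M (\<Psi> v)"
  shows "AE v in \<mu>. \<Psi> v \<notin> VWA M (c_kd CARD('k) CARD('d))"
proof -
  note sm = local_parameterization_smooth[OF par]
  have U: "open U" "sets \<mu> = sets (restrict_space borel U)"
    using smooth_on_open_openD[OF sm] lf by (auto simp: locally_finite_borel_measure_def)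
  have space: "space \<mu> = U" using sets_eq_imp_space_eq[OF U(2)] by (simp add: space_restrict_space)
  define c where "c = c_kd CARD('k) CARD('d)"
  have "1 \<le> N_kd CARD('k) CARD('d)" using card by (intro N_kd_pos) (simp_all add: Suc_le_eq)
  then have c0: "c > 0" by (simp add: c_def c_kd_def)
  define good where "good v \<longleftrightarrow> (\<forall>m. \<forall>\<^sub>F n in sequentially. \<not> (approximable_at_scale M (2 powr (- (c + inverse (real (Suc m))))) n (\<Psi> v)))" for v
  define \<F> where "\<F> = {W. open W \<and> (AE v in \<mu>. v \<in> W \<longrightarrow> v \<in> measure_support U \<mu> \<longrightarrow> good v)}"
  have cover: "v \<in> \<Union>\<F>" if v: "v \<in> U" "nondegenerate_point TYPE('k) M (\<Psi> v)" for v
  proof -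
    obtain R where R: "R > 0" "\<And>\<epsilon>. \<epsilon> > 0 \<Longrightarrow>
      AE w in \<mu>. w \<in> max_cball v R \<inter> measure_support U \<mu> \<longrightarrow>
       (\<forall>\<^sub>F n in sequentially. \<not> (approximable_at_scale M (2 powr (- (c + \<epsilon>))) n (\<Psi> w)))"
      unfolding c_def by (rule AE_eventually_not_approximable[OF card par lf dec v]) blast
    have "AE w in \<mu>. \<forall>m. w \<in> max_cball v R \<inter> measure_support U \<mu> \<longrightarrow>
       (\<forall>\<^sub>F n in sequentially. \<not> (approximable_at_scale M (2 powr (- (c + inverse (real (Suc m))))) n (\<Psi> w)))"
      unfolding AE_all_countable by (intro allI R(2)) simp
    then have "AE w in \<mu>. w \<in> ball v R \<longrightarrow> w \<in> measure_support U \<mu> \<longrightarrow> good w"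
      unfolding good_def
      by eventually_elim (use cball_subset_max_cball[of v R] ball_subset_cball[of v R] in blast)
    then have "ball v R \<in> \<F>" by (simp add: \<F>_def)
    moreover have "v \<in> ball v R" using R(1) by simp
    ultimately show ?thesis by blast
  qed
  obtain \<G> where \<G>: "\<G> \<subseteq> \<F>" "countable \<G>" "\<Union>\<G> = \<Union>\<F>"
    using Lindelof[of \<F>] by (auto simp: \<F>_def)
  have "AE v in \<mu>. \<forall>W\<in>\<G>. v \<in> W \<longrightarrow> v \<in> measure_support U \<mu> \<longrightarrow> good v"
    using \<G>(1,2) by (subst AE_ball_countable) (auto simp: \<F>_def)
  moreover have "AE v in \<mu>. v \<in> measure_support U \<mu> \<longrightarrow> \<Psi> v \<notin> rational_points"
  proof -
    define Z where "Z = {v \<in> measure_support U \<mu>. \<Psi> v \<in> rational_points}"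
    have "inj_on \<Psi> U" using par by (auto simp: local_parameterization_def diffeomorphism_def bij_betw_def)
    then have "inj_on \<Psi> Z" by (rule inj_on_subset) (auto simp: Z_def measure_support_def)
    moreover have "countable (\<Psi> ` Z)"
      by (rule countable_subset[OF _ countable_rational_points]) (auto simp: Z_def)
    ultimately have "countable Z" using countable_image_inj_on by blast
    then have "(\<Union>v\<in>Z. {v}) \<in> null_sets \<mu>"
      by (rule null_sets_UN') (auto simp: Z_def intro: singleton_null[OF lf U(1) dec])
    then show ?thesis by (rule AE_I') (auto simp: Z_def)
  qed
  ultimately show ?thesis
    using nd AE_measure_support[OF U] AE_space
  proof eventually_elim
    case (elim v)
    then have "v \<in> \<Union>\<G>" using cover[of v] \<G>(3) space by simp
    then have g: "good v" using elim by blast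
    show "\<Psi> v \<notin> VWA M (c_kd CARD('k) CARD('d))"
    proof
      assume "\<Psi> v \<in> VWA M (c_kd CARD('k) CARD('d))"
      then obtain m where "\<exists>\<^sub>F n in sequentially. approximable_at_scale M (2 powr (- (c + inverse (real (Suc m))))) n (\<Psi> v)"
        using VWA_infinitely_many_scales[of "\<Psi> v" M c] elim c0 unfolding c_def by blast
      then show False using g unfolding good_def frequently_def by blast
    qed
  qed
qed

section \<open>Lebesgue measure and the volume measure\<close>

lemma emeasure_max_cball:
  fixes x :: "real^'k"
  assumes "0 \<le> \<rho>"
  shows "emeasure lborel (max_cball x \<rho>) = ennreal ((2 * \<rho>) ^ CARD('k))"
proof -
  have "x \<in> max_cball x \<rho>" using assms by (simp add: mem_max_cball)
  then have ne: "cbox (\<chi> i. x $ i - \<rho>) (\<chi> i. x $ i + \<rho>) \<noteq> {}" by (auto simp: max_cball_eq_cbox)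
  have "measure lborel (max_cball x \<rho>) = (2 * \<rho>) ^ CARD('k)"
    unfolding max_cball_eq_cbox content_cbox_cart[OF ne] by simp
  moreover have "emeasure lborel (max_cball x \<rho>) = ennreal (measure lborel (max_cball x \<rho>))"
    using emeasure_compact_finite[of "max_cball x \<rho>"] by (intro emeasure_eq_ennreal_measure) auto
  ultimately show ?thesis by simp
qed

lemma emeasure_lborel_translate:
  fixes A :: "(real^'k) set"
  assumes "A \<in> sets borel"
  shows "emeasure lborel ((\<lambda>y. c + y) -` A) = emeasure lborel A"
proof -
  have "emeasure lborel A = emeasure (distr lborel borel ((+) c)) A"
    by (simp add: lborel_distr_plus)
  also have "\<dots> = emeasure lborel ((\<lambda>y. c + y) -` A)"
    using assms by (subst emeasure_distr) auto
  finally show ?thesis by simp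
qed

text \<open>
  Translates of the slab by multiples of \<open>3 \<epsilon> \<rho>\<close> in direction \<open>i\<close> are disjoint. More than \<open>1 / (3 \<epsilon>)\<close> of them
  fit into the cube of radius \<open>2 \<rho>\<close>, and all have the same measure.
\<close>

lemma lborel_hyperplane_decay:
  fixes U :: "(real^'k) set"
  assumes U: "open U"
  shows "hyperplane_decay U (restrict_space lborel U) (3 * 2 ^ CARD('k)) 1"
  unfolding hyperplane_decay_def
proof (intro ballI allI impI)
  fix x a :: "real^'k" and \<rho> \<epsilon> b :: real and i
  assume \<rho>: "0 < \<rho>" and sub: "max_cball x \<rho> \<subseteq> U" and \<epsilon>: "0 < \<epsilon>" and a: "a $ i \<noteq> 0"
  define A where "A = slab a b (\<bar>a $ i\<bar> * (\<epsilon> * \<rho>)) \<inter> max_cball x \<rho>"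
  have A: "A \<in> sets borel" unfolding A_def by (intro sets.Int sets_slab max_cball_borel)
  \<comment> \<open>With \<open>j \<le> n\<close> the translations are by at most \<open>\<rho>\<close>.\<close>
  define n where "n = nat \<lfloor>1 / (3 * \<epsilon>)\<rfloor>"
  define T where "T j = (\<lambda>y. (- real j * (3 * \<epsilon> * \<rho>)) *\<^sub>R axis i 1 + y) -` A" for j :: nat
  have Tm: "emeasure lborel (T j) = emeasure lborel A" for j
    unfolding T_def by (rule emeasure_lborel_translate[OF A])
  have Ts: "T j \<in> sets lborel" for j
    unfolding T_def sets_lborel by (rule measurable_sets_borel[OF _ A]) simp
  have disj: "disjoint_family_on T {..n}"
    unfolding disjoint_family_on_def
  proof (intro ballI impI)
    have aux: "j = j'" if "y \<in> T j" "y \<in> T j'" "j \<le> j'" for y j j'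
    proof (rule ccontr)
      assume "j \<noteq> j'"
      then have jj: "1 \<le> real j' - real j" using that(3) by linarith
      have e: "\<bar>a \<bullet> y - b - a $ i * (real l * (3 * \<epsilon> * \<rho>))\<bar> \<le> \<bar>a $ i\<bar> * (\<epsilon> * \<rho>)" if "y \<in> T l" for l
        using that by (simp add: T_def A_def inner_add_right inner_axis algebra_simps)
      have "\<bar>a $ i\<bar> * ((real j' - real j) * (3 * \<epsilon> * \<rho>)) = \<bar>a $ i * ((real j' - real j) * (3 * \<epsilon> * \<rho>))\<bar>"
        using jj \<epsilon> \<rho> by (simp add: abs_mult)
      also have "\<dots> \<le> 2 * (\<bar>a $ i\<bar> * (\<epsilon> * \<rho>))"
        using e[OF that(1)] e[OF that(2)] by (simp add: algebra_simps)
      finally have "\<bar>a $ i\<bar> * ((real j' - real j) * (3 * (\<epsilon> * \<rho>))) \<le> \<bar>a $ i\<bar> * (2 * (\<epsilon> * \<rho>))" by (simp add: mult_ac)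
      then have "(real j' - real j) * (3 * (\<epsilon> * \<rho>)) \<le> 2 * (\<epsilon> * \<rho>)" 
        by (rule mult_left_le_imp_le) (use a in simp)
      moreover have "1 * (3 * (\<epsilon> * \<rho>)) \<le> (real j' - real j) * (3 * (\<epsilon> * \<rho>))" using jj \<epsilon> \<rho> by (intro mult_right_mono) auto
      ultimately show False using mult_pos_pos[OF \<epsilon> \<rho>] by linarith
    qed
    fix j j' :: nat assume "j \<noteq> j'"
    show "T j \<inter> T j' = {}"
    proof (rule ccontr)
      assume "T j \<inter> T j' \<noteq> {}"
      then obtain y where "y \<in> T j" "y \<in> T j'" by blast
      then show False using aux[of y j j'] aux[of y j' j] \<open>j \<noteq> j'\<close> by linarith
    qed
  qed
  have n_le: "real n \<le> 1 / (3 * \<epsilon>)" and n_ge: "1 / (3 * \<epsilon>) \<le> real n + 1"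
    using \<epsilon> by (auto simp: n_def intro: less_imp_le real_of_int_floor_add_one_gt)
  have "T j \<subseteq> max_cball x (2 * \<rho>)" if j: "j \<le> n" for j
  proof
    fix y assume y: "y \<in> T j"
    have "real j * (3 * \<epsilon> * \<rho>) \<le> 1 / (3 * \<epsilon>) * (3 * \<epsilon> * \<rho>)"
      using j n_le \<epsilon> \<rho> by (intro mult_right_mono) auto
    also have "\<dots> = \<rho>" using \<epsilon> by simp
    finally have s: "real j * (3 * \<epsilon> * \<rho>) \<le> \<rho>" .
    have s0: "0 \<le> real j * (3 * \<epsilon> * \<rho>)" using \<epsilon> \<rho> by simp
    have "\<bar>y $ l - x $ l\<bar> \<le> 2 * \<rho>" for l
    proof -
      have "\<bar>(- real j * (3 * \<epsilon> * \<rho>)) * axis i 1 $ l + y $ l - x $ l\<bar> \<le> \<rho>"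
        using y by (auto simp: T_def A_def mem_max_cball)
      then show ?thesis using s s0 \<rho> unfolding mult_minus_left axis_def by (cases "l = i"; simp; linarith)
    qed
    then show "y \<in> max_cball x (2 * \<rho>)" by (simp add: mem_max_cball)
  qed
  then have "(\<Union>j\<in>{..n}. T j) \<subseteq> max_cball x (2 * \<rho>)" by blast
  then have "emeasure lborel (\<Union>j\<in>{..n}. T j) \<le> emeasure lborel (max_cball x (2 * \<rho>))"
    by (intro emeasure_mono) auto
  moreover have "emeasure lborel (\<Union>j\<in>{..n}. T j) = (\<Sum>j\<in>{..n}. emeasure lborel (T j))"
    using disj Ts by (intro sum_emeasure[symmetric]) auto
  ultimately have "of_nat (Suc n) * emeasure lborel A \<le> emeasure lborel (max_cball x (2 * \<rho>))"
    by (simp add: Tm)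
  also have "\<dots> = ennreal ((2 * (2 * \<rho>)) ^ CARD('k))" using \<rho> by (intro emeasure_max_cball) simp
  also have "(2 * (2 * \<rho>)) ^ CARD('k) = 2 ^ CARD('k) * (2 * \<rho>) ^ CARD('k)" by (rule power_mult_distrib)
  also have "ennreal \<dots> = ennreal (2 ^ CARD('k)) * ennreal ((2 * \<rho>) ^ CARD('k))"
    using \<rho> by (intro ennreal_mult) auto
  also have "ennreal ((2 * \<rho>) ^ CARD('k)) = emeasure lborel (max_cball x \<rho>)"
    using \<rho> by (intro emeasure_max_cball[symmetric]) simp
  finally have le: "of_nat (Suc n) * emeasure lborel A \<le> ennreal (2 ^ CARD('k)) * emeasure lborel (max_cball x \<rho>)" .
  have "1 \<le> 3 * \<epsilon> * real (Suc n)" using n_ge \<epsilon> by (simp add: field_simps)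
  moreover have "ennreal (3 * \<epsilon>) * of_nat (Suc n) = ennreal (3 * \<epsilon> * real (Suc n))"
    unfolding ennreal_of_nat_eq_real_of_nat using \<epsilon> by (intro ennreal_mult[symmetric]) auto
  ultimately have "1 \<le> ennreal (3 * \<epsilon>) * of_nat (Suc n)" by (metis ennreal_1 ennreal_leI)
  then have "1 * emeasure lborel A \<le> (ennreal (3 * \<epsilon>) * of_nat (Suc n)) * emeasure lborel A"
    by (intro mult_right_mono) auto
  also have "\<dots> \<le> ennreal (3 * \<epsilon>) * (ennreal (2 ^ CARD('k)) * emeasure lborel (max_cball x \<rho>))"
    unfolding mult.assoc by (intro mult_left_mono le) auto
  also have "\<dots> = ennreal (3 * 2 ^ CARD('k) * \<epsilon> powr 1) * emeasure lborel (max_cball x \<rho>)"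
    using \<epsilon> by (simp add: mult_ac flip: ennreal_mult mult.assoc)
  finally have "emeasure lborel A \<le> ennreal (3 * 2 ^ CARD('k) * \<epsilon> powr 1) * emeasure lborel (max_cball x \<rho>)" by simp
  moreover have "A \<subseteq> U" using sub by (auto simp: A_def)
  ultimately show "emeasure (restrict_space lborel U) (slab a b (\<bar>a $ i\<bar> * (\<epsilon> * \<rho>)) \<inter> max_cball x \<rho>)
     \<le> ennreal (3 * 2 ^ CARD('k) * \<epsilon> powr 1) * emeasure (restrict_space lborel U) (max_cball x \<rho>)"
    using U sub by (simp add: emeasure_restrict_space flip: A_def)
qed

lemma locally_finite_restrict_lborel:
  fixes U :: "(real^'k) set"
  assumes U: "open U"
  shows "locally_finite_borel_measure U (restrict_space lborel U)"
  unfolding locally_finite_borel_measure_def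
proof (intro conjI ballI)
  show "sets (restrict_space lborel U) = sets (restrict_space borel U)" by (simp add: sets_restrict_space)
  fix x assume "x \<in> U"
  have "emeasure (restrict_space lborel U) (ball x 1 \<inter> U) = emeasure lborel (ball x 1 \<inter> U)"
    using U by (intro emeasure_restrict_space) auto
  also have "\<dots> \<le> emeasure lborel (cball x 1)" using U by (intro emeasure_mono) auto
  also have "\<dots> < \<infinity>" using emeasure_compact_finite[OF compact_cball] .
  finally show "\<exists>W. open W \<and> x \<in> W \<and> emeasure (restrict_space lborel U) (W \<inter> U) < \<infinity>"
    by (intro exI[of _ "ball x 1"]) auto
qed

lemma continuous_on_det:
  fixes X :: "'a::topological_space \<Rightarrow> real^'n^'n"
  assumes "\<And>i j. continuous_on S (\<lambda>t. X t $ i $ j)"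
  shows "continuous_on S (\<lambda>t. det (X t))"
  unfolding det_def by (intro continuous_intros assms)

text \<open>
  On the segment from the Gram matrix to the identity all matrices are positive definite, hence
  invertible. So the determinant does not change its sign there.
\<close>

lemma det_gram_pos:
  fixes A :: "real^'k^'d"
  assumes inj: "\<And>w. A *v w = 0 \<Longrightarrow> w = 0"
  shows "0 < det (transpose A ** A)"
proof (rule ccontr)
  assume neg: "\<not> 0 < det (transpose A ** A)"
  define X where "X t = t *\<^sub>R mat 1 + (1 - t) *\<^sub>R (transpose A ** A)" for t :: real
  have "continuous_on {0..1} (\<lambda>t. det (X t))"
    by (rule continuous_on_det) (auto simp: X_def intro!: continuous_intros)
  moreover have "det (X 0) \<le> 0" "0 \<le> det (X 1)" using neg by (simp_all add: X_def)
  ultimately obtain t where t: "0 \<le> t" "t \<le> 1" "det (X t) = 0"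
    using IVT'[of "\<lambda>t. det (X t)" 0 0 1] by auto
  then have "\<not> invertible (X t)" by (simp add: invertible_det_nz)
  then obtain w where w: "w \<noteq> 0" "X t *v w = 0"
    unfolding invertible_left_inverse matrix_left_invertible_ker by blast
  have "X t *v w = t *\<^sub>R w + (1 - t) *\<^sub>R (transpose A *v (A *v w))"
    by (simp add: X_def matrix_vector_mult_add_rdistrib scaleR_matrix_vector_assoc[symmetric] matrix_vector_mul_assoc)
  then have "0 = w \<bullet> (t *\<^sub>R w + (1 - t) *\<^sub>R (transpose A *v (A *v w)))" using w(2) by simp
  also have "\<dots> = t * (w \<bullet> w) + (1 - t) * ((A *v w) \<bullet> (A *v w))"
  proof -
    have "w \<bullet> (transpose A *v z) = (A *v w) \<bullet> z" for z
      by (simp add: transpose_matrix_vector inner_commute[of w] dot_lmul_matrix inner_commute[of z])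
    then show ?thesis by (simp add: inner_add_right)
  qed
  finally have e: "t * (w \<bullet> w) + (1 - t) * ((A *v w) \<bullet> (A *v w)) = 0" by simp
  have p: "0 < w \<bullet> w" "0 < (A *v w) \<bullet> (A *v w)" using w(1) inj[of w] by auto
  have "0 \<le> t * (w \<bullet> w)" "0 \<le> (1 - t) * ((A *v w) \<bullet> (A *v w))" using t p by auto
  then have "t * (w \<bullet> w) = 0" "(1 - t) * ((A *v w) \<bullet> (A *v w)) = 0" using e by linarith+
  then show False using p by auto
qed

text \<open>
  A parameterization has a smooth left inverse, so its derivative is injective.
\<close>

lemma jacobian_volume_pos:
  fixes \<Phi> :: "real^'k \<Rightarrow> real^'d"
  assumes par: "local_parameterization M U \<Phi>" and v: "v \<in> U"
  shows "0 < jacobian_volume \<Phi> v"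
proof -
  note sm = local_parameterization_smooth[OF par]
  obtain W G where W: "\<Phi> v \<in> W" "smooth_on_open W G"
    "\<And>v. v \<in> U \<Longrightarrow> \<Phi> v \<in> W \<Longrightarrow> G (\<Phi> v) = v"
    using local_parameterization_inverse[OF par v] by metis
  define D where "D = frechet_derivative \<Phi> (at v)"
  have D: "(\<Phi> has_derivative D) (at v)"
    using smooth_on_open_differentiable[OF sm v] by (simp add: D_def frechet_derivative_works)
  obtain D' where D': "(G has_derivative D') (at (\<Phi> v))"
    using smooth_on_open_differentiable[OF W(2,1)] by (auto simp: differentiable_def)
  have 1: "((\<lambda>y. G (\<Phi> y)) has_derivative (\<lambda>h. D' (D h))) (at v)"
    by (rule has_derivative_compose[OF D D'])
  have op: "open (U \<inter> \<Phi> -` W)"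
    using smooth_on_open_continuous[OF sm] smooth_on_open_openD[OF sm] smooth_on_open_openD[OF W(2)]
    by (rule continuous_open_preimage)
  have "((\<lambda>y. y) has_derivative (\<lambda>h. D' (D h))) (at v)"
    by (rule has_derivative_transform_within_open[OF 1 op]) (use v W in auto)
  then have id: "(\<lambda>h. D' (D h)) = (\<lambda>h. h)" by (rule has_derivative_unique) (rule has_derivative_ident)
  have lin: "linear D" "linear D'" using D D' has_derivative_linear by blast+
  have "w = 0" if "matrix D *v w = 0" for w
  proof -
    have "D w = 0" using that fun_cong[OF matrix_vector_mul(2)[OF lin(1)], of w] by simp
    then have "D' (D w) = 0" using linear_0[OF lin(2)] by simp
    then show ?thesis using fun_cong[OF id, of w] by simp
  qed
  then have "0 < det (transpose (matrix D) ** matrix D)" by (rule det_gram_pos)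
  then show ?thesis by (simp add: jacobian_volume_def Let_def D_def)
qed

lemma continuous_on_jacobian_volume:
  fixes \<Phi> :: "real^'k \<Rightarrow> real^'d"
  assumes sm: "smooth_on_open U \<Phi>"
  shows "continuous_on U (jacobian_volume \<Phi>)"
proof -
  have "continuous_on U (\<lambda>v. matrix (frechet_derivative \<Phi> (at v)) $ i $ j)" for i j
    using continuous_on_component[OF smooth_on_open_continuous[OF smooth_on_open_partial_deriv[OF sm, of j]], of i]
    by (simp add: matrix_def partial_deriv_def)
  then have "continuous_on U (\<lambda>v. det (transpose (matrix (frechet_derivative \<Phi> (at v))) ** matrix (frechet_derivative \<Phi> (at v))))"
    by (intro continuous_on_det)
       (simp add: matrix_matrix_mult_def transpose_def, intro continuous_on_sum continuous_on_mult)
  then show ?thesis unfolding jacobian_volume_def Let_def by (rule continuous_on_real_sqrt)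
qed

lemma parameterization_measurable:
  assumes "local_parameterization M U \<Phi>" "sets \<mu> = sets (restrict_space borel U)"
  shows "\<Phi> \<in> measurable \<mu> (restrict_space borel M)"
proof -
  have "\<Phi> \<in> borel_measurable (restrict_space borel U)"
    by (intro borel_measurable_continuous_on_restrict smooth_on_open_continuous local_parameterization_smooth[OF assms(1)])
  then have "\<Phi> \<in> measurable \<mu> borel" using measurable_cong_sets[OF assms(2) refl] by blast
  moreover have "\<Phi> ` U \<subseteq> M" using assms(1) by (auto simp: local_parameterization_def dest!: openin_imp_subset)
  moreover have "space \<mu> = U" using sets_eq_imp_space_eq[OF assms(2)] by (simp add: space_restrict_space)
  ultimately show ?thesis by (intro measurable_restrict_space2) auto
qed

text \<open>
  In a parameterization the volume measure has a positive density with respect to Lebesgue measure, so both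
  have the same null sets.
\<close>

lemma volume_null_iff:
  fixes \<Phi> :: "real^'k \<Rightarrow> real^'d"
  assumes vol: "volume_measure_on TYPE('k) M vol" and par: "local_parameterization M U \<Phi>"
    and A: "A \<in> sets borel" "A \<subseteq> U"
  shows "emeasure vol (\<Phi> ` A) = 0 \<longleftrightarrow> (AE v in lborel. v \<notin> A)"
proof -
  note sm = local_parameterization_smooth[OF par]
  have "(\<lambda>v. indicator U v *\<^sub>R jacobian_volume \<Phi> v) \<in> borel_measurable borel"
    using smooth_on_open_openD[OF sm] continuous_on_jacobian_volume[OF sm]
    by (intro borel_measurable_continuous_on_indicator) auto
  then have "(\<lambda>v. ennreal (indicator U v *\<^sub>R jacobian_volume \<Phi> v) * indicator A v) \<in> borel_measurable lborel"
    using A(1) by measurable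
  also have "(\<lambda>v. ennreal (indicator U v *\<^sub>R jacobian_volume \<Phi> v) * indicator A v)
      = (\<lambda>v. ennreal (jacobian_volume \<Phi> v) * indicator A v)"
    using A(2) by (auto simp: fun_eq_iff indicator_def)
  finally have m: "(\<lambda>v. ennreal (jacobian_volume \<Phi> v) * indicator A v) \<in> borel_measurable lborel" .
  have "emeasure vol (\<Phi> ` A) = (\<integral>\<^sup>+v\<in>A. ennreal (jacobian_volume \<Phi> v) \<partial>lborel)"
    using vol par A unfolding volume_measure_on_def by blast
  then have "emeasure vol (\<Phi> ` A) = 0 \<longleftrightarrow> (AE v in lborel. ennreal (jacobian_volume \<Phi> v) * indicator A v = 0)"
    using nn_integral_0_iff_AE[OF m] by simp
  also have "\<dots> \<longleftrightarrow> (AE v in lborel. v \<notin> A)"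
  proof (intro AE_cong)
    fix v
    show "ennreal (jacobian_volume \<Phi> v) * indicator A v = 0 \<longleftrightarrow> v \<notin> A"
      using jacobian_volume_pos[OF par, of v] A(2) by (auto simp: indicator_def)
  qed
  finally show ?thesis .
qed

lemma VWA_null_pushforward:
  fixes \<Psi> :: "real^'k \<Rightarrow> real^'d"
  assumes card: "CARD('k) \<le> CARD('d)" and par: "local_parameterization M U \<Psi>"
    and fr: "absolutely_friendly U \<mu>"
    and nd: "AE x in pushforward_on M \<Psi> \<mu>. nondegenerate_point TYPE('k) M x"
  shows "VWA M (c_kd CARD('k) CARD('d)) \<in> null_sets (pushforward_on M \<Psi> \<mu>)"
proof -
  have lf: "locally_finite_borel_measure U \<mu>" and ad: "absolutely_decaying U \<mu>"
    using fr by (auto simp: absolutely_friendly_def)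
  have U: "open U" "sets \<mu> = sets (restrict_space borel U)"
    using par lf by (auto simp: local_parameterization_def locally_finite_borel_measure_def)
  note m = parameterization_measurable[OF par U(2)]
  obtain C \<alpha> where C: "C > 0" "\<alpha> > 0" "hyperplane_decay U \<mu> C \<alpha>"
    using absolutely_decaying_imp_hyperplane_decay[OF U ad] by blast
  have "AE v in \<mu>. \<Psi> v \<notin> VWA M (c_kd CARD('k) CARD('d))"
    using nd unfolding pushforward_on_def
    by (intro AE_not_VWA[OF card par lf C(3,1,2)] AE_distrD[OF m])
  then have "\<Psi> -` VWA M (c_kd CARD('k) CARD('d)) \<inter> space \<mu> \<in> null_sets \<mu>"
    using measurable_sets[OF m VWA_sets] by (subst AE_iff_null_sets) auto
  then show ?thesis
    unfolding pushforward_on_def null_sets_distr_iff[OF m] using VWA_sets by blast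
qed

lemma VWA_null_volume_chart:
  fixes \<Phi> :: "real^'k \<Rightarrow> real^'d"
  assumes card: "CARD('k) \<le> CARD('d)" and vol: "volume_measure_on TYPE('k) M vol"
    and nd: "AE x in vol. nondegenerate_point TYPE('k) M x"
    and par: "local_parameterization M U \<Phi>"
  shows "VWA M (c_kd CARD('k) CARD('d)) \<inter> \<Phi> ` U \<in> null_sets vol"
proof -
  have U: "open U" using par by (simp add: local_parameterization_def)
  have vs: "sets vol = sets (restrict_space borel M)" using vol by (simp add: volume_measure_on_def)
  have lU: "sets (restrict_space lborel U) = sets (restrict_space borel U)" by (simp add: sets_restrict_space)
  have msr: "U \<inter> \<Phi> -` B \<in> sets borel" if "B \<in> sets vol" for B
  proof -
    have "\<Phi> -` B \<inter> space (restrict_space lborel U) \<in> sets (restrict_space lborel U)"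
      using parameterization_measurable[OF par lU] that vs by (intro measurable_sets) auto
    then show ?thesis using U by (simp add: sets_on_open[OF U lU] space_restrict_space Int_commute)
  qed
  have img: "\<Phi> ` (U \<inter> \<Phi> -` B) = B \<inter> \<Phi> ` U" for B by auto
  have char: "emeasure vol (B \<inter> \<Phi> ` U) = 0 \<longleftrightarrow> (AE v in lborel. v \<notin> U \<inter> \<Phi> -` B)" if "B \<in> sets vol" for B
    using volume_null_iff[OF vol par msr[OF that]] unfolding img by simp
  have im: "\<Phi> ` U \<in> sets vol"
  proof -
    obtain T where "open T" "\<Phi> ` U = M \<inter> T"
      using par by (auto simp: local_parameterization_def openin_open)
    then show ?thesis unfolding vs sets_restrict_space by auto
  qed
  obtain N where N: "N \<in> null_sets vol" "{x \<in> space vol. \<not> nondegenerate_point TYPE('k) M x} \<subseteq> N"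
    using nd by (auto elim: AE_E3 simp: eventually_ae_filter)
  have "emeasure vol (N \<inter> \<Phi> ` U) \<le> emeasure vol N" using N(1) by (intro emeasure_mono) auto
  moreover have Ns: "N \<in> sets vol" "emeasure vol N = 0" using N(1) by auto
  ultimately have "emeasure vol (N \<inter> \<Phi> ` U) = 0" by simp
  then have "AE v in lborel. v \<notin> U \<inter> \<Phi> -` N" using char[OF Ns(1)] by simp
  moreover have "\<Phi> v \<in> space vol" if "v \<in> U" for v
    using that im sets.sets_into_space by blast
  ultimately have "AE v in lborel. v \<in> U \<longrightarrow> nondegenerate_point TYPE('k) M (\<Phi> v)"
    using N(2) by (auto elim!: eventually_mono)
  then have "AE v in restrict_space lborel U. nondegenerate_point TYPE('k) M (\<Phi> v)"
    using U by (subst AE_restrict_space_iff) auto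
  then have "AE v in restrict_space lborel U. \<Phi> v \<notin> VWA M (c_kd CARD('k) CARD('d))"
    by (intro AE_not_VWA[OF card par locally_finite_restrict_lborel[OF U] lborel_hyperplane_decay[OF U]]) auto
  then have "AE v in lborel. v \<in> U \<longrightarrow> \<Phi> v \<notin> VWA M (c_kd CARD('k) CARD('d))"
    using U by (subst (asm) AE_restrict_space_iff) auto
  then have "AE v in lborel. v \<notin> U \<inter> \<Phi> -` VWA M (c_kd CARD('k) CARD('d))"
    by (auto elim!: eventually_mono)
  then show ?thesis
    using char[of "VWA M (c_kd CARD('k) CARD('d))"] VWA_sets im vs by (auto simp: null_sets_def)
qed

theorem theorem1p5:
  fixes M :: "(real^'d) set"
  assumes "CARD('k::finite) \<le> CARD('d)"
    and "smooth_submanifold TYPE('k) M"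
  shows "(\<forall>vol. volume_measure_on TYPE('k) M vol \<longrightarrow>
            (AE x in vol. nondegenerate_point TYPE('k) M x) \<longrightarrow>
            VWA M (c_kd CARD('k) CARD('d)) \<in> null_sets vol)
       \<and> (\<forall>(U :: (real^'k) set) \<Psi> \<mu>.
            local_parameterization M U \<Psi> \<longrightarrow> absolutely_friendly U \<mu> \<longrightarrow>
            (AE x in pushforward_on M \<Psi> \<mu>. nondegenerate_point TYPE('k) M x) \<longrightarrow>
            VWA M (c_kd CARD('k) CARD('d)) \<in> null_sets (pushforward_on M \<Psi> \<mu>))"
proof (intro conjI allI impI)
  fix vol
  assume vol: "volume_measure_on TYPE('k) M vol" and nd: "AE x in vol. nondegenerate_point TYPE('k) M x"
  define \<V> where "\<V> = {V. \<exists>(U :: (real^'k) set) \<Phi>. local_parameterization M U \<Phi> \<and> V = \<Phi> ` U}"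
  have "openin (top_of_set M) V" if "V \<in> \<V>" for V
    using that by (auto simp: \<V>_def local_parameterization_def)
  then obtain \<W> where \<W>: "\<W> \<subseteq> \<V>" "countable \<W>" "\<Union>\<W> = \<Union>\<V>" by (rule Lindelof_openin)
  have "M \<subseteq> \<Union>\<V>" using assms(2) unfolding smooth_submanifold_def \<V>_def by blast
  then have "VWA M (c_kd CARD('k) CARD('d)) = (\<Union>V\<in>\<W>. VWA M (c_kd CARD('k) CARD('d)) \<inter> V)"
    using \<W>(3) by (auto simp: VWA_def)
  moreover have "(\<Union>V\<in>\<W>. VWA M (c_kd CARD('k) CARD('d)) \<inter> V) \<in> null_sets vol"
    using \<W>(1,2) VWA_null_volume_chart[OF assms(1) vol nd]
    by (intro null_sets_UN') (auto simp: \<V>_def)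
  ultimately show "VWA M (c_kd CARD('k) CARD('d)) \<in> null_sets vol" by simp
next
  fix U :: "(real^'k) set" and \<Psi> \<mu>
  assume "local_parameterization M U \<Psi>" "absolutely_friendly U \<mu>"
    "AE x in pushforward_on M \<Psi> \<mu>. nondegenerate_point TYPE('k) M x"
  then show "VWA M (c_kd CARD('k) CARD('d)) \<in> null_sets (pushforward_on M \<Psi> \<mu>)"
    by (rule VWA_null_pushforward[OF assms(1)])
qed

end
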